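(* There is an algorithm that, given an instance of the line planning on all lines problem (LPAL) whose graph $G$ is a tree with $n$ vertices, with $d_{\mathrm{fix}}=0$ and $f^{\min}_e=f^{\max}_e$ for all edges $e$, computes an optimal (minimum-cost feasible) line concept in $\mathcal{O}(n^3)$ time.
   Context: A line planning instance is a tuple $(G,d_{\mathrm{fix}},c_{\mathrm{fix}},c,f^{\min},f^{\max})$ where $G=(V,E)$ is a finite simple graph with $n=|V|$, $d_{\mathrm{fix}}\ge 0$ and $c_{\mathrm{fix}}\ge 0$ are reals, $c:E\to\mathbb{R}_{\ge 0}$ gives edge costs $c_e$, and $f^{\min},f^{\max}$ assign to each edge integer bounds $f^{\min}_e\le f^{\max}_e$. A line is a simple path in $G$; a line concept $(\mathcal{L},f)$ is a set $\mathcal{L}$ of lines with frequencies $f_\ell\in\mathbb{N}$. It is feasible if for every edge $e$, $f^{\min}_e\le\sum_{\ell\in\mathcal{L}:e\in E(\ell)}f_\ell\le f^{\max}_e$. Its cost is $d_{\mathrm{fix}}|\mathcal{L}|+\sum_{\ell\in\mathcal{L}}f_\ell\,(c_{\mathrm{fix}}+\sum_{e\in E(\ell)}c_e)$. LPAL asks for a feasible line concept of minimum cost. *)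

theory Defs
  imports Complex_Main "HOL-Library.Landau_Symbols"
begin

section \<open>Graphs, lines and line concepts\<close>

type_synonym 'v graph = "'v set \<times> 'v set set"

definition simple_graph :: "'v graph \<Rightarrow> bool" where
  "simple_graph G \<longleftrightarrow> finite (fst G) \<and>
     (\<forall>e \<in> snd G. \<exists>u v. u \<in> fst G \<and> v \<in> fst G \<and> u \<noteq> v \<and> e = {u, v})"

definition path_edges :: "'v list \<Rightarrow> 'v set set" where
  "path_edges xs = {{xs ! i, xs ! Suc i} | i. Suc i < length xs}"

definition walk :: "'v graph \<Rightarrow> 'v list \<Rightarrow> bool" where
  "walk G xs \<longleftrightarrow> xs \<noteq> [] \<and> set xs \<subseteq> fst G \<and> path_edges xs \<subseteq> snd G"

definition simple_path :: "'v graph \<Rightarrow> 'v list \<Rightarrow> bool" where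
  "simple_path G xs \<longleftrightarrow> walk G xs \<and> distinct xs"

definition cycle :: "'v graph \<Rightarrow> 'v list \<Rightarrow> bool" where
  "cycle G xs \<longleftrightarrow> simple_path G xs \<and> 3 \<le> length xs \<and> {last xs, hd xs} \<in> snd G"

definition connected_graph :: "'v graph \<Rightarrow> bool" where
  "connected_graph G \<longleftrightarrow> fst G \<noteq> {} \<and>
     (\<forall>u \<in> fst G. \<forall>v \<in> fst G. \<exists>xs. walk G xs \<and> hd xs = u \<and> last xs = v)"

definition tree :: "'v graph \<Rightarrow> bool" where
  "tree G \<longleftrightarrow> simple_graph G \<and> connected_graph G \<and> (\<nexists>xs. cycle G xs)"

text \<open>A line is an undirected path, i.e. the subgraph traced out by a simple vertex sequence;
  a sequence and its reversal describe the same line.\<close>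

definition line_of :: "'v list \<Rightarrow> 'v graph" where
  "line_of xs = (set xs, path_edges xs)"

definition lines :: "'v graph \<Rightarrow> 'v graph set" where
  "lines G = line_of ` {xs. simple_path G xs}"

record 'v lp_instance =
  network :: "'v graph"
  d_fix :: real
  c_fix :: real
  edge_cost :: "'v set \<Rightarrow> real"
  f_min :: "'v set \<Rightarrow> int"
  f_max :: "'v set \<Rightarrow> int"

definition lp_instance :: "'v lp_instance \<Rightarrow> bool" where
  "lp_instance I \<longleftrightarrow> simple_graph (network I) \<and> 0 \<le> d_fix I \<and> 0 \<le> c_fix I \<and>
     (\<forall>e \<in> snd (network I). 0 \<le> edge_cost I e \<and> f_min I e \<le> f_max I e)"

definition line_concept :: "'v lp_instance \<Rightarrow> 'v graph set \<Rightarrow> ('v graph \<Rightarrow> nat) \<Rightarrow> bool" where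
  "line_concept I L f \<longleftrightarrow> L \<subseteq> lines (network I)"

definition feasible :: "'v lp_instance \<Rightarrow> 'v graph set \<Rightarrow> ('v graph \<Rightarrow> nat) \<Rightarrow> bool" where
  "feasible I L f \<longleftrightarrow> line_concept I L f \<and>
     (\<forall>e \<in> snd (network I).
        f_min I e \<le> int (\<Sum>l \<in> {l \<in> L. e \<in> snd l}. f l) \<and>
        int (\<Sum>l \<in> {l \<in> L. e \<in> snd l}. f l) \<le> f_max I e)"

definition concept_cost :: "'v lp_instance \<Rightarrow> 'v graph set \<Rightarrow> ('v graph \<Rightarrow> nat) \<Rightarrow> real" where
  "concept_cost I L f = d_fix I * real (card L) +
     (\<Sum>l \<in> L. real (f l) * (c_fix I + (\<Sum>e \<in> snd l. edge_cost I e)))"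

definition optimal :: "'v lp_instance \<Rightarrow> 'v graph set \<Rightarrow> ('v graph \<Rightarrow> nat) \<Rightarrow> bool" where
  "optimal I L f \<longleftrightarrow> feasible I L f \<and>
     (\<forall>L' f'. feasible I L' f' \<longrightarrow> concept_cost I L f \<le> concept_cost I L' f')"


section \<open>Unit-cost random access programs\<close>

text \<open>
  Algorithms are programs of a while language on a random access memory that has integer and
  real cells, both as scalar variables and as arrays with computed (indirect) addressing.
  Every operator, memory access, assignment and test costs one unit of time.

  The operations are a subset of those of the usual real RAM: integers and reals can be added,
  subtracted and compared, and integers can be halved and converted to reals. There is
  no multiplication, no rounding of reals to integers, and no real constant other than integers.
\<close>

type_synonym vname = string

datatype iexp =
    ICon int
  | IVar vname
  | IArr vname iexp
  | IPlus iexp iexp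
  | IMinus iexp iexp
  | IHalf iexp

datatype rexp =
    ROfInt iexp
  | RVar vname
  | RArr vname iexp
  | RPlus rexp rexp
  | RMinus rexp rexp

datatype bexp =
    ILess iexp iexp
  | RLess rexp rexp
  | BNot bexp
  | BAnd bexp bexp

datatype com =
    Skip
  | IAssign vname iexp
  | IStore vname iexp iexp
  | RAssign vname rexp
  | RStore vname iexp rexp
  | Seq com com
  | Cond bexp com com
  | While bexp com

record state =
  ivar :: "vname \<Rightarrow> int"
  iarr :: "vname \<Rightarrow> int \<Rightarrow> int"
  rvar :: "vname \<Rightarrow> real"
  rarr :: "vname \<Rightarrow> int \<Rightarrow> real"

fun ival :: "iexp \<Rightarrow> state \<Rightarrow> int" where
  "ival (ICon k) s = k"
| "ival (IVar x) s = ivar s x"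
| "ival (IArr a i) s = iarr s a (ival i s)"
| "ival (IPlus p q) s = ival p s + ival q s"
| "ival (IMinus p q) s = ival p s - ival q s"
| "ival (IHalf p) s = ival p s div 2"

fun rval :: "rexp \<Rightarrow> state \<Rightarrow> real" where
  "rval (ROfInt p) s = real_of_int (ival p s)"
| "rval (RVar x) s = rvar s x"
| "rval (RArr a i) s = rarr s a (ival i s)"
| "rval (RPlus p q) s = rval p s + rval q s"
| "rval (RMinus p q) s = rval p s - rval q s"

fun bval :: "bexp \<Rightarrow> state \<Rightarrow> bool" where
  "bval (ILess p q) s \<longleftrightarrow> ival p s < ival q s"
| "bval (RLess p q) s \<longleftrightarrow> rval p s < rval q s"
| "bval (BNot b) s \<longleftrightarrow> \<not> bval b s"
| "bval (BAnd b c) s \<longleftrightarrow> bval b s \<and> bval c s"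

fun itime :: "iexp \<Rightarrow> nat" where
  "itime (ICon k) = 1"
| "itime (IVar x) = 1"
| "itime (IArr a i) = itime i + 1"
| "itime (IPlus p q) = itime p + itime q + 1"
| "itime (IMinus p q) = itime p + itime q + 1"
| "itime (IHalf p) = itime p + 1"

fun rtime :: "rexp \<Rightarrow> nat" where
  "rtime (ROfInt p) = itime p + 1"
| "rtime (RVar x) = 1"
| "rtime (RArr a i) = itime i + 1"
| "rtime (RPlus p q) = rtime p + rtime q + 1"
| "rtime (RMinus p q) = rtime p + rtime q + 1"

fun btime :: "bexp \<Rightarrow> nat" where
  "btime (ILess p q) = itime p + itime q + 1"
| "btime (RLess p q) = rtime p + rtime q + 1"
| "btime (BNot b) = btime b + 1"
| "btime (BAnd b c) = btime b + btime c + 1"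

text \<open>\<open>runs c s t s'\<close>: started in \<open>s\<close>, program \<open>c\<close> terminates in \<open>s'\<close> after exactly \<open>t\<close> steps.\<close>

inductive runs :: "com \<Rightarrow> state \<Rightarrow> nat \<Rightarrow> state \<Rightarrow> bool" where
  runs_Skip: "runs Skip s 1 s"
| runs_IAssign:
    "runs (IAssign x p) s (itime p + 1) (s\<lparr>ivar := (ivar s)(x := ival p s)\<rparr>)"
| runs_IStore:
    "runs (IStore a i p) s (itime i + itime p + 1)
       (s\<lparr>iarr := (iarr s)(a := (iarr s a)(ival i s := ival p s))\<rparr>)"
| runs_RAssign:
    "runs (RAssign x p) s (rtime p + 1) (s\<lparr>rvar := (rvar s)(x := rval p s)\<rparr>)"
| runs_RStore:
    "runs (RStore a i p) s (itime i + rtime p + 1)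
       (s\<lparr>rarr := (rarr s)(a := (rarr s a)(ival i s := rval p s))\<rparr>)"
| runs_Seq:
    "runs c s t s' \<Longrightarrow> runs d s' t' s'' \<Longrightarrow> runs (Seq c d) s (t + t') s''"
| runs_CondTrue:
    "bval b s \<Longrightarrow> runs c s t s' \<Longrightarrow> runs (Cond b c d) s (btime b + 1 + t) s'"
| runs_CondFalse:
    "\<not> bval b s \<Longrightarrow> runs d s t s' \<Longrightarrow> runs (Cond b c d) s (btime b + 1 + t) s'"
| runs_WhileFalse:
    "\<not> bval b s \<Longrightarrow> runs (While b c) s (btime b + 1) s"
| runs_WhileTrue:
    "bval b s \<Longrightarrow> runs c s t s' \<Longrightarrow> runs (While b c) s' t' s'' \<Longrightarrow>
     runs (While b c) s (btime b + 1 + t + t') s''"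

inductive_cases runs_SkipE: "runs Skip s t s'"
inductive_cases runs_IAssignE: "runs (IAssign x p) s t s'"
inductive_cases runs_IStoreE: "runs (IStore a i p) s t s'"
inductive_cases runs_RAssignE: "runs (RAssign x p) s t s'"
inductive_cases runs_RStoreE: "runs (RStore a i p) s t s'"
inductive_cases runs_SeqE: "runs (Seq c d) s t s'"
inductive_cases runs_CondE: "runs (Cond b c d) s t s'"
inductive_cases runs_WhileE: "runs (While b c) s t s'"

lemma runs_deterministic:
  "runs c s t s' \<Longrightarrow> runs c s u s'' \<Longrightarrow> t = u \<and> s' = s''"
proof (induction arbitrary: u s'' rule: runs.induct)
  case (runs_Skip s)
  from runs_Skip.prems show ?case by (rule runs_SkipE) simp
next
  case (runs_IAssign x p s)
  from runs_IAssign.prems show ?case by (rule runs_IAssignE) simp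
next
  case (runs_IStore a i p s)
  from runs_IStore.prems show ?case by (rule runs_IStoreE) simp
next
  case (runs_RAssign x p s)
  from runs_RAssign.prems show ?case by (rule runs_RAssignE) simp
next
  case (runs_RStore a i p s)
  from runs_RStore.prems show ?case by (rule runs_RStoreE) simp
next
  case (runs_Seq c s t s1 d t' s2)
  from runs_Seq.prems obtain t1 r t2
    where c: "runs c s t1 r" and d: "runs d r t2 s''" and u: "u = t1 + t2"
    by (rule runs_SeqE)
  from runs_Seq.IH(1)[OF c] have r: "t = t1" "s1 = r" by simp_all
  from runs_Seq.IH(2)[OF d[folded r]] r u show ?case by simp
next
  case (runs_CondTrue b s c t s1 d)
  from runs_CondTrue.prems runs_CondTrue.hyps(1) obtain t1
    where c: "runs c s t1 s''" and u: "u = btime b + 1 + t1"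
    by (elim runs_CondE) simp_all
  from runs_CondTrue.IH[OF c] u show ?case by simp
next
  case (runs_CondFalse b s d t s1 c)
  from runs_CondFalse.prems runs_CondFalse.hyps(1) obtain t1
    where d: "runs d s t1 s''" and u: "u = btime b + 1 + t1"
    by (elim runs_CondE) simp_all
  from runs_CondFalse.IH[OF d] u show ?case by simp
next
  case (runs_WhileFalse b s c)
  from runs_WhileFalse.prems show ?case
    by (rule runs_WhileE) (use runs_WhileFalse.hyps in simp_all)
next
  case (runs_WhileTrue b s c t s1 t' s2)
  from runs_WhileTrue.prems obtain t1 r t2
    where c: "runs c s t1 r" and w: "runs (While b c) r t2 s''"
      and u: "u = btime b + 1 + t1 + t2"
    by (rule runs_WhileE) (use runs_WhileTrue.hyps(1) in simp_all)
  from runs_WhileTrue.IH(1)[OF c] have r: "t = t1" "s1 = r" by simp_all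
  from runs_WhileTrue.IH(2)[OF w[folded r]] r u show ?case by simp
qed


section \<open>Input and output format\<close>

text \<open>The vertices are \<open>0, \<dots>, n - 1\<close>, and the edges are listed in arbitrary order
  and orientation.\<close>

definition edge_listing :: "nat graph \<Rightarrow> (nat \<times> nat) list \<Rightarrow> bool" where
  "edge_listing G es \<longleftrightarrow>
     distinct (map (\<lambda>(u, v). {u, v}) es) \<and> set (map (\<lambda>(u, v). {u, v}) es) = snd G"

definition array_of :: "'b::zero list \<Rightarrow> int \<Rightarrow> 'b" where
  "array_of xs i = (if 0 \<le> i \<and> i < int (length xs) then xs ! nat i else 0)"

definition input_state :: "nat lp_instance \<Rightarrow> (nat \<times> nat) list \<Rightarrow> state" where
  "input_state I es = \<lparr>
     ivar = (\<lambda>_. 0)(''n'' := int (card (fst (network I))), ''m'' := int (length es)),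
     iarr = (\<lambda>_ _. 0)(
       ''src'' := array_of (map (\<lambda>(u, v). int u) es),
       ''dst'' := array_of (map (\<lambda>(u, v). int v) es),
       ''fmin'' := array_of (map (\<lambda>(u, v). f_min I {u, v}) es),
       ''fmax'' := array_of (map (\<lambda>(u, v). f_max I {u, v}) es)),
     rvar = (\<lambda>_. 0)(''dfix'' := d_fix I, ''cfix'' := c_fix I),
     rarr = (\<lambda>_ _. 0)(''cost'' := array_of (map (\<lambda>(u, v). edge_cost I {u, v}) es)) \<rparr>"

text \<open>The output lists the lines without repetition. The vertex sequence of the \<open>i\<close>-th line is
  written out in full in \<open>path\<close>, from position \<open>start[i]\<close> up to, but excluding, position
  \<open>start[i+1]\<close>.\<close>

definition outputs :: "state \<Rightarrow> nat graph \<Rightarrow> nat graph set \<Rightarrow> (nat graph \<Rightarrow> nat) \<Rightarrow> bool" where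
  "outputs s G L f \<longleftrightarrow> (\<exists>ps.
     (\<forall>p \<in> set ps. simple_path G p) \<and>
     distinct (map line_of ps) \<and>
     L = set (map line_of ps) \<and>
     ivar s ''k'' = int (length ps) \<and>
     (\<forall>i < length ps.
        iarr s ''freq'' (int i) = int (f (line_of (ps ! i))) \<and>
        iarr s ''start'' (int i + 1) = iarr s ''start'' (int i) + int (length (ps ! i)) \<and>
        (\<forall>j < length (ps ! i).
           iarr s ''path'' (iarr s ''start'' (int i) + int j) = int (ps ! i ! j))))"

text \<open>Instances without a feasible line concept have to be recognised.\<close>

definition solves_LPAL :: "state \<Rightarrow> nat lp_instance \<Rightarrow> bool" where
  "solves_LPAL s I \<longleftrightarrow>
     (if \<exists>L f. feasible I L f
      then ivar s ''feasible'' = 1 \<and> (\<exists>L f. outputs s (network I) L f \<and> optimal I L f)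
      else ivar s ''feasible'' = 0)"

end

theory Submission
  imports Defs
begin

text \<open>
  With \<open>d_fix = 0\<close> and exact demands, all feasible line concepts have the same edge costs, so the number
  of lines (counted with frequency) has to be minimised. Cut into single edges, the demands give
  \<open>\<Sum>e. b e\<close> lines, and joining two line ends at a vertex saves one line. In a tree, any joining that never
  pairs two units of the same edge yields simple paths, so the vertices can be treated independently: at
  \<open>v\<close>, with total demand \<open>S\<close> and maximal demand \<open>M\<close> of an incident edge, exactly
  \<open>min (S div 2) (S - M)\<close> pairs are possible.

  As a path in a tree is determined by its ends, a line concept is a symmetric matrix of frequencies.
  The vertices are processed in arbitrary order; at each one, an optimal pairing is found by sliding two
  pointers along the line ends.
\<close>

section \<open>Paths in acyclic graphs\<close>

text \<open>A line with an edge has one inner vertex less than it has edges, so few lines means many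
  passages through vertices. A passage at \<open>v\<close> uses two units on different edges, so
  there are at most \<open>S div 2\<close>; and one of the two lies off the heaviest edge, so there
  are at most \<open>S - M\<close>. Passages at different vertices do not compete, since an edge
  unit has a separate end at each of its vertices.

  The obstacle is the size of the frequencies: they are unbounded integers, so cubic time in
  \<open>n\<close> forbids handling units one by one. All units at \<open>v\<close> with the same
  far end form a block, and a pointer step joins the whole overlap of two blocks at once; as each
  step advances a pointer, a vertex takes at most \<open>2 * n\<close> of them. Cubic time in total
  also leaves quadratic time per vertex for sorting the line ends by their edge at that vertex and
  for finding the paths towards it, and suffices to write out fewer than \<open>n * n\<close> paths
  of at most \<open>n\<close> vertices each. Lines of frequency \<open>0\<close> may be written too,
  since a line as such is free.\<close>

lemma path_edges_Nil [simp]: "path_edges [] = {}"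
  by (simp add: path_edges_def)

lemma path_edges_single [simp]: "path_edges [x] = {}"
  by (simp add: path_edges_def)

lemma path_edges_Cons [simp]: "path_edges (x # y # zs) = insert {x, y} (path_edges (y # zs))"
proof -
  have "path_edges (x # y # zs) = (\<lambda>i. {(x # y # zs) ! i, (x # y # zs) ! Suc i}) ` {i. Suc i < length (x # y # zs)}"
    by (auto simp: path_edges_def)
  also have "{i. Suc i < length (x # y # zs)} = insert 0 (Suc ` {i. Suc i < length (y # zs)})"
  proof (intro set_eqI iffI)
    fix i assume "i \<in> {i. Suc i < length (x # y # zs)}"
    then show "i \<in> insert 0 (Suc ` {i. Suc i < length (y # zs)})" by (cases i) auto
  qed auto
  also have "(\<lambda>i. {(x # y # zs) ! i, (x # y # zs) ! Suc i}) ` \<dots> = insert {x, y} (path_edges (y # zs))"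
    unfolding image_insert image_image by (auto simp: path_edges_def)
  finally show ?thesis .
qed

lemma path_edges_append:
  "xs \<noteq> [] \<Longrightarrow> path_edges (xs @ y # ys) = insert {last xs, y} (path_edges xs \<union> path_edges (y # ys))"
proof (induction xs)
  case (Cons x xs)
  then show ?case by (cases xs) auto
qed simp

lemma path_edges_rev [simp]: "path_edges (rev xs) = path_edges xs"
proof (induction xs)
  case (Cons x xs)
  show ?case
  proof (cases xs)
    case (Cons y ys)
    then have "rev xs \<noteq> []" "last (rev xs) = y" by auto
    with Cons.IH Cons show ?thesis
      using path_edges_append[of "rev xs" x "[]"] by (simp add: insert_commute)
  qed simp
qed simp

lemma path_edges_subset: "e \<in> path_edges xs \<Longrightarrow> e \<subseteq> set xs"
  by (auto simp: path_edges_def)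

lemma finite_path_edges [simp]: "finite (path_edges xs)"
  by (induction xs rule: induct_list012) auto

lemma card_path_edges: "distinct xs \<Longrightarrow> card (path_edges xs) = length xs - 1"
proof (induction xs rule: induct_list012)
  case (3 x y zs)
  then have "{x, y} \<notin> path_edges (y # zs)"
    using path_edges_subset[of "{x, y}" "y # zs"] by auto
  with 3 show ?case by simp
qed auto

lemma simple_path_Cons [simp]:
  "simple_path G (x # y # zs) \<longleftrightarrow> x \<in> fst G \<and> {x, y} \<in> snd G \<and> x \<notin> set (y # zs) \<and> simple_path G (y # zs)"
  by (auto simp: simple_path_def walk_def)

lemma simple_path_single [simp]: "simple_path G [x] \<longleftrightarrow> x \<in> fst G"
  by (auto simp: simple_path_def walk_def)

lemma simple_path_not_Nil [simp]: "\<not> simple_path G []"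
  by (auto simp: simple_path_def walk_def)

lemma simple_path_rev [simp]: "simple_path G (rev xs) = simple_path G xs"
  by (auto simp: simple_path_def walk_def)

lemma simple_path_suffix: "simple_path G (xs @ ys) \<Longrightarrow> ys \<noteq> [] \<Longrightarrow> simple_path G ys"
proof (induction xs)
  case (Cons x xs)
  then show ?case by (cases "xs @ ys") auto
qed simp

lemma simple_path_prefix: "simple_path G (xs @ ys) \<Longrightarrow> xs \<noteq> [] \<Longrightarrow> simple_path G xs"
  using simple_path_suffix[of G "rev ys" "rev xs"] simple_path_rev[of G "xs @ ys"] by simp

text \<open>Closing up the first common vertex of the two paths would give a cycle.\<close>

lemma diverging_paths_disjoint:
  assumes acyclic: "\<nexists>c. cycle G c"
    and px: "simple_path G (a # xs)" and py: "simple_path G (a # ys)"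
    and ne: "xs \<noteq> []" "ys \<noteq> []" "hd xs \<noteq> hd ys"
  shows "set xs \<inter> set ys = {}"
proof (rule ccontr)
  assume "set xs \<inter> set ys \<noteq> {}"
  then have "\<exists>y \<in> set ys. y \<in> set xs" by auto
  from split_list_first_prop[OF this]
  obtain ys1 y ys2 where ys: "ys = ys1 @ y # ys2" and y: "y \<in> set xs" and n: "\<forall>z \<in> set ys1. z \<notin> set xs"
    by blast
  from y obtain xs1 xs2 where xs: "xs = xs1 @ y # xs2" by (meson split_list)
  define c where "c = a # xs1 @ y # rev ys1"
  have dx: "distinct (a # xs)" and dy: "distinct (a # ys)"
    and vx: "set (a # xs) \<subseteq> fst G" and vy: "set (a # ys) \<subseteq> fst G"
    and ex: "path_edges (a # xs) \<subseteq> snd G" and ey: "path_edges (a # ys) \<subseteq> snd G"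
    using px py by (auto simp: simple_path_def walk_def)
  have "path_edges (a # xs1 @ y # xs2) = insert {last (a # xs1), y} (path_edges (a # xs1) \<union> path_edges (y # xs2))"
    using path_edges_append[of "a # xs1" y xs2] by simp
  with ex xs have ex': "insert {last (a # xs1), y} (path_edges (a # xs1)) \<subseteq> snd G" by auto
  have ey': "insert {a, hd (ys1 @ [y])} (path_edges (ys1 @ [y])) \<subseteq> snd G"
  proof (cases ys1)
    case Nil
    with ey ys show ?thesis by (cases ys2) auto
  next
    case (Cons z zs)
    with ey ys path_edges_append[of ys1 y ys2] path_edges_append[of ys1 y "[]"] show ?thesis
      by auto
  qed
  have "path_edges (y # rev ys1) = path_edges (ys1 @ [y])"
    using path_edges_rev[of "ys1 @ [y]"] by simp
  then have "path_edges c \<subseteq> snd G"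
    using path_edges_append[of "a # xs1" y "rev ys1"] ex' ey' by (auto simp: c_def)
  moreover have "distinct c" "set c \<subseteq> fst G"
    using dx dy xs ys n vx vy by (auto simp: c_def)
  ultimately have "simple_path G c" by (auto simp: simple_path_def walk_def c_def)
  moreover have "last c = hd (ys1 @ [y])"
    by (cases ys1) (auto simp: c_def)
  then have "{last c, hd c} \<in> snd G" using ey' by (auto simp: c_def insert_commute)
  moreover have "3 \<le> length c"
  proof -
    \<comment> \<open>If both were empty, \<open>y\<close> would be the head of both lists; so
      \<open>c\<close> has a vertex besides \<open>a\<close> and \<open>y\<close>.\<close>
    have "xs1 \<noteq> [] \<or> ys1 \<noteq> []" using ne(3) xs ys by auto
    then show ?thesis by (cases xs1; cases ys1) (auto simp: c_def)
  qed
  ultimately have "cycle G c" by (simp add: cycle_def)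
  with acyclic show False by blast
qed

text \<open>Paths that part ways have disjoint tails and cannot end in the same vertex, so the two
  agree step by step.\<close>

lemma simple_path_unique:
  assumes acyclic: "\<nexists>c. cycle G c"
  shows "simple_path G (a # xs) \<Longrightarrow> simple_path G (a # ys) \<Longrightarrow> last (a # xs) = last (a # ys) \<Longrightarrow> xs = ys"
proof (induction xs arbitrary: a ys)
  case Nil
  then show ?case
    using last_in_set[of ys] by (auto simp: simple_path_def split: if_splits)
next
  case (Cons x xs)
  show ?case
  proof (cases ys)
    case Nil
    have "last (x # xs) = a" using Cons.prems(3) Nil by simp
    then have "a \<in> set (x # xs)" using last_in_set[of "x # xs"] by simp
    with Cons.prems(1) show ?thesis by simp
  next
    case (Cons y ys')
    have "x = y"
    proof (rule ccontr)
      assume "x \<noteq> y"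
      then have "set (x # xs) \<inter> set ys = {}"
        using diverging_paths_disjoint[OF acyclic Cons.prems(1,2)] Cons by auto
      moreover have "last (x # xs) \<in> set (x # xs)" "last ys \<in> set ys"
        using Cons by (intro last_in_set; simp)+
      moreover have "last (x # xs) = last ys" using Cons.prems(3) Cons by simp
      ultimately show False by auto
    qed
    with Cons Cons.prems Cons.IH[of x ys'] show ?thesis by simp
  qed
qed

text \<open>If the new first vertex already occurs on the path built for the rest, everything before
  that occurrence is cut off.\<close>

lemma walk_to_simple_path:
  "walk G xs \<Longrightarrow> \<exists>ys. simple_path G ys \<and> hd ys = hd xs \<and> last ys = last xs"
proof (induction xs rule: induct_list012)
  case 1
  then show ?case by (simp add: walk_def)
next
  case (2 x)
  then show ?case by (intro exI[of _ "[x]"]) (auto simp: walk_def)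
next
  case (3 x y zs)
  then have "walk G (y # zs)" by (auto simp: walk_def)
  with 3 obtain ys where ys: "simple_path G ys" "hd ys = y" "last ys = last (y # zs)" by auto
  show ?case
  proof (cases "x \<in> set ys")
    case True
    then obtain us vs where "ys = us @ x # vs" by (meson split_list)
    with ys simple_path_suffix[of G us "x # vs"] show ?thesis
      by (intro exI[of _ "x # vs"]) simp
  next
    case False
    from ys obtain ys' where "ys = y # ys'" by (cases ys) auto
    with ys False 3 show ?thesis
      by (intro exI[of _ "x # ys"]) (auto simp: walk_def)
  qed
qed

section \<open>Passing through a vertex versus ending there\<close>

definition inner_vertices :: "'v list \<Rightarrow> 'v set" where
  "inner_vertices xs = set xs - {hd xs, last xs}"

lemma inner_vertex_split:
  assumes "v \<in> inner_vertices xs"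
  obtains ys a b zs where "xs = ys @ a # v # b # zs"
proof -
  from assms have "v \<in> set xs" "v \<noteq> hd xs" "v \<noteq> last xs" by (auto simp: inner_vertices_def)
  then obtain us vs where xs: "xs = us @ v # vs" by (meson split_list)
  with \<open>v \<noteq> hd xs\<close> obtain ys a where "us = ys @ [a]" by (cases us rule: rev_cases) auto
  moreover from xs \<open>v \<noteq> last xs\<close> obtain b zs where "vs = b # zs" by (cases vs) auto
  ultimately show thesis using xs that by simp
qed

text \<open>An end of a path meets only one of its edges, so this tells passing from ending. The
  bound on passages at a vertex and the recovery of the ends of a line both rest on it.\<close>

lemma inner_vertex_two_edges:
  assumes "distinct xs" "v \<in> inner_vertices xs"
  obtains e1 e2 where "e1 \<noteq> e2" "e1 \<in> path_edges xs" "e2 \<in> path_edges xs" "v \<in> e1" "v \<in> e2"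
proof -
  from assms(2) obtain ys a b zs where xs: "xs = ys @ a # v # b # zs" by (rule inner_vertex_split)
  have "{a, v} \<noteq> {v, b}" using assms(1) xs by (auto simp: doubleton_eq_iff)
  moreover have "{a, v} \<in> path_edges xs" "{v, b} \<in> path_edges xs"
    using path_edges_append[of "ys @ [a]" v "b # zs"] unfolding xs by simp_all
  ultimately show thesis by (rule that) auto
qed

lemma card_inner_vertices: "distinct xs \<Longrightarrow> card (inner_vertices xs) = length xs - 2"
proof (cases xs)
  case (Cons x ys)
  assume d: "distinct xs"
  show ?thesis
  proof (cases "ys = []")
    case False
    then have "x \<noteq> last ys" using d Cons last_in_set[OF False] by auto
    then have "card {hd xs, last xs} = 2" using Cons False by auto
    moreover have "{hd xs, last xs} \<subseteq> set xs" using Cons False by auto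
    ultimately show ?thesis
      using d by (simp add: inner_vertices_def card_Diff_subset distinct_card)
  qed (use Cons in \<open>simp add: inner_vertices_def\<close>)
qed (simp add: inner_vertices_def)

lemma hd_edge:
  "distinct (x # y # ys) \<Longrightarrow> e \<in> path_edges (x # y # ys) \<Longrightarrow> x \<in> e \<Longrightarrow> e = {x, y}"
  using path_edges_subset[of e "y # ys"] by auto

text \<open>Equality holds from two vertices on; the inequality also admits one-vertex lines, which
  have neither edges nor inner vertices.\<close>

lemma card_path_edges_inner:
  "distinct xs \<Longrightarrow> card (path_edges xs) \<le> card (inner_vertices xs) + 1"
  by (simp add: card_path_edges card_inner_vertices)


section \<open>Paths in trees\<close>

locale tree_graph =
  fixes G :: "nat graph" and n :: nat
  assumes tree: "tree G" and vertices: "fst G = {..<n}"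
begin

abbreviation "V \<equiv> {..<n}"
abbreviation "E \<equiv> snd G"

lemma acyclic: "\<nexists>c. cycle G c"
  using tree by (simp add: tree_def)

lemma edgeE:
  assumes "e \<in> E"
  obtains u v where "u < n" "v < n" "u \<noteq> v" "e = {u, v}"
proof -
  from tree assms have "\<exists>u v. u \<in> fst G \<and> v \<in> fst G \<and> u \<noteq> v \<and> e = {u, v}"
    by (simp add: tree_def simple_graph_def)
  then obtain u v where "u \<in> fst G" "v \<in> fst G" "u \<noteq> v" "e = {u, v}" by blast
  then show thesis using vertices by (intro that[of u v]) auto
qed

lemma finite_E [simp]: "finite E"
proof -
  have "E \<subseteq> Pow V" by (auto elim!: edgeE)
  then show ?thesis by (rule finite_subset) simp
qed

lemma ex1_tree_path:
  assumes "u < n" "w < n"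
  shows "\<exists>!xs. simple_path G xs \<and> hd xs = u \<and> last xs = w"
proof -
  have "\<forall>u \<in> fst G. \<forall>v \<in> fst G. \<exists>xs. walk G xs \<and> hd xs = u \<and> last xs = v"
    using tree by (simp add: tree_def connected_graph_def)
  then obtain xs where "walk G xs" "hd xs = u" "last xs = w" using assms vertices by blast
  then have "\<exists>xs. simple_path G xs \<and> hd xs = u \<and> last xs = w"
    using walk_to_simple_path[of G xs] by auto
  moreover have "xs = ys" if "simple_path G xs" "hd xs = u" "last xs = w"
    and "simple_path G ys" "hd ys = u" "last ys = w" for xs ys
  proof (cases xs)
    case (Cons x xs')
    moreover from that obtain ys' where "ys = x # ys'" using Cons by (cases ys) auto
    moreover have "last xs = last ys" using that by simp
    ultimately show ?thesis using simple_path_unique[OF acyclic, of x xs' ys'] that(1,4) by simp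
  qed (use that in auto)
  ultimately show ?thesis by blast
qed

definition tpath :: "nat \<Rightarrow> nat \<Rightarrow> nat list" where
  "tpath u w = (THE xs. simple_path G xs \<and> hd xs = u \<and> last xs = w)"

text \<open>For \<open>u \<noteq> w\<close> it names the edge by which a line with ends
  \<open>u\<close> and \<open>w\<close> leaves \<open>u\<close>. The convention for
  \<open>u = w\<close> keeps the value a vertex, so that every vertex falls into exactly one group
  in the pairing at \<open>u\<close>.\<close>

definition next_hop :: "nat \<Rightarrow> nat \<Rightarrow> nat" where
  "next_hop u w = (if u = w then u else tpath u w ! 1)"

abbreviation "tedges u w \<equiv> path_edges (tpath u w)"
abbreviation "inner u w \<equiv> inner_vertices (tpath u w)"

lemma tpath:
  assumes "u < n" "w < n"
  shows simple_tpath: "simple_path G (tpath u w)" and hd_tpath: "hd (tpath u w) = u"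
    and last_tpath: "last (tpath u w) = w"
  using theI'[OF ex1_tree_path[OF assms]] by (auto simp: tpath_def)

lemma tpath_eqI:
  assumes "simple_path G xs" "hd xs = u" "last xs = w"
  shows "tpath u w = xs"
proof -
  have "xs \<noteq> []" using assms(1) by auto
  then have "u \<in> set xs" "w \<in> set xs" using assms by auto
  then have "u < n" "w < n" using assms(1) vertices by (auto simp: simple_path_def walk_def)
  from the1_equality[OF ex1_tree_path[OF this], of xs] assms show ?thesis by (simp add: tpath_def)
qed

lemma distinct_tpath: "u < n \<Longrightarrow> w < n \<Longrightarrow> distinct (tpath u w)"
  using simple_tpath by (simp add: simple_path_def)

lemma tpath_refl [simp]: "u < n \<Longrightarrow> tpath u u = [u]"
  using vertices by (intro tpath_eqI) auto

lemma tpath_edge: "{u, w} \<in> E \<Longrightarrow> tpath u w = [u, w]"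
  by (intro tpath_eqI) (auto elim!: edgeE simp: vertices doubleton_eq_iff)

lemma tpath_commute: "u < n \<Longrightarrow> w < n \<Longrightarrow> tpath w u = rev (tpath u w)"
  using tpath[of u w] by (intro tpath_eqI) (auto simp: hd_rev last_rev)

lemma tedges_commute: "u < n \<Longrightarrow> w < n \<Longrightarrow> tedges w u = tedges u w"
  by (simp add: tpath_commute[of u w])

lemma inner_commute: "u < n \<Longrightarrow> w < n \<Longrightarrow> inner w u = inner u w"
  by (auto simp: tpath_commute[of u w] inner_vertices_def hd_rev last_rev)

lemma set_tpath: "u < n \<Longrightarrow> w < n \<Longrightarrow> set (tpath u w) \<subseteq> V"
  using simple_tpath vertices by (auto simp: simple_path_def walk_def)

lemma tedges_subset: "u < n \<Longrightarrow> w < n \<Longrightarrow> tedges u w \<subseteq> E"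
  using simple_tpath by (auto simp: simple_path_def walk_def)

lemma length_tpath_le: "u < n \<Longrightarrow> w < n \<Longrightarrow> length (tpath u w) \<le> n"
  using card_mono[OF _ set_tpath, of u w] distinct_card[OF distinct_tpath, of u w] by simp

lemma tpath_Cons:
  assumes "u < n" "w < n" "u \<noteq> w"
  shows "tpath u w = u # tpath (next_hop u w) w" and "next_hop u w < n" and "{u, next_hop u w} \<in> E"
    and "next_hop u w \<noteq> u"
proof -
  note t = tpath[OF assms(1,2)]
  obtain y ys where xs: "tpath u w = u # y # ys"
  proof (cases "tpath u w")
    case Nil
    with t show thesis by simp
  next
    case (Cons a list)
    moreover have "list \<noteq> []" using t assms(3) Cons by auto
    ultimately show thesis using t(2) that by (cases list) auto
  qed
  have y: "next_hop u w = y" using xs assms(3) by (simp add: next_hop_def)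
  have "simple_path G (y # ys)" "last (y # ys) = w" using t xs by auto
  then have "tpath y w = y # ys" by (intro tpath_eqI) auto
  with xs y show "tpath u w = u # tpath (next_hop u w) w" by simp
  show "next_hop u w < n" "{u, next_hop u w} \<in> E" "next_hop u w \<noteq> u"
    using t xs y set_tpath[OF assms(1,2)] by auto
qed

lemma next_hop_refl [simp]: "next_hop u u = u"
  by (simp add: next_hop_def)

lemma next_hop_less: "u < n \<Longrightarrow> w < n \<Longrightarrow> next_hop u w < n"
  using tpath_Cons(2) by (cases "u = w") auto

text \<open>Prepending \<open>u\<close> to the path of \<open>v\<close> keeps it simple, and by
  uniqueness it is the path of \<open>u\<close>.\<close>

lemma tpath_extend:
  assumes "{u, v} \<in> E" "w < n" "u \<notin> set (tpath v w)"
  shows "next_hop u w = v"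
proof -
  have uv: "u < n" "v < n" using assms(1) by (auto elim!: edgeE simp: doubleton_eq_iff)
  note t = tpath[OF uv(2) assms(2)]
  then obtain ys where ys: "tpath v w = v # ys" by (cases "tpath v w") auto
  have "tpath u w = u # v # ys"
    using assms t ys uv vertices by (intro tpath_eqI) auto
  moreover have "u \<noteq> w" using assms(3) t(1,3) by (metis last_in_set simple_path_not_Nil)
  ultimately show ?thesis by (simp add: next_hop_def)
qed

text \<open>The branches from \<open>v\<close> to \<open>a\<close> and to \<open>b\<close> meet only
  in \<open>v\<close>, so one reversed and followed by the other is simple, and uniqueness makes it
  the path from \<open>a\<close> to \<open>b\<close>. Two lines ending at \<open>v\<close> may thus
  be joined as soon as their edges at \<open>v\<close> differ, however long they are.\<close>

lemma diverge:
  assumes "v < n" "a < n" "b < n" "v \<noteq> a" "v \<noteq> b" "next_hop v a \<noteq> next_hop v b"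
  shows "tedges a b = tedges v a \<union> tedges v b" and "tedges v a \<inter> tedges v b = {}"
    and "inner a b \<subseteq> insert v (inner v a \<union> inner v b)" and "a \<noteq> b"
proof -
  obtain xs where xs: "tpath v a = v # xs" "tpath (next_hop v a) a = xs"
    using tpath_Cons[of v a] assms by auto
  obtain ys where ys: "tpath v b = v # ys" "tpath (next_hop v b) b = ys"
    using tpath_Cons[of v b] assms by auto
  note ta = tpath[OF assms(1,2)] and tb = tpath[OF assms(1,3)]
  have hd: "xs \<noteq> []" "ys \<noteq> []" "hd xs = next_hop v a" "hd ys = next_hop v b"
    using tpath[of "next_hop v a" a] tpath[of "next_hop v b" b] tpath_Cons(2) assms xs ys by auto
  have disj: "set xs \<inter> set ys = {}"
    using diverging_paths_disjoint[OF acyclic, of v xs ys] ta tb xs ys assms(6) hd by simp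
  have la: "last xs = a" and lb: "last ys = b" using xs ys ta tb hd by auto
  have v: "v \<notin> set xs" "v \<notin> set ys"
    using ta(1) tb(1) xs ys by (auto simp: simple_path_def)
  obtain y ys' where y: "ys = y # ys'" using hd by (cases ys) auto
  have pe: "path_edges (rev (v # xs) @ ys) = path_edges (v # xs) \<union> path_edges (v # ys)"
    using path_edges_append[of "rev (v # xs)" y ys'] path_edges_rev[of "v # xs"] y
    by (auto simp: last_rev)
  have "simple_path G (rev (v # xs) @ ys)"
    using ta(1) tb(1) disj v pe xs(1) ys(1) by (auto simp: simple_path_def walk_def simp del: rev.simps)
  moreover have "hd (rev (v # xs) @ ys) = a" "last (rev (v # xs) @ ys) = b"
    using hd la lb by (auto simp: hd_append hd_rev)
  ultimately have ab: "tpath a b = rev (v # xs) @ ys" by (rule tpath_eqI)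
  then show "tedges a b = tedges v a \<union> tedges v b" using pe xs ys by simp
  show "inner a b \<subseteq> insert v (inner v a \<union> inner v b)"
    using ab xs ys hd la lb by (auto simp: inner_vertices_def hd_append hd_rev)
  show "a \<noteq> b" using la lb hd disj by (metis disjoint_iff last_in_set)
  show "tedges v a \<inter> tedges v b = {}"
  proof (rule ccontr)
    assume "tedges v a \<inter> tedges v b \<noteq> {}"
    then obtain e where e: "e \<in> tedges v a" "e \<in> tedges v b" by auto
    \<comment> \<open>A common edge would have to lie inside the single common vertex of both
      branches.\<close>
    then have "e \<subseteq> {v}" using path_edges_subset[of e "v # xs"] path_edges_subset[of e "v # ys"] xs ys disj
      by auto
    moreover have "e \<in> E" using e tedges_subset assms by auto
    ultimately show False by (auto elim!: edgeE)
  qed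
qed

lemma incident_tedges_iff:
  assumes "v < n" "w < n" "{v, g} \<in> E"
  shows "{v, g} \<in> tedges v w \<longleftrightarrow> next_hop v w = g"
proof (cases "v = w")
  case True
  with assms show ?thesis by (auto elim!: edgeE)
next
  case False
  note t = tpath_Cons[OF assms(1,2) False]
  have "hd (tpath (next_hop v w) w) = next_hop v w" "tpath (next_hop v w) w \<noteq> []"
    using tpath[OF t(2) assms(2)] by auto
  then obtain ys where ys: "tpath v w = v # next_hop v w # ys"
    using t by (cases "tpath (next_hop v w) w") auto
  have "distinct (v # next_hop v w # ys)" using distinct_tpath[OF assms(1,2)] ys by simp
  from hd_edge[OF this, of "{v, g}"] show ?thesis using ys by (auto simp: doubleton_eq_iff)
qed

lemma endpoint_edge:
  assumes "v < n" "w < n" "v \<noteq> w" "e \<in> tedges v w" "v \<in> e"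
  shows "e = {v, next_hop v w}"
proof -
  have "e \<in> E" using tedges_subset assms by auto
  then obtain g where "e = {v, g}" using assms(5) by (auto elim!: edgeE)
  with incident_tedges_iff[OF assms(1,2)] \<open>e \<in> E\<close> assms(4) show ?thesis by auto
qed

text \<open>If \<open>u\<close> lies on the path from \<open>v\<close> to \<open>w\<close>, the part
  up to \<open>u\<close> is the path from \<open>v\<close> to \<open>u\<close>, that is, the edge
  itself; otherwise \<open>u\<close> can be prepended.\<close>

lemma edge_next_hop:
  assumes "{u, v} \<in> E" "w < n"
  shows "next_hop u w = v \<or> next_hop v w = u"
proof (cases "u \<in> set (tpath v w)")
  case True
  have uv: "u < n" "v < n" "u \<noteq> v" using assms(1) by (auto elim!: edgeE simp: doubleton_eq_iff)
  note t = tpath[OF uv(2) assms(2)]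
  from True obtain us zs where s: "tpath v w = us @ u # zs" by (meson split_list)
  have "simple_path G ((us @ [u]) @ zs)" using t(1) s by simp
  then have "simple_path G (us @ [u])" by (rule simple_path_prefix) simp
  moreover have "hd (us @ [u]) = v" using t(2) s by (cases us) auto
  ultimately have "tpath v u = us @ [u]" by (intro tpath_eqI) auto
  moreover have "tpath v u = [v, u]" using assms(1) by (intro tpath_edge) (simp add: insert_commute)
  ultimately have us: "us = [v]" by simp
  have "v \<noteq> w"
  proof
    assume "v = w"
    then show False using s us uv assms(2) by simp
  qed
  then have "next_hop v w = u" using s us by (simp add: next_hop_def)
  then show ?thesis ..
qed (use tpath_extend[OF assms] in simp)

text \<open>Root the tree at \<open>0\<close>: every edge is the first one on the way from one of
  its ends to the root. The root contributes the singleton \<open>{0}\<close>, so the count gives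
  \<open>n\<close> and not the sharp \<open>n - 1\<close>, which is enough to bound loops over
  edges.\<close>

lemma card_E_le: "card E \<le> n"
proof (cases "n = 0")
  case False
  have "E \<subseteq> (\<lambda>u. {u, next_hop u 0}) ` V"
  proof
    fix e assume "e \<in> E"
    then obtain u v where "u < n" "v < n" "e = {u, v}" by (auto elim!: edgeE)
    moreover from this edge_next_hop[of u v 0] \<open>e \<in> E\<close> False
    have "next_hop u 0 = v \<or> next_hop v 0 = u" by auto
    ultimately show "e \<in> (\<lambda>u. {u, next_hop u 0}) ` V" by (auto simp: insert_commute)
  qed
  from card_mono[OF _ this] card_image_le[of V "\<lambda>u. {u, next_hop u 0}"] show ?thesis by simp
next
  case True
  then have "E = {}" by (auto elim!: edgeE)
  then show ?thesis by simp
qed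

text \<open>Lines are subgraphs but are counted by their ends, so the ends must be recoverable: an
  end of one path that is no end of the other would meet one path edge in the first and two in the
  second.\<close>

lemma line_of_tpath_eqD:
  assumes "u < n" "w < n" "u \<noteq> w" "u' < n" "w' < n" "u' \<noteq> w'"
    and eq: "line_of (tpath u w) = line_of (tpath u' w')"
  shows "{u, w} = {u', w'}"
proof -
  have edges: "tedges u w = tedges u' w'" and verts: "set (tpath u w) = set (tpath u' w')"
    using eq by (auto simp: line_of_def)
  have *: "x \<in> {u', w'}" if x: "{x, y} = {u, w}" for x y
  proof (rule ccontr)
    assume x': "x \<notin> {u', w'}"
    have xy: "x < n" "y < n" "x \<noteq> y" using that assms by (auto simp: doubleton_eq_iff)
    have te: "tedges x y = tedges u' w'"
      using x edges tedges_commute[OF assms(1,2)] by (auto simp: doubleton_eq_iff)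
    have "{u, w} \<subseteq> set (tpath u w)"
      using tpath[OF assms(1,2)] by (metis hd_in_set last_in_set insert_subset empty_subsetI simple_path_not_Nil)
    then have "x \<in> set (tpath u' w')" using x verts by auto
    with x' have "x \<in> inner u' w'" using tpath[OF assms(4,5)] by (simp add: inner_vertices_def)
    from inner_vertex_two_edges[OF distinct_tpath[OF assms(4,5)] this] obtain e1 e2
      where "e1 \<noteq> e2" "e1 \<in> tedges x y" "e2 \<in> tedges x y" "x \<in> e1" "x \<in> e2"
      using te by metis
    with endpoint_edge[OF xy] show False by metis
  qed
  from *[of u w] *[of w u] assms(3,6) show ?thesis by (auto simp: doubleton_eq_iff)
qed

end

section \<open>The minimum number of lines\<close>

lemma finite_lines:
  assumes "simple_graph G"
  shows "finite (lines G)"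
proof -
  have "{xs. simple_path G xs} \<subseteq> {xs. set xs \<subseteq> fst G \<and> distinct xs}"
    by (auto simp: simple_path_def walk_def)
  moreover have "finite {xs. set xs \<subseteq> fst G \<and> distinct xs}"
    using assms by (intro finite_subset_distinct) (simp add: simple_graph_def)
  ultimately show ?thesis unfolding lines_def using finite_subset by blast
qed

locale fixed_demand = tree_graph "network I" n for I :: "nat lp_instance" and n +
  assumes valid_instance: "lp_instance I" and no_fixed_cost: "d_fix I = 0"
    and exact: "\<And>e. e \<in> snd (network I) \<Longrightarrow> f_min I e = f_max I e"
begin

abbreviation "b \<equiv> f_min I"

definition incident :: "nat \<Rightarrow> nat set set" where
  "incident v = {e \<in> E. v \<in> e}"

definition load :: "nat \<Rightarrow> int" where
  "load v = (\<Sum>e \<in> incident v. b e)"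

text \<open>The inserted \<open>0\<close> keeps \<open>Max\<close> defined when no edge meets
  \<open>v\<close>, as in the one-vertex tree.\<close>

definition max_load :: "nat \<Rightarrow> int" where
  "max_load v = Max (insert 0 (b ` incident v))"

text \<open>The largest number of pairs of edge units at \<open>v\<close> in which no unit is paired with another
  unit of the same edge.\<close>

definition pairs_at :: "nat \<Rightarrow> int" where
  "pairs_at v = min (load v div 2) (load v - max_load v)"

lemma finite_incident [simp]: "finite (incident v)"
  by (simp add: incident_def)

lemma feasible_finite: "feasible I L f \<Longrightarrow> finite L"
  using finite_lines[of "network I"] valid_instance finite_subset[of L "lines (network I)"]
  by (simp add: feasible_def line_concept_def lp_instance_def)

text \<open>Double counting: the demand on \<open>A\<close> is collected line by line. It is applied
  to all edges, to the edges at a vertex, and to those edges without one of them.\<close>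

lemma feasible_demand:
  assumes "feasible I L f" "A \<subseteq> E"
  shows "(\<Sum>e\<in>A. b e) = (\<Sum>l\<in>L. int (f l) * int (card (A \<inter> snd l)))"
proof -
  note fin = feasible_finite[OF assms(1)]
  have finA: "finite A" using assms(2) by (rule finite_subset) simp
  have "b e = (\<Sum>l\<in>L. int (f l) * (if e \<in> snd l then 1 else 0))" if "e \<in> A" for e
  proof -
    have "e \<in> E" using that assms(2) by auto
    with assms(1) exact have "b e = int (\<Sum>l \<in> {l \<in> L. e \<in> snd l}. f l)"
      by (force simp: feasible_def)
    also have "\<dots> = (\<Sum>l\<in>L. int (f l) * (if e \<in> snd l then 1 else 0))"
      using fin by (simp add: sum.inter_filter of_nat_sum if_distrib cong: if_cong)
    finally show ?thesis .
  qed
  then have "(\<Sum>e\<in>A. b e) = (\<Sum>e\<in>A. \<Sum>l\<in>L. int (f l) * (if e \<in> snd l then 1 else 0))" by simp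
  also have "\<dots> = (\<Sum>l\<in>L. int (f l) * (\<Sum>e\<in>A. if e \<in> snd l then 1 else 0))"
    by (subst sum.swap) (simp add: sum_distrib_left)
  also have "\<dots> = (\<Sum>l\<in>L. int (f l) * int (card (A \<inter> snd l)))"
  proof (intro sum.cong refl)
    fix l :: "nat graph"
    have "(\<Sum>e\<in>A. if e \<in> snd l then 1 else 0) = (\<Sum>e\<in>A \<inter> snd l. 1::int)"
      by (rule sum.inter_restrict[symmetric, OF finA])
    then show "int (f l) * (\<Sum>e\<in>A. if e \<in> snd l then 1 else 0) = int (f l) * int (card (A \<inter> snd l))"
      by simp
  qed
  finally show ?thesis .
qed

text \<open>A line with at least one edge has one inner vertex less than it has edges, and the lines with
  inner vertex \<open>v\<close> pair off units of distinct edges at \<open>v\<close>.\<close>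

lemma lines_lower_bound:
  assumes "feasible I L f"
  shows "(\<Sum>e\<in>E. b e) - (\<Sum>v<n. pairs_at v) \<le> (\<Sum>l\<in>L. int (f l))"
proof -
  note fin = feasible_finite[OF assms]
  have "\<forall>l\<in>L. \<exists>p. simple_path (network I) p \<and> line_of p = l"
    using assms unfolding feasible_def line_concept_def lines_def by blast
  then obtain p where p: "\<And>l. l \<in> L \<Longrightarrow> simple_path (network I) (p l)" "\<And>l. l \<in> L \<Longrightarrow> line_of (p l) = l"
    by metis
  then have snd: "snd l = path_edges (p l)" if "l \<in> L" for l using that by (metis line_of_def snd_conv)
  have dist: "distinct (p l)" and sub: "snd l \<subseteq> E" and vs: "inner_vertices (p l) \<subseteq> V" if "l \<in> L" for l
    using p(1)[OF that] snd[OF that] vertices by (auto simp: simple_path_def walk_def inner_vertices_def)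
  \<comment> \<open>Passages through \<open>v\<close>, with multiplicity; summed over all
    \<open>v\<close> they count the inner vertices of all lines.\<close>
  define thru where "thru v = (\<Sum>l\<in>L. int (f l) * (if v \<in> inner_vertices (p l) then 1 else 0))" for v
  have thru_le: "thru v \<le> pairs_at v" for v
  proof -
    have two: "\<exists>e1 e2. e1 \<noteq> e2 \<and> {e1, e2} \<subseteq> incident v \<inter> snd l" 
      if l: "l \<in> L" "v \<in> inner_vertices (p l)" for l
    proof -
      obtain e1 e2 where "e1 \<noteq> e2" "e1 \<in> path_edges (p l)" "e2 \<in> path_edges (p l)" "v \<in> e1" "v \<in> e2"
        using inner_vertex_two_edges[OF dist[OF l(1)] l(2)] .
      then show ?thesis using snd[OF l(1)] sub[OF l(1)]
        by (intro exI[of _ e1] exI[of _ e2]) (auto simp: incident_def)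
    qed
    have "2 * thru v \<le> load v"
    proof -
      have "2 * thru v = (\<Sum>l\<in>L. int (f l) * (if v \<in> inner_vertices (p l) then 2 else 0))"
        unfolding thru_def sum_distrib_left by (intro sum.cong) auto
      also have "\<dots> \<le> (\<Sum>l\<in>L. int (f l) * int (card (incident v \<inter> snd l)))"
      proof (intro sum_mono mult_left_mono)
        fix l assume l: "l \<in> L"
        show "(if v \<in> inner_vertices (p l) then 2 else 0) \<le> int (card (incident v \<inter> snd l))"
        proof (cases "v \<in> inner_vertices (p l)")
          case True
          from two[OF l True] obtain e1 e2 where e: "e1 \<noteq> e2" "{e1, e2} \<subseteq> incident v \<inter> snd l" by blast
          from card_mono[OF _ e(2)] e(1) True show ?thesis by simp
        qed simp
      qed simp
      also have "\<dots> = load v"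
        unfolding load_def by (rule feasible_demand[symmetric, OF assms]) (auto simp: incident_def)
      finally show ?thesis .
    qed
    moreover have thru0: "0 \<le> thru v" unfolding thru_def by (intro sum_nonneg) auto
    \<comment> \<open>Of the two edges at \<open>v\<close> that a passing line uses, one differs
      from \<open>e\<close>.\<close>
    moreover have "thru v \<le> load v - b e" if e: "e \<in> incident v" for e
    proof -
      have "thru v \<le> (\<Sum>l\<in>L. int (f l) * int (card ((incident v - {e}) \<inter> snd l)))"
        unfolding thru_def
      proof (intro sum_mono mult_left_mono)
        fix l assume l: "l \<in> L"
        show "(if v \<in> inner_vertices (p l) then 1 else 0) \<le> int (card ((incident v - {e}) \<inter> snd l))"
        proof (cases "v \<in> inner_vertices (p l)")
          case True
          from two[OF l True] obtain e' where "e' \<in> (incident v - {e}) \<inter> snd l" by blast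
          then have "0 < card ((incident v - {e}) \<inter> snd l)"
            unfolding card_gt_0_iff by auto
          then show ?thesis unfolding if_P[OF True] by linarith
        qed simp
      qed simp
      also have "\<dots> = (\<Sum>e\<in>incident v - {e}. b e)"
        by (rule feasible_demand[symmetric, OF assms]) (auto simp: incident_def)
      also have "\<dots> = load v - b e"
        using e by (simp add: load_def sum_diff1)
      finally show ?thesis .
    qed
    \<comment> \<open>If the maximum is the inserted \<open>0\<close>, the required
      \<open>thru v \<le> load v\<close> follows from the bound on \<open>2 * thru v\<close> and
      \<open>0 \<le> thru v\<close>.\<close>
    moreover have "max_load v \<in> insert 0 (b ` incident v)"
      unfolding max_load_def by (rule Max_in) auto
    ultimately have "thru v \<le> load v - max_load v" by auto
    with \<open>2 * thru v \<le> load v\<close> show ?thesis unfolding pairs_at_def by linarith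
  qed
  have "(\<Sum>e\<in>E. b e) = (\<Sum>l\<in>L. int (f l) * int (card (snd l)))"
    using feasible_demand[OF assms order.refl] sub by (simp add: Int_absorb1 cong: sum.cong)
  moreover have "(\<Sum>v<n. thru v) = (\<Sum>l\<in>L. int (f l) * int (card (inner_vertices (p l))))"
  proof -
    have "(\<Sum>v<n. thru v) = (\<Sum>l\<in>L. int (f l) * (\<Sum>v<n. if v \<in> inner_vertices (p l) then 1 else 0))"
      unfolding thru_def by (subst sum.swap) (simp add: sum_distrib_left)
    also have "\<dots> = (\<Sum>l\<in>L. int (f l) * int (card (inner_vertices (p l))))"
    proof (intro sum.cong refl)
      fix l assume "l \<in> L"
      have "(\<Sum>v\<in>V. if v \<in> inner_vertices (p l) then 1 else 0) = (\<Sum>v\<in>V \<inter> inner_vertices (p l). 1::int)"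
        by (rule sum.inter_restrict[symmetric]) simp
      then show "int (f l) * (\<Sum>v<n. if v \<in> inner_vertices (p l) then 1 else 0) = int (f l) * int (card (inner_vertices (p l)))"
        using vs[OF \<open>l \<in> L\<close>] by (simp add: Int_absorb1)
    qed
    finally show ?thesis .
  qed
  moreover have "(\<Sum>v<n. thru v) \<le> (\<Sum>v<n. pairs_at v)" by (intro sum_mono thru_le)
  moreover have "(\<Sum>l\<in>L. int (f l) * int (card (snd l))) \<le>
      (\<Sum>l\<in>L. int (f l) * int (card (inner_vertices (p l))) + int (f l))"
  proof (intro sum_mono)
    fix l assume "l \<in> L"
    have "int (card (snd l)) \<le> int (card (inner_vertices (p l))) + 1"
      using card_path_edges_inner[OF dist[OF \<open>l \<in> L\<close>]] snd[OF \<open>l \<in> L\<close>] by simp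
    from mult_left_mono[OF this, of "int (f l)"]
    show "int (f l) * int (card (snd l)) \<le> int (f l) * int (card (inner_vertices (p l))) + int (f l)"
      by (simp add: algebra_simps)
  qed
  ultimately show ?thesis by (simp add: sum.distrib)
qed

lemma concept_cost_eq:
  assumes "feasible I L f"
  shows "concept_cost I L f = c_fix I * real_of_int (\<Sum>l\<in>L. int (f l)) + (\<Sum>e\<in>E. edge_cost I e * real_of_int (b e))"
proof -
  note fin = feasible_finite[OF assms]
  have sub: "snd l \<subseteq> E" if "l \<in> L" for l
  proof -
    from that assms obtain p where "simple_path (network I) p" "l = line_of p"
      unfolding feasible_def line_concept_def lines_def by blast
    then show ?thesis by (simp add: line_of_def simple_path_def walk_def)
  qed
  have "(\<Sum>l\<in>L. real (f l) * (\<Sum>e \<in> snd l. edge_cost I e))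
      = (\<Sum>l\<in>L. \<Sum>e\<in>E. if e \<in> snd l then real (f l) * edge_cost I e else 0)"
  proof (intro sum.cong refl)
    fix l assume "l \<in> L"
    have "(\<Sum>e\<in>E. if e \<in> snd l then real (f l) * edge_cost I e else 0) = (\<Sum>e\<in>E \<inter> snd l. real (f l) * edge_cost I e)"
      by (rule sum.inter_restrict[symmetric]) simp
    with sub[OF \<open>l \<in> L\<close>] show "real (f l) * (\<Sum>e \<in> snd l. edge_cost I e)
        = (\<Sum>e\<in>E. if e \<in> snd l then real (f l) * edge_cost I e else 0)"
      by (simp add: Int_absorb1 sum_distrib_left)
  qed
  also have "\<dots> = (\<Sum>e\<in>E. edge_cost I e * real_of_int (b e))"
  proof (subst sum.swap, intro sum.cong refl)
    fix e assume e: "e \<in> E"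
    have "b e = int (\<Sum>l \<in> {l \<in> L. e \<in> snd l}. f l)"
      using assms exact[OF e] e by (force simp: feasible_def)
    then have "real_of_int (b e) = (\<Sum>l \<in> {l \<in> L. e \<in> snd l}. real (f l))" by simp
    also have "\<dots> = (\<Sum>l\<in>L. if e \<in> snd l then real (f l) else 0)"
      using fin by (rule sum.inter_filter)
    finally show "(\<Sum>l\<in>L. if e \<in> snd l then real (f l) * edge_cost I e else 0) = edge_cost I e * real_of_int (b e)"
      by (simp add: sum_distrib_left if_distrib mult.commute cong: if_cong)
  qed
  finally show ?thesis
    using no_fixed_cost by (simp add: concept_cost_def distrib_left sum.distrib sum_distrib_left mult.commute)
qed

lemma optimalI:
  assumes "feasible I L f" "(\<Sum>l\<in>L. int (f l)) \<le> (\<Sum>e\<in>E. b e) - (\<Sum>v<n. pairs_at v)"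
  shows "optimal I L f"
  unfolding optimal_def
proof (intro conjI allI impI assms(1))
  fix L' f' assume f': "feasible I L' f'"
  from lines_lower_bound[OF f'] assms(2) have "(\<Sum>l\<in>L. int (f l)) \<le> (\<Sum>l\<in>L'. int (f' l))" by linarith
  then have "c_fix I * real_of_int (\<Sum>l\<in>L. int (f l)) \<le> c_fix I * real_of_int (\<Sum>l\<in>L'. int (f' l))"
    using valid_instance by (intro mult_left_mono of_int_le_iff[THEN iffD2]) (auto simp: lp_instance_def)
  then show "concept_cost I L f \<le> concept_cost I L' f'"
    unfolding concept_cost_eq[OF assms(1)] concept_cost_eq[OF f'] by simp
qed

text \<open>Negative demands are the only obstruction: for nonnegative ones the program constructs a
  feasible concept. Hence a sign test decides feasibility.\<close>

lemma feasible_imp_nonneg: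
  assumes "feasible I L f" "e \<in> E"
  shows "0 \<le> b e"
  using feasible_demand[OF assms(1), of "{e}"] assms(2) by (simp add: sum_nonneg)

end

section \<open>Frequency matrices\<close>

text \<open>One functional for both quantities to be tracked: weight \<open>1\<close> counts the
  lines, and the indicator of an edge counts how often it is covered. Both come out doubled, since a
  line occurs in both directions.\<close>

definition wsum :: "nat \<Rightarrow> (nat \<Rightarrow> nat \<Rightarrow> int) \<Rightarrow> (nat \<Rightarrow> nat \<Rightarrow> int) \<Rightarrow> int" where
  "wsum n g F = (\<Sum>p<n. \<Sum>q<n. g p q * F p q)"

abbreviation (input) kdelta :: "nat \<Rightarrow> nat \<Rightarrow> nat \<Rightarrow> nat \<Rightarrow> int" where
  "kdelta a c p q \<equiv> (if p = a \<and> q = c then 1 else 0)"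

text \<open>Joins \<open>w\<close> copies of the line between \<open>a\<close> and \<open>v\<close> with \<open>w\<close> copies of the line
  between \<open>v\<close> and \<open>c\<close>.\<close>

definition merge :: "nat \<Rightarrow> nat \<Rightarrow> nat \<Rightarrow> int \<Rightarrow> (nat \<Rightarrow> nat \<Rightarrow> int) \<Rightarrow> nat \<Rightarrow> nat \<Rightarrow> int" where
  "merge v a c w F p q = F p q + w * (kdelta a c p q + kdelta c a p q
     - kdelta v a p q - kdelta a v p q - kdelta v c p q - kdelta c v p q)"

text \<open>The additive form of \<open>merge\<close> suits the linear \<open>wsum\<close>, this one
  suits pointwise claims. Distinctness of the three vertices keeps the six changed positions
  apart.\<close>

lemma merge_apply:
  assumes "v \<noteq> a" "v \<noteq> c" "a \<noteq> c"
  shows "merge v a c w F p q =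
    (if (p, q) \<in> {(a, c), (c, a)} then F p q + w
     else if (p, q) \<in> {(v, a), (a, v), (v, c), (c, v)} then F p q - w else F p q)"
proof -
  note ne = assms assms[symmetric]
  have merge: "merge v a c w F p q = F p q + w * (d1 + d2 - d3 - d4 - d5 - d6)"
    if "kdelta a c p q = d1" "kdelta c a p q = d2" "kdelta v a p q = d3" "kdelta a v p q = d4"
      "kdelta v c p q = d5" "kdelta c v p q = d6" for d1 d2 d3 d4 d5 d6
    unfolding merge_def that ..
  consider "p = a" "q = c" | "p = c" "q = a" | "p = v" "q = a" | "p = a" "q = v" | "p = v" "q = c"
    | "p = c" "q = v" | "(p, q) \<notin> {(a, c), (c, a), (v, a), (a, v), (v, c), (c, v)}"
    by blast
  then show ?thesis
  proof cases
    case 1 show ?thesis unfolding 1 by (simp add: merge_def ne)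
  next
    case 2 show ?thesis unfolding 2 by (simp add: merge_def ne)
  next
    case 3 show ?thesis unfolding 3 by (simp add: merge_def ne)
  next
    case 4 show ?thesis unfolding 4 by (simp add: merge_def ne)
  next
    case 5 show ?thesis unfolding 5 by (simp add: merge_def ne)
  next
    case 6 show ?thesis unfolding 6 by (simp add: merge_def ne)
  next
    case 7
    then have "merge v a c w F p q = F p q + w * (0 + 0 - 0 - 0 - 0 - 0)"
      by (intro merge) auto
    moreover have "(p, q) \<notin> {(a, c), (c, a)}" "(p, q) \<notin> {(v, a), (a, v), (v, c), (c, v)}"
      using 7 by blast+
    ultimately show ?thesis by (simp only: if_False) simp
  qed
qed

lemma wsum_kdelta: "a < n \<Longrightarrow> c < n \<Longrightarrow> wsum n g (\<lambda>p q. kdelta a c p q) = g a c"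
proof -
  assume "a < n" "c < n"
  have "(\<Sum>q<n. g p q * kdelta a c p q) = (if p = a then g p c else 0)" for p
    using \<open>c < n\<close> by (cases "p = a") (simp_all add: if_distrib[of "(*) _"] cong: if_cong)
  then show ?thesis using \<open>a < n\<close> by (simp add: wsum_def)
qed

lemma wsum_linear:
  "wsum n g (\<lambda>p q. F p q + H p q) = wsum n g F + wsum n g H"
  "wsum n g (\<lambda>p q. F p q - H p q) = wsum n g F - wsum n g H"
  "wsum n g (\<lambda>p q. w * F p q) = w * wsum n g F"
  by (simp_all add: wsum_def sum.distrib sum_subtractf sum_distrib_left algebra_simps)

lemma wsum_merge:
  assumes "v < n" "a < n" "c < n"
  shows "wsum n g (merge v a c w F) =
    wsum n g F + w * (g a c + g c a - g v a - g a v - g v c - g c v)"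
proof -
  have "merge v a c w F = (\<lambda>p q. F p q + w * (kdelta a c p q + kdelta c a p q
     - kdelta v a p q - kdelta a v p q - kdelta v c p q - kdelta c v p q))"
    by (intro ext) (simp add: merge_def)
  then show ?thesis using assms by (simp only: wsum_linear wsum_kdelta)
qed

text \<open>Passes from ordered pairs, where each line occurs twice, to one orientation per
  line.\<close>

lemma wsum_symmetric:
  assumes "\<And>p q. p < n \<Longrightarrow> q < n \<Longrightarrow> g p q * F p q = g q p * F q p" "\<And>p. p < n \<Longrightarrow> g p p * F p p = 0"
  shows "wsum n g F = 2 * (\<Sum>(p, q) \<in> {(p, q). q < p \<and> p < n}. g p q * F p q)"
proof -
  let ?h = "\<lambda>(p, q). g p q * F p q"
  let ?A = "{(p, q). q < p \<and> p < n}" and ?B = "{(p, q). p < q \<and> q < n}" and ?D = "{(p, q). p = q \<and> q < n}"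
  have fin: "finite ?A" "finite ?B" "finite ?D"
    by (rule finite_subset[of _ "{..<n} \<times> {..<n}"]; force)+
  have "wsum n g F = (\<Sum>z\<in>{..<n} \<times> {..<n}. ?h z)"
    by (simp add: wsum_def sum.cartesian_product)
  also have "{..<n} \<times> {..<n} = (?A \<union> ?B) \<union> ?D" by auto
  also have "(\<Sum>z\<in>\<dots>. ?h z) = (\<Sum>z\<in>?A. ?h z) + (\<Sum>z\<in>?B. ?h z) + (\<Sum>z\<in>?D. ?h z)"
    using fin by (subst sum.union_disjoint; (subst sum.union_disjoint)?; auto)
  also have "(\<Sum>z\<in>?D. ?h z) = 0" using assms(2) by (intro sum.neutral) auto
  also have "(\<Sum>z\<in>?B. ?h z) = (\<Sum>z\<in>?A. ?h z)"
    by (rule sum.reindex_bij_witness[of _ prod.swap prod.swap]) (auto simp: assms(1))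
  finally show ?thesis by simp
qed

section \<open>Matrices that represent line concepts\<close>

context fixed_demand
begin

text \<open>\<open>F u w\<close> is the number of lines with ends \<open>u\<close> and \<open>w\<close>, counted in both directions; no line
  passes through a vertex of \<open>U\<close>.\<close>

definition valid :: "nat set \<Rightarrow> (nat \<Rightarrow> nat \<Rightarrow> int) \<Rightarrow> bool" where
  "valid U F \<longleftrightarrow> (\<forall>p<n. \<forall>q<n. 0 \<le> F p q \<and> F p q = F q p) \<and> (\<forall>p<n. F p p = 0) \<and>
     (\<forall>e\<in>E. wsum n (\<lambda>p q. of_bool (e \<in> tedges p q)) F = 2 * b e) \<and>
     (\<forall>v\<in>U. \<forall>p<n. \<forall>q<n. v \<in> inner p q \<longrightarrow> F p q = 0)"

abbreviation total :: "(nat \<Rightarrow> nat \<Rightarrow> int) \<Rightarrow> int" where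
  "total \<equiv> wsum n (\<lambda>_ _. 1)"

text \<open>By \<open>diverge\<close> the new path covers each edge as often as the two old ones
  together, and its only new inner vertex is \<open>v\<close>, which lies outside \<open>U\<close>.
  Two entries rise and four fall by \<open>w\<close>, hence the \<open>2 * w\<close>.\<close>

lemma valid_merge:
  assumes F: "valid U F" and lt: "v < n" "a < n" "c < n" and ne: "v \<noteq> a" "v \<noteq> c"
    and nh: "next_hop v a \<noteq> next_hop v c" and w: "0 < w" "w \<le> F v a" "w \<le> F v c" and v: "v \<notin> U"
  shows "valid U (merge v a c w F)" and "total (merge v a c w F) = total F - 2 * w"
proof -
  note dv = diverge[OF lt ne nh]
  note mrg = merge_apply[OF ne dv(4), of w F]
  have sym: "F p q = F q p" and nonneg: "0 \<le> F p q" if "p < n" "q < n" for p q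
    using F that by (auto simp: valid_def)
  show "total (merge v a c w F) = total F - 2 * w" by (simp add: wsum_merge lt)
  show "valid U (merge v a c w F)"
    unfolding valid_def
  proof (intro conjI allI impI ballI)
    fix p q assume "p < n" "q < n"
    have rev: "w \<le> F a v" "w \<le> F c v" using w sym[of a v] sym[of c v] lt by simp_all
    show "0 \<le> merge v a c w F p q"
    proof -
      have "w \<le> F p q" if "(p, q) \<in> {(v, a), (a, v), (v, c), (c, v)}"
        using that w(2,3) rev by blast
      then show ?thesis using w(1) nonneg[OF \<open>p < n\<close> \<open>q < n\<close>] unfolding mrg by simp
    qed
    show "merge v a c w F p q = merge v a c w F q p"
    proof -
      have "(p, q) \<in> {(a, c), (c, a)} \<longleftrightarrow> (q, p) \<in> {(a, c), (c, a)}"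
        and "(p, q) \<in> {(v, a), (a, v), (v, c), (c, v)} \<longleftrightarrow> (q, p) \<in> {(v, a), (a, v), (v, c), (c, v)}"
        by blast+
      then show ?thesis unfolding mrg using sym[OF \<open>p < n\<close> \<open>q < n\<close>] by presburger
    qed
  next
    fix p assume "p < n"
    then show "merge v a c w F p p = 0" using F ne dv(4) by (simp add: mrg valid_def)
  next
    fix e assume "e \<in> E"
    have "wsum n (\<lambda>p q. of_bool (e \<in> tedges p q)) F = 2 * b e"
      using F \<open>e \<in> E\<close> by (simp add: valid_def)
    moreover have "of_bool (e \<in> tedges a c) = of_bool (e \<in> tedges v a) + (of_bool (e \<in> tedges v c) :: int)"
      using dv(1,2) by auto
    ultimately show "wsum n (\<lambda>p q. of_bool (e \<in> tedges p q)) (merge v a c w F) = 2 * b e"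
      using lt tedges_commute[of a c] tedges_commute[of v a] tedges_commute[of v c]
      by (simp add: wsum_merge algebra_simps)
  next
    fix u p q assume u: "u \<in> U" and pq: "p < n" "q < n" and i: "u \<in> inner p q"
    \<comment> \<open>Both merged lines occur with positive frequency, so by validity they avoid
      \<open>U\<close>.\<close>
    have z: "u \<notin> inner x y" if "x < n" "y < n" "0 < F x y" for x y
      using F that u by (fastforce simp: valid_def)
    have "u \<notin> inner v a" "u \<notin> inner v c" using z lt w by auto
    moreover from this have "u \<notin> inner a c" using dv(3) u v by auto
    ultimately have "(p, q) \<notin> {(a, c), (c, a)}" "(p, q) \<notin> {(v, a), (a, v), (v, c), (c, v)}"
      using i lt inner_commute[of a c] inner_commute[of v a] inner_commute[of v c] by auto
    moreover have "F p q = 0" using F u pq i by (simp add: valid_def)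
    ultimately show "merge v a c w F p q = 0" unfolding mrg by (simp only: if_False)
  qed
qed

definition edge_matrix :: "nat \<Rightarrow> nat \<Rightarrow> int" where
  "edge_matrix u w = (if {u, w} \<in> E then b {u, w} else 0)"

text \<open>A single edge has no inner vertex, so \<open>U\<close> is arbitrary; only the two
  orientations of \<open>e\<close> cover \<open>e\<close>.\<close>

lemma valid_edge_matrix:
  assumes nonneg: "\<And>e. e \<in> E \<Longrightarrow> 0 \<le> b e"
  shows "valid U edge_matrix"
  unfolding valid_def
proof (intro conjI allI impI ballI)
  fix p q assume "p < n" "q < n"
  show "0 \<le> edge_matrix p q" using nonneg by (simp add: edge_matrix_def)
  show "edge_matrix p q = edge_matrix q p" by (simp add: edge_matrix_def insert_commute)
next
  fix p show "edge_matrix p p = 0" by (auto simp: edge_matrix_def elim!: edgeE)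
next
  fix e assume "e \<in> E"
  then obtain u v where uv: "u < n" "v < n" "u \<noteq> v" "e = {u, v}" by (rule edgeE)
  \<comment> \<open>The factor \<open>1\<close> on the right is the constant weight of the
    \<open>wsum\<close> that follows.\<close>
  have "of_bool (e \<in> tedges p q) * edge_matrix p q = 1 * (b e * (kdelta u v p q + kdelta v u p q))" for p q
    using \<open>e \<in> E\<close> uv by (auto simp: edge_matrix_def tpath_edge doubleton_eq_iff insert_commute)
  then have "wsum n (\<lambda>p q. of_bool (e \<in> tedges p q)) edge_matrix
      = wsum n (\<lambda>_ _. 1) (\<lambda>p q. b e * (kdelta u v p q + kdelta v u p q))"
    unfolding wsum_def by (intro sum.cong refl)
  also have "\<dots> = 2 * b e" using uv by (simp only: wsum_linear wsum_kdelta) simp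
  finally show "wsum n (\<lambda>p q. of_bool (e \<in> tedges p q)) edge_matrix = 2 * b e" .
next
  fix v p q assume "v \<in> inner p q"
  then show "edge_matrix p q = 0"
    by (auto simp: edge_matrix_def tpath_edge inner_vertices_def)
qed

text \<open>Every nonzero entry covers exactly one edge, so the total is the sum of the coverages of
  all edges.\<close>

lemma total_edge_matrix:
  assumes nonneg: "\<And>e. e \<in> E \<Longrightarrow> 0 \<le> b e"
  shows "total edge_matrix = 2 * (\<Sum>e\<in>E. b e)"
proof -
  have "(\<Sum>e\<in>E. of_bool (e \<in> tedges p q) * edge_matrix p q) = edge_matrix p q" for p q
  proof (cases "{p, q} \<in> E")
    case True
    then have "(\<Sum>e\<in>E. of_bool (e \<in> tedges p q) * edge_matrix p q) = (\<Sum>e\<in>E. if e = {p, q} then edge_matrix p q else 0)"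
      by (intro sum.cong) (auto simp: tpath_edge)
    then show ?thesis using True by simp
  qed (simp add: edge_matrix_def)
  then have "total edge_matrix = (\<Sum>p<n. \<Sum>q<n. \<Sum>e\<in>E. of_bool (e \<in> tedges p q) * edge_matrix p q)"
    by (simp only: wsum_def mult_1_left)
  also have "\<dots> = (\<Sum>e\<in>E. wsum n (\<lambda>p q. of_bool (e \<in> tedges p q)) edge_matrix)"
    unfolding wsum_def by (subst sum.swap[of _ _ E], subst sum.swap[of _ _ E]) simp
  also have "\<dots> = 2 * (\<Sum>e\<in>E. b e)"
    using valid_edge_matrix[OF nonneg] by (simp add: valid_def sum_distrib_left)
  finally show ?thesis .
qed

lemma inj_on_lines: "inj_on (\<lambda>(u, w). line_of (tpath u w)) {(u, w). w < u \<and> u < n}"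
  (is "inj_on ?l ?P")
proof (rule inj_onI)
  fix x y assume x: "x \<in> ?P" and y: "y \<in> ?P" and eq: "?l x = ?l y"
  obtain u w u' w' where xy: "x = (u, w)" "y = (u', w')" by fastforce
  with x y have o: "w < u" "u < n" "w' < u'" "u' < n" by auto
  then have "{u, w} = {u', w'}"
    using line_of_tpath_eqD[of u w u' w'] eq xy by auto
  with o xy show "x = y" by (auto simp: doubleton_eq_iff)
qed

text \<open>\<open>L\<close> has a line for every pair of distinct ends, frequency \<open>0\<close>
  included; with \<open>d_fix I = 0\<close> such lines are free and need not be sorted out.\<close>

lemma optimal_matrix:
  assumes F: "valid U F" and tot: "total F = 2 * ((\<Sum>e\<in>E. b e) - (\<Sum>v<n. pairs_at v))"
    and L: "L = (\<lambda>(u, w). line_of (tpath u w)) ` {(u, w). w < u \<and> u < n}"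
    and f: "\<And>u w. w < u \<Longrightarrow> u < n \<Longrightarrow> int (f (line_of (tpath u w))) = F u w"
  shows "optimal I L f"
proof -
  let ?P = "{(u, w). w < u \<and> u < n}" and ?l = "\<lambda>(u, w). line_of (tpath u w)"
  note inj = inj_on_lines
  have fin: "finite ?P" by (rule finite_subset[of _ "V \<times> V"]) auto
  have sym: "F p q = F q p" and nonneg: "0 \<le> F p q" if "p < n" "q < n" for p q
    using F that by (auto simp: valid_def)
  have diag: "F p p = 0" if "p < n" for p using F that by (simp add: valid_def)
  have tp: "simple_path (network I) (tpath u w)" if "u < n" "w < n" for u w
    using simple_tpath that by blast
  have "feasible I L f"
    unfolding feasible_def line_concept_def
  proof (intro conjI ballI)
    show "L \<subseteq> lines (network I)" using tp by (force simp: L lines_def)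
  next
    fix e assume e: "e \<in> E"
    have "int (\<Sum>l \<in> {l \<in> L. e \<in> snd l}. f l) = (\<Sum>l\<in>L. of_bool (e \<in> snd l) * int (f l))"
      using fin by (simp add: L sum.inter_filter of_bool_def if_distrib[of "\<lambda>z. z * _"] if_distrib[of int] cong: if_cong)
    also have "\<dots> = (\<Sum>z\<in>?P. of_bool (e \<in> snd (?l z)) * int (f (?l z)))"
      unfolding L by (rule sum.reindex_cong[OF inj]) auto
    also have "\<dots> = (\<Sum>(p, q)\<in>?P. of_bool (e \<in> tedges p q) * F p q)"
      by (intro sum.cong) (auto simp: f line_of_def f[unfolded line_of_def])
    also have "2 * \<dots> = 2 * b e"
    proof (subst wsum_symmetric[symmetric])
      fix p q assume "p < n" "q < n"
      then show "of_bool (e \<in> tedges p q) * F p q = of_bool (e \<in> tedges q p) * F q p"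
        using sym[of p q] tedges_commute[of p q] by simp
    qed (use diag F e in \<open>auto simp: valid_def\<close>)
    finally show "b e \<le> int (\<Sum>l \<in> {l \<in> L. e \<in> snd l}. f l)"
      and "int (\<Sum>l \<in> {l \<in> L. e \<in> snd l}. f l) \<le> f_max I e"
      using exact[OF e] by auto
  qed
  moreover have "(\<Sum>l\<in>L. int (f l)) = (\<Sum>e\<in>E. b e) - (\<Sum>v<n. pairs_at v)"
  proof -
    have "(\<Sum>l\<in>L. int (f l)) = (\<Sum>z\<in>?P. int (f (?l z)))"
      unfolding L by (rule sum.reindex_cong[OF inj]) auto
    also have "\<dots> = (\<Sum>(p, q)\<in>?P. 1 * F p q)" by (intro sum.cong) (auto simp: f)
    also have "2 * \<dots> = total F"
      by (subst wsum_symmetric) (use sym diag in auto)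
    finally show ?thesis using tot by simp
  qed
  ultimately show ?thesis by (intro optimalI) auto
qed


section \<open>Pairing the line ends at one vertex\<close>

definition group_list :: "nat \<Rightarrow> nat \<Rightarrow> nat list" where
  "group_list v g = filter (\<lambda>q. next_hop v q = g) [0..<n]"

definition grouped :: "nat \<Rightarrow> nat \<Rightarrow> nat list" where
  "grouped v k = concat (map (group_list v) [0..<k])"

text \<open>Units are never listed individually: the \<open>k\<close>-th end stands for a block of
  units, occupying the positions from \<open>csum r xs k\<close> up to, but excluding,
  \<open>csum r xs (Suc k)\<close>.\<close>

definition csum :: "(nat \<Rightarrow> int) \<Rightarrow> nat list \<Rightarrow> nat \<Rightarrow> int" where
  "csum r xs k = sum_list (map r (take k xs))"

definition group_sum :: "nat \<Rightarrow> (nat \<Rightarrow> int) \<Rightarrow> nat \<Rightarrow> int" where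
  "group_sum v r g = sum_list (map r (group_list v g))"

definition max_group :: "nat \<Rightarrow> (nat \<Rightarrow> int) \<Rightarrow> nat \<Rightarrow> int" where
  "max_group v r k = Max (insert 0 (group_sum v r ` {..<k}))"

lemma grouped_0 [simp]: "grouped v 0 = []"
  by (simp add: grouped_def)

lemma grouped_Suc: "grouped v (Suc k) = grouped v k @ group_list v k"
  by (simp add: grouped_def)

lemma max_group_0 [simp]: "max_group v r 0 = 0"
  by (simp add: max_group_def)

lemma max_group_Suc: "max_group v r (Suc k) = max (max_group v r k) (group_sum v r k)"
proof -
  have "insert 0 (group_sum v r ` {..<Suc k}) = insert (group_sum v r k) (insert 0 (group_sum v r ` {..<k}))"
    by (auto simp: lessThan_Suc)
  then show ?thesis unfolding max_group_def by (subst max.commute) (simp only: Max_insert finite_insert finite_imageI finite_lessThan insert_not_empty simp_thms)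
qed

lemma csum_0 [simp]: "csum r xs 0 = 0"
  by (simp add: csum_def)

lemma csum_Suc: "k < length xs \<Longrightarrow> csum r xs (Suc k) = csum r xs k + r (xs ! k)"
  by (simp add: csum_def take_Suc_conv_app_nth)

lemma csum_append1 [simp]: "k \<le> length xs \<Longrightarrow> csum r (xs @ ys) k = csum r xs k"
  by (simp add: csum_def)

lemma csum_length: "csum r xs (length xs) = sum_list (map r xs)"
  by (simp add: csum_def)

lemma csum_mono:
  assumes "\<And>x. x \<in> set xs \<Longrightarrow> 0 \<le> r x" "j \<le> k" "k \<le> length xs"
  shows "csum r xs j \<le> csum r xs k"
  using assms(2,3)
proof (induction k rule: dec_induct)
  case (step k)
  then have "0 \<le> r (xs ! k)" by (intro assms(1)) simp
  with step show ?case by (simp add: csum_Suc)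
qed simp

lemma sum_list_grouped: "sum_list (map r (grouped v k)) = (\<Sum>g<k. group_sum v r g)"
  by (induction k) (simp_all add: grouped_Suc group_sum_def)

lemma in_grouped: "q \<in> set (grouped v k) \<longleftrightarrow> q < n \<and> next_hop v q < k"
  by (auto simp: grouped_def group_list_def)

lemma distinct_grouped: "distinct (grouped v k)"
  by (induction k) (auto simp: grouped_Suc in_grouped, auto simp: group_list_def)

lemma set_grouped_n: "v < n \<Longrightarrow> set (grouped v n) = V"
  using next_hop_less by (auto simp: in_grouped)

lemma length_grouped_n: "v < n \<Longrightarrow> length (grouped v n) = n"
  using distinct_card[OF distinct_grouped[of v n]] by (simp add: set_grouped_n)

text \<open>Ends with the same next hop are contiguous in \<open>grouped\<close>, so the blocks from
  \<open>i\<close> to \<open>j\<close> stay within a single group.\<close>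

lemma same_group_csum:
  assumes r: "\<And>q. q < n \<Longrightarrow> 0 \<le> r q"
  shows "i \<le> j \<Longrightarrow> j < length (grouped v k) \<Longrightarrow> next_hop v (grouped v k ! i) = next_hop v (grouped v k ! j) \<Longrightarrow>
    csum r (grouped v k) (Suc j) - csum r (grouped v k) i \<le> max_group v r k"
proof (induction k)
  case (Suc k)
  let ?xs = "grouped v k" and ?ys = "group_list v k"
  consider "j < length ?xs" | "i < length ?xs" "length ?xs \<le> j" | "length ?xs \<le> i" by linarith
  then show ?case
  proof cases
    case 1
    with Suc show ?thesis by (simp add: grouped_Suc nth_append max_group_Suc)
  next
    \<comment> \<open>Impossible: \<open>i\<close> lies in an earlier group, with next hop below
      \<open>k\<close>, and \<open>j\<close> in group \<open>k\<close>.\<close>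
    case 2
    then have "?xs ! i \<in> set ?xs" "?ys ! (j - length ?xs) \<in> set ?ys"
      using Suc.prems(2) by (auto simp: grouped_Suc intro!: nth_mem)
    with 2 Suc.prems(3) show ?thesis
      by (auto simp: grouped_Suc nth_append in_grouped) (auto simp: group_list_def)
  next
    case 3
    let ?zs = "?xs @ ?ys"
    have pos: "\<And>x. x \<in> set ?zs \<Longrightarrow> 0 \<le> r x" using r by (auto simp: in_grouped group_list_def)
    have "csum r ?zs (Suc j) \<le> csum r ?zs (length ?zs)"
      using Suc.prems(2) by (intro csum_mono pos) (auto simp: grouped_Suc)
    moreover have "csum r ?zs (length ?xs) \<le> csum r ?zs i"
      using Suc.prems 3 by (intro csum_mono pos) (auto simp: grouped_Suc)
    moreover have "csum r ?zs (length ?zs) = csum r ?zs (length ?xs) + group_sum v r k"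
      unfolding csum_length by (simp add: csum_length group_sum_def)
    ultimately show ?thesis by (simp add: grouped_Suc max_group_Suc)
  qed
qed simp

text \<open>As \<open>v \<in> U\<close>, no line passes through \<open>v\<close>; every line that
  uses the edge to \<open>g\<close> ends at \<open>v\<close>, so group \<open>g\<close> alone covers
  the demand of this edge.\<close>

lemma group_sum_eq:
  assumes F: "valid U F" and v: "v \<in> U" "v < n" and g: "g < n"
  shows "group_sum v (F v) g = (if {v, g} \<in> E then b {v, g} else 0)"
proof -
  have gs: "group_sum v (F v) g = (\<Sum>q<n. of_bool (next_hop v q = g) * F v q)"
    unfolding group_sum_def group_list_def
    by (simp add: sum_list_map_filter' interv_sum_list_conv_sum_set_nat lessThan_atLeast0
        of_bool_def if_distrib[of "\<lambda>z. z * _"] cong: if_cong)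
  show ?thesis
  proof (cases "{v, g} \<in> E")
    case True
    let ?e = "{v, g}"
    have sym: "F p v = F v p" if "p < n" for p using F that v by (auto simp: valid_def)
    have vg: "v \<noteq> g" using True by (auto elim!: edgeE)
    \<comment> \<open>Only row \<open>v\<close> and column \<open>v\<close> survive, and by symmetry
      each yields the group sum.\<close>
    have split: "of_bool (?e \<in> tedges p q) * F p q
        = (if p = v then of_bool (next_hop v q = g) * F v q else 0)
          + (if q = v then of_bool (next_hop v p = g) * F v p else 0)" if "p < n" "q < n" for p q
    proof -
      consider "p = v" "q = v" | "p = v" "q \<noteq> v" | "p \<noteq> v" "q = v" | "p \<noteq> v" "q \<noteq> v" by blast
      then show ?thesis
      proof cases
        case 1
        with vg v show ?thesis by simp
      next
        case 2
        with incident_tedges_iff[OF v(2) that(2) True] show ?thesis by simp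
      next
        case 3
        with incident_tedges_iff[OF v(2) that(1) True] tedges_commute[OF that] sym[OF that(1)]
        show ?thesis by simp
      next
        case 4
        have "F p q = 0" if "?e \<in> tedges p q"
        proof -
          have "v \<in> set (tpath p q)" using path_edges_subset[OF that] by simp
          then have "v \<in> inner p q" using 4 tpath[OF \<open>p < n\<close> \<open>q < n\<close>] by (simp add: inner_vertices_def)
          with F v \<open>p < n\<close> \<open>q < n\<close> show ?thesis by (simp add: valid_def)
        qed
        with 4 show ?thesis by auto
      qed
    qed
    have "2 * b ?e = wsum n (\<lambda>p q. of_bool (?e \<in> tedges p q)) F"
      using F True by (simp add: valid_def)
    also have "\<dots> = (\<Sum>p<n. \<Sum>q<n. (if p = v then of_bool (next_hop v q = g) * F v q else 0)
        + (if q = v then of_bool (next_hop v p = g) * F v p else 0))"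
      unfolding wsum_def by (intro sum.cong refl) (use split in auto)
    also have "\<dots> = 2 * group_sum v (F v) g"
    proof -
      have "(\<Sum>p<n. \<Sum>q<n. if p = v then of_bool (next_hop v q = g) * F v q else 0) = group_sum v (F v) g"
        using v(2) unfolding gs by (subst sum.swap) simp
      moreover have "(\<Sum>p<n. \<Sum>q<n. if q = v then of_bool (next_hop v p = g) * F v p else 0) = group_sum v (F v) g"
        using v(2) unfolding gs by simp
      ultimately show ?thesis by (simp only: sum.distrib)
    qed
    finally show ?thesis using True by simp
  next
    case False
    \<comment> \<open>Without an edge to \<open>g\<close> the group contains at most
      \<open>v\<close> itself, and the diagonal of \<open>F\<close> is zero.\<close>
    have "of_bool (next_hop v q = g) * F v q = 0" if "q < n" for q
    proof (cases "q = v")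
      case True
      with F v show ?thesis by (simp add: valid_def)
    next
      case False
      with tpath_Cons(3)[OF v(2) that] \<open>{v, g} \<notin> E\<close> show ?thesis by auto
    qed
    then show ?thesis using False gs by simp
  qed
qed

lemma incident_image: "v < n \<Longrightarrow> incident v = (\<lambda>g. {v, g}) ` {g. g < n \<and> {v, g} \<in> E}"
proof (intro set_eqI iffI)
  fix e assume e: "e \<in> incident v"
  then have "e \<in> E" "v \<in> e" by (auto simp: incident_def)
  then obtain g where "g < n" "e = {v, g}" by (auto elim!: edgeE simp: insert_commute)
  with \<open>e \<in> E\<close> show "e \<in> (\<lambda>g. {v, g}) ` {g. g < n \<and> {v, g} \<in> E}" by auto
qed (auto simp: incident_def)

text \<open>Row \<open>v\<close> still carries the original demand, whatever was joined at other
  vertices before; this makes the order of the vertices irrelevant.\<close>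

lemma load_eq:
  assumes F: "valid U F" and v: "v \<in> U" "v < n"
  shows "sum_list (map (F v) (grouped v n)) = load v"
proof -
  have "load v = (\<Sum>g\<in>{g. g < n \<and> {v, g} \<in> E}. b {v, g})"
    unfolding load_def incident_image[OF v(2)]
    by (rule sum.reindex_cong[of "\<lambda>g. {v, g}"]) (auto intro!: inj_onI simp: doubleton_eq_iff)
  also have "\<dots> = (\<Sum>g<n. if {v, g} \<in> E then b {v, g} else 0)"
    by (subst sum.inter_filter[symmetric]) (auto intro: sum.cong)
  finally show ?thesis unfolding sum_list_grouped using group_sum_eq[OF F v] by simp
qed

lemma max_load_eq:
  assumes F: "valid U F" and v: "v \<in> U" "v < n"
  shows "max_group v (F v) n = max_load v"
proof -
  have "group_sum v (F v) ` {..<n} = (\<lambda>g. if {v, g} \<in> E then b {v, g} else 0) ` {..<n}"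
    using group_sum_eq[OF F v] by (intro image_cong) auto
  then have "insert 0 (group_sum v (F v) ` {..<n}) = insert 0 (b ` incident v)"
    unfolding incident_image[OF v(2)] by (auto split: if_splits)
  then show ?thesis by (simp add: max_group_def max_load_def)
qed

end

text \<open>Line up the units with an end at \<open>v\<close>, grouped by the edge through which they reach \<open>v\<close>, and pair
  the unit at position \<open>x\<close> with the one at position \<open>x + shift\<close>. As \<open>shift\<close> is at least the size of every
  group, the two units lie on different edges.\<close>

locale pairing = fixed_demand +
  fixes v :: nat and U :: "nat set" and F0 :: "nat \<Rightarrow> nat \<Rightarrow> int"
  assumes v: "v < n" "v \<in> U" and F0: "valid U F0"
begin

abbreviation "xs \<equiv> grouped v n"
abbreviation "pos \<equiv> csum (F0 v) xs"

text \<open>The least value with two properties: \<open>max_load v\<close> keeps partners in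
  different groups, and half the load, rounded up, keeps the first and last
  \<open>load v - shift\<close> positions disjoint, so that no unit is used twice. What remains,
  \<open>load v - shift\<close>, is exactly \<open>pairs_at v\<close>.\<close>

definition shift :: int where
  "shift = max (max_load v) (load v - load v div 2)"

definition matching :: "(nat \<Rightarrow> nat \<Rightarrow> int) \<Rightarrow> nat \<Rightarrow> nat \<Rightarrow> int \<Rightarrow> bool" where
  "matching F i j x \<longleftrightarrow> valid (U - {v}) F \<and> total F = total F0 - 2 * x \<and> 0 \<le> x \<and> x \<le> load v - shift \<and>
     i < n \<and> j \<le> n \<and> pos i \<le> x \<and> pos j \<le> x + shift \<and>
     (\<forall>k<n. max 0 (pos (Suc k) - max (pos k) (x + shift)) + max 0 (min (pos (Suc k)) shift - max (pos k) x)
        \<le> F v (xs ! k))"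

lemma len: "length xs = n"
  using v by (simp add: length_grouped_n)

lemma F0_nonneg: "q < n \<Longrightarrow> 0 \<le> F0 v q"
  using F0 v by (simp add: valid_def)

lemma pos_Suc: "k < n \<Longrightarrow> pos (Suc k) = pos k + F0 v (xs ! k)"
  by (simp add: csum_Suc len)

lemma pos_mono: "j \<le> k \<Longrightarrow> k \<le> n \<Longrightarrow> pos j \<le> pos k"
  using F0_nonneg by (intro csum_mono) (auto simp: len in_grouped)

lemma pos_n: "pos n = load v"
  using csum_length[of "F0 v" xs] load_eq[OF F0] v by (simp add: len)

lemma xs_less: "k < n \<Longrightarrow> xs ! k < n"
  using nth_mem[of k xs] v by (simp add: len set_grouped_n)

lemma load_nonneg: "0 \<le> load v"
  using pos_mono[of 0 n] pos_n by simp

lemma max_load_bounds: "0 \<le> max_load v" "max_load v \<le> load v"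
proof -
  show "0 \<le> max_load v" unfolding max_load_def by (intro Max_ge) auto
  have nn: "0 \<le> group_sum v (F0 v) g" for g
    using F0_nonneg by (auto simp: group_sum_def group_list_def intro!: sum_list_nonneg)
  have "max_group v (F0 v) n \<le> (\<Sum>g<n. group_sum v (F0 v) g)"
    unfolding max_group_def
    by (subst Max_le_iff) (auto intro!: sum_nonneg nn member_le_sum)
  then show "max_load v \<le> load v"
    using max_load_eq[OF F0] load_eq[OF F0] sum_list_grouped v by simp
qed

lemma shift_bounds: "max_load v \<le> shift" "load v \<le> 2 * shift" "0 \<le> shift" "shift \<le> load v"
proof -
  have "2 * (load v div 2) \<le> load v" "0 \<le> load v div 2" using load_nonneg by auto
  with max_load_bounds load_nonneg show "max_load v \<le> shift" "load v \<le> 2 * shift" "0 \<le> shift" "shift \<le> load v"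
    unfolding shift_def by (auto simp: max_def)
qed

lemma load_minus_shift: "load v - shift = pairs_at v"
  by (auto simp: shift_def pairs_at_def)

lemma matching_init: "matching F0 0 0 0"
proof -
  have "max 0 (pos (Suc k) - max (pos k) shift) + max 0 (min (pos (Suc k)) shift - max (pos k) 0) \<le> F0 v (xs ! k)"
    if "k < n" for k
    using that pos_Suc[of k] pos_mono[of 0 k] F0_nonneg[OF xs_less[OF that]] by simp
  moreover have "valid (U - {v}) F0" using F0 by (auto simp: valid_def)
  ultimately show ?thesis using shift_bounds v by (simp add: matching_def)
qed

text \<open>The positions from \<open>x\<close> up to \<open>y\<close> belong to block
  \<open>i\<close> and their partners to block \<open>j\<close>, so one merge of weight
  \<open>y - x\<close> handles them all; \<open>y\<close> is where the first of the two blocks is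
  exhausted. If \<open>y \<le> x\<close>, nothing is merged and only a pointer moves, hence the
  \<open>max\<close>.\<close>

lemma matching_step:
  assumes m: "matching F i j x" and j: "j < n"
  defines "y \<equiv> min (pos (Suc i)) (pos (Suc j) - shift)"
  defines "F' \<equiv> (if x < y then merge v (xs ! i) (xs ! j) (y - x) F else F)" and "x' \<equiv> max x y"
  shows "pos (Suc i) < pos (Suc j) - shift \<Longrightarrow> matching F' (Suc i) j x'"
    and "\<not> pos (Suc i) < pos (Suc j) - shift \<Longrightarrow> matching F' i (Suc j) x'"
proof -
  have i: "i < n" and x: "0 \<le> x" "x \<le> load v - shift" "pos i \<le> x" "pos j \<le> x + shift"
    using m by (auto simp: matching_def)
  have yh: "y \<le> load v - shift" using pos_mono[of "Suc j" n] j pos_n by (simp add: y_def)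
  define need where "need x k = max 0 (pos (Suc k) - max (pos k) (x + shift)) + max 0 (min (pos (Suc k)) shift - max (pos k) x)"
    for x k
  have need: "need x k \<le> F v (xs ! k)" if "k < n" for k using m that by (simp add: matching_def need_def)
  have main: "valid (U - {v}) F' \<and> total F' = total F0 - 2 * x' \<and> (\<forall>k<n. need x' k \<le> F' v (xs ! k))"
  proof (cases "x < y")
    case False
    with m show ?thesis by (simp add: F'_def x'_def matching_def need_def)
  next
    case True
    then have lt: "x < pos (Suc i)" "x + shift < pos (Suc j)" by (auto simp: y_def)
    \<comment> \<open>Blocks \<open>i \<le> j\<close> of one group would span more than
      \<open>shift\<close>, hence more than \<open>max_load v\<close>; and \<open>j < i\<close>
      would put the partner of position \<open>x\<close> before \<open>x\<close>.\<close>
    have nh: "next_hop v (xs ! i) \<noteq> next_hop v (xs ! j)"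
    proof
      assume eq: "next_hop v (xs ! i) = next_hop v (xs ! j)"
      show False
      proof (cases "i \<le> j")
        case True
        have "pos (Suc j) - pos i \<le> max_group v (F0 v) n"
          by (rule same_group_csum[OF F0_nonneg True _ eq]) (simp_all add: len j)
        then have "pos (Suc j) - pos i \<le> max_load v" using max_load_eq[OF F0] v by simp
        with lt x shift_bounds show False by linarith
      next
        case False
        with pos_mono[of "Suc j" i] i lt x shift_bounds show False by linarith
      qed
    qed
    then have ij: "i \<noteq> j" by auto
    have F0v: "F0 v v = 0" using F0 v by (simp add: valid_def)
    have ne: "v \<noteq> xs ! i" "v \<noteq> xs ! j"
      using pos_Suc[OF i] pos_Suc[OF j] lt x F0v by auto
    \<comment> \<open>Since \<open>y \<le> load v - shift \<le> shift\<close>, the positions joined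
      lie in block \<open>i\<close> below \<open>shift\<close> and, shifted, in block
      \<open>j\<close> from \<open>x + shift\<close> on. Each of the two counts drops by at least
      \<open>y - x\<close>, so that many units are available.\<close>
    have needi: "y - x \<le> need x i - need y i" "0 \<le> need y i" and needj: "y - x \<le> need x j - need y j" "0 \<le> need y j"
      using x yh True shift_bounds by (simp_all add: need_def y_def max_def min_def split: if_splits)
    have ni: "y - x \<le> F v (xs ! i)"
      using need[OF i] needi by linarith
    have nj: "y - x \<le> F v (xs ! j)"
      using need[OF j] needj by linarith
    have val: "valid (U - {v}) F" and tot: "total F = total F0 - 2 * x"
      using m by (auto simp: matching_def)
    have acne: "xs ! i \<noteq> xs ! j" using nh by auto
    note mm = valid_merge[OF val v(1) xs_less[OF i] xs_less[OF j] ne nh _ ni nj]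
    have F': "F' = merge v (xs ! i) (xs ! j) (y - x) F" and x': "x' = y"
      using True by (auto simp: F'_def x'_def)
    have "need y k \<le> F' v (xs ! k)" if k: "k < n" for k
    proof -
      have eq: "xs ! k = xs ! l \<longleftrightarrow> k = l" if "l < n" for l
        using k that distinct_grouped[of v n] by (simp add: nth_eq_iff_index_eq len)
      have "F' v (xs ! k) = F v (xs ! k) - (if k = i \<or> k = j then y - x else 0)"
        unfolding F' merge_apply[OF ne acne] using ne ij eq[OF i] eq[OF j] by auto
      moreover have "need y k \<le> need x k"
        unfolding need_def by (intro add_mono max.mono diff_mono order.refl) (use True in auto)
      ultimately show ?thesis using need[OF k] needi(1) needj(1) by (cases "k = i"; cases "k = j") simp_all
    qed
    with mm True tot show ?thesis unfolding F' x' by simp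
  qed
  have x': "0 \<le> x'" "x' \<le> load v - shift" "y \<le> x'" "x \<le> x'" using x yh by (auto simp: x'_def)
  show "matching F' (Suc i) j x'" if lt: "pos (Suc i) < pos (Suc j) - shift"
  proof -
    \<comment> \<open>Otherwise \<open>load v = pos (Suc i)\<close> would be less than
      \<open>pos (Suc j) - shift\<close>, which is at most \<open>load v - shift\<close>.\<close>
    have "Suc i \<noteq> n"
    proof
      assume "Suc i = n"
      then show False using lt pos_n pos_mono[of "Suc j" n] j shift_bounds by simp
    qed
    then show ?thesis using main x' x i j lt by (simp add: matching_def y_def need_def)
  qed
  show "matching F' i (Suc j) x'" if ge: "\<not> pos (Suc i) < pos (Suc j) - shift"
    using main x' x i j ge by (simp add: matching_def y_def need_def)
qed

text \<open>With \<open>j = n\<close> the invariant gives \<open>load v \<le> x + shift\<close>,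
  which together with \<open>x \<le> load v - shift\<close> fixes \<open>x\<close>.\<close>

lemma matching_final:
  assumes "matching F i n x"
  shows "valid (U - {v}) F" and "total F = total F0 - 2 * pairs_at v"
  using assms pos_n load_minus_shift by (auto simp: matching_def)

end

section \<open>Total correctness with running times\<close>

fun wvars :: "com \<Rightarrow> vname set" where
  "wvars (IAssign x p) = {x}"
| "wvars (Seq c d) = wvars c \<union> wvars d"
| "wvars (Cond _ c d) = wvars c \<union> wvars d"
| "wvars (While _ c) = wvars c"
| "wvars _ = {}"

fun warrs :: "com \<Rightarrow> vname set" where
  "warrs (IStore a i p) = {a}"
| "warrs (Seq c d) = warrs c \<union> warrs d"
| "warrs (Cond _ c d) = warrs c \<union> warrs d"
| "warrs (While _ c) = warrs c"
| "warrs _ = {}"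

text \<open>Only integer cells are tracked, because the program works on integers alone.\<close>

definition frame :: "com \<Rightarrow> state \<Rightarrow> state \<Rightarrow> bool" where
  "frame c s s' \<longleftrightarrow> (\<forall>x. x \<notin> wvars c \<longrightarrow> ivar s' x = ivar s x) \<and> (\<forall>a. a \<notin> warrs c \<longrightarrow> iarr s' a = iarr s a)"

lemma frame_ivar: "frame c s s' \<Longrightarrow> x \<notin> wvars c \<Longrightarrow> ivar s' x = ivar s x"
  by (simp add: frame_def)

lemma frame_iarr: "frame c s s' \<Longrightarrow> a \<notin> warrs c \<Longrightarrow> iarr s' a = iarr s a"
  by (simp add: frame_def)

lemma frame_refl: "frame c s s"
  by (simp add: frame_def)

lemma runs_frame: "runs c s t s' \<Longrightarrow> frame c s s'"
  by (induction rule: runs.induct) (auto simp: frame_def)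

definition reach :: "com \<Rightarrow> state \<Rightarrow> nat \<Rightarrow> (state \<Rightarrow> bool) \<Rightarrow> bool" where
  "reach c s T Q \<longleftrightarrow> (\<exists>t s'. runs c s t s' \<and> t \<le> T \<and> Q s')"

text \<open>The frame fact comes for free with every run; offering it here and in the rules below
  keeps untouched cells out of the invariants.\<close>

lemma reach_mono:
  assumes "reach c s T Q" "T \<le> T'" "\<And>s'. frame c s s' \<Longrightarrow> Q s' \<Longrightarrow> Q' s'"
  shows "reach c s T' Q'"
  using assms runs_frame unfolding reach_def by (meson order_trans)

lemma reach_Seq:
  assumes "reach c s T1 Q1" "\<And>s'. frame c s s' \<Longrightarrow> Q1 s' \<Longrightarrow> reach d s' T2 Q"
  shows "reach (Seq c d) s (T1 + T2) Q"
proof -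
  from assms(1) obtain t1 s1 where 1: "runs c s t1 s1" "t1 \<le> T1" "Q1 s1" by (auto simp: reach_def)
  from assms(2)[OF runs_frame[OF 1(1)] 1(3)] obtain t2 s2 where "runs d s1 t2 s2" "t2 \<le> T2" "Q s2"
    by (auto simp: reach_def)
  with 1 show ?thesis unfolding reach_def by (intro exI[of _ "t1 + t2"] exI[of _ s2]) (auto intro: runs_Seq)
qed

lemma reach_Cond:
  assumes "bval B s \<Longrightarrow> reach c s T Q" "\<not> bval B s \<Longrightarrow> reach d s T Q"
  shows "reach (Cond B c d) s (btime B + 1 + T) Q"
proof (cases "bval B s")
  case True
  with assms obtain t s' where "runs c s t s'" "t \<le> T" "Q s'" by (auto simp: reach_def)
  with True runs_CondTrue[of B s c t s' d] show ?thesis unfolding reach_def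
    by (intro exI[of _ "btime B + 1 + t"] exI[of _ s']) auto
next
  case False
  with assms obtain t s' where "runs d s t s'" "t \<le> T" "Q s'" by (auto simp: reach_def)
  with False runs_CondFalse[of B s d t s' c] show ?thesis unfolding reach_def
    by (intro exI[of _ "btime B + 1 + t"] exI[of _ s']) auto
qed

text \<open>The frame hypothesis relates each intermediate state to the state before the loop, not
  merely to the previous iteration.\<close>

lemma reach_While:
  assumes "I s" "\<mu> s \<le> (N :: nat)"
    and step: "\<And>s'. frame c s s' \<Longrightarrow> I s' \<Longrightarrow> bval B s' \<Longrightarrow> reach c s' T (\<lambda>s''. I s'' \<and> \<mu> s'' < \<mu> s')"
  shows "reach (While B c) s (N * (T + btime B + 1) + btime B + 1) (\<lambda>s'. I s' \<and> \<not> bval B s')"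
proof -
  have "reach (While B c) s' (N * (T + btime B + 1) + btime B + 1) (\<lambda>s'. I s' \<and> \<not> bval B s')"
    if "frame c s s'" "I s'" "\<mu> s' \<le> N" for s'
    using that
  proof (induction N arbitrary: s')
    case 0
    \<comment> \<open>A further iteration would have to decrease a measure that is already
      \<open>0\<close>.\<close>
    have "\<not> bval B s'"
      using step[OF 0(1,2)] 0(3) by (auto simp: reach_def)
    with 0 show ?case by (auto simp: reach_def intro!: exI runs_WhileFalse)
  next
    case (Suc N)
    show ?case
    proof (cases "bval B s'")
      case True
      from step[OF Suc.prems(1,2) True] obtain t s1 where 1: "runs c s' t s1" "t \<le> T" "I s1" "\<mu> s1 < \<mu> s'"
        by (auto simp: reach_def)
      have "frame c s s1" using Suc.prems(1) runs_frame[OF 1(1)] by (simp add: frame_def)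
      from Suc.IH[OF this 1(3)] 1(4) Suc.prems(3) obtain t2 s2 where
        "runs (While B c) s1 t2 s2" "t2 \<le> N * (T + btime B + 1) + btime B + 1" "I s2" "\<not> bval B s2"
        by (auto simp: reach_def)
      with 1 True runs_WhileTrue[of B s' c t s1 t2 s2] show ?thesis unfolding reach_def
        by (intro exI[of _ "btime B + 1 + t + t2"] exI[of _ s2]) auto
    next
      case False
      with Suc.prems show ?thesis by (auto simp: reach_def intro!: exI runs_WhileFalse)
    qed
  qed
  from this[OF frame_refl assms(1,2)] show ?thesis .
qed

section \<open>Straight-line code and counting loops\<close>

fun loop_free :: "com \<Rightarrow> bool" where
  "loop_free (While _ _) = False"
| "loop_free (Seq c d) = (loop_free c \<and> loop_free d)"
| "loop_free (Cond _ c d) = (loop_free c \<and> loop_free d)"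
| "loop_free _ = True"

text \<open>Lets the simplifier compute final states of straight-line code. The clauses for
  \<open>While\<close>, here and in \<open>ctime\<close>, are dummies excluded by
  \<open>loop_free\<close>.\<close>

fun exec :: "com \<Rightarrow> state \<Rightarrow> state" where
  "exec Skip s = s"
| "exec (IAssign x p) s = s\<lparr>ivar := (ivar s)(x := ival p s)\<rparr>"
| "exec (IStore a i p) s = s\<lparr>iarr := (iarr s)(a := (iarr s a)(ival i s := ival p s))\<rparr>"
| "exec (RAssign x p) s = s\<lparr>rvar := (rvar s)(x := rval p s)\<rparr>"
| "exec (RStore a i p) s = s\<lparr>rarr := (rarr s)(a := (rarr s a)(ival i s := rval p s))\<rparr>"
| "exec (Seq c d) s = exec d (exec c s)"
| "exec (Cond B c d) s = (if bval B s then exec c s else exec d s)"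
| "exec (While B c) s = s"

fun ctime :: "com \<Rightarrow> nat" where
  "ctime Skip = 1"
| "ctime (IAssign x p) = itime p + 1"
| "ctime (IStore a i p) = itime i + itime p + 1"
| "ctime (RAssign x p) = rtime p + 1"
| "ctime (RStore a i p) = itime i + rtime p + 1"
| "ctime (Seq c d) = ctime c + ctime d"
| "ctime (Cond B c d) = btime B + 1 + max (ctime c) (ctime d)"
| "ctime (While B c) = 0"

lemma reach_exec:
  assumes "loop_free c" "Q (exec c s)"
  shows "reach c s (ctime c) Q"
proof -
  have "\<exists>t. runs c s t (exec c s) \<and> t \<le> ctime c"
    using assms(1)
  proof (induction c arbitrary: s)
    case (Seq c d)
    then obtain t1 t2 where "runs c s t1 (exec c s)" "t1 \<le> ctime c"
      "runs d (exec c s) t2 (exec d (exec c s))" "t2 \<le> ctime d" by fastforce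
    then show ?case by (auto intro!: exI[of _ "t1 + t2"] runs_Seq)
  next
    case (Cond B c d)
    then obtain t1 t2 where "runs c s t1 (exec c s)" "t1 \<le> ctime c" "runs d s t2 (exec d s)" "t2 \<le> ctime d"
      by fastforce
    then show ?case
      by (cases "bval B s") (auto intro: exI[of _ "btime B + 1 + t1"] exI[of _ "btime B + 1 + t2"] runs_CondTrue runs_CondFalse)
  qed (auto intro: runs.intros)
  with assms(2) show ?thesis by (auto simp: reach_def)
qed

lemma reach_Seq_exec:
  assumes "loop_free c" "reach d (exec c s) T Q"
  shows "reach (Seq c d) s (ctime c + T) Q"
  by (rule reach_Seq[OF reach_exec[OF assms(1), where Q = "\<lambda>s'. s' = exec c s"]]) (use assms(2) in auto)

definition For :: "vname \<Rightarrow> vname \<Rightarrow> com \<Rightarrow> com" where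
  "For x y c = Seq (IAssign x (ICon 0))
     (While (ILess (IVar x) (IVar y)) (Seq c (IAssign x (IPlus (IVar x) (ICon 1)))))"

text \<open>An iteration adds \<open>4\<close> for the test and \<open>4\<close> for the increment;
  the \<open>6\<close> is \<open>2\<close> for the initial assignment and \<open>4\<close> for the
  last test.\<close>

definition for_time :: "nat \<Rightarrow> nat \<Rightarrow> nat" where
  "for_time N T = N * (T + 8) + 6"

lemma wvars_For [simp]: "wvars (For x y c) = insert x (wvars c)"
  by (auto simp: For_def)

lemma warrs_For [simp]: "warrs (For x y c) = warrs c"
  by (auto simp: For_def)

definition set_ivar :: "vname \<Rightarrow> int \<Rightarrow> state \<Rightarrow> state" where
  "set_ivar x k s = s\<lparr>ivar := (ivar s)(x := k)\<rparr>"

lemma set_ivar_simps [simp]: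
  "ivar (set_ivar x k s) = (ivar s)(x := k)" "iarr (set_ivar x k s) = iarr s"
  by (simp_all add: set_ivar_def)

text \<open>\<open>set_ivar\<close> stands for the reset or increment of the counter, so the body is
  verified without its loop bookkeeping.\<close>

lemma reach_For:
  assumes N: "ivar s y = int N" and y: "y \<noteq> x" "y \<notin> wvars c" and x: "x \<notin> wvars c"
    and init: "I 0 (set_ivar x 0 s)"
    and step: "\<And>k s'. k < N \<Longrightarrow> I k s' \<Longrightarrow> ivar s' x = int k \<Longrightarrow> frame (For x y c) s s' \<Longrightarrow>
      reach c s' T (\<lambda>s''. I (Suc k) (set_ivar x (int (Suc k)) s''))"
  shows "reach (For x y c) s (for_time N T) (I N)"
proof -
  let ?B = "ILess (IVar x) (IVar y)" and ?c = "Seq c (IAssign x (IPlus (IVar x) (ICon 1)))"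
  let ?J = "\<lambda>s'. \<exists>k\<le>N. ivar s' x = int k \<and> I k s' \<and> ivar s' y = int N"
  let ?s0 = "set_ivar x 0 s"
  have "reach (While ?B ?c) ?s0 (N * ((T + 4) + btime ?B + 1) + btime ?B + 1) (\<lambda>s'. ?J s' \<and> \<not> bval ?B s')"
  proof (rule reach_While[where \<mu> = "\<lambda>s. nat (int N - ivar s x)"])
    show "?J ?s0" using init N y by (intro exI[of _ 0]) simp
  next
    fix s' assume fr: "frame ?c ?s0 s'" and J: "?J s'" and B: "bval ?B s'"
    then obtain k where k: "k < N" "ivar s' x = int k" "I k s'" "ivar s' y = int N" by auto
    have fr': "frame (For x y c) s s'" using fr by (simp add: frame_def)
    have "reach ?c s' (T + 4) (\<lambda>s''. I (Suc k) s'' \<and> ivar s'' x = int (Suc k) \<and> ivar s'' y = int N)"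
    proof (rule reach_Seq)
      show "reach c s' T (\<lambda>s''. I (Suc k) (set_ivar x (int (Suc k)) s''))"
        by (rule step[OF k(1,3,2) fr'])
    next
      fix s'' assume fr: "frame c s' s''" and "I (Suc k) (set_ivar x (int (Suc k)) s'')"
      moreover have "ivar s'' x = int k" "ivar s'' y = int N"
        using frame_ivar[OF fr] x y k by auto
      ultimately show "reach (IAssign x (IPlus (IVar x) (ICon 1))) s'' 4
          (\<lambda>s''. I (Suc k) s'' \<and> ivar s'' x = int (Suc k) \<and> ivar s'' y = int N)"
        using y by (intro reach_mono[OF reach_exec]) (auto simp: set_ivar_def add.commute)
    qed
    then show "reach ?c s' (T + 4) (\<lambda>s''. ?J s'' \<and> nat (int N - ivar s'' x) < nat (int N - ivar s' x))"
      by (rule reach_mono) (use k in \<open>auto intro!: exI[of _ "Suc k"]\<close>)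
  qed (use N in simp)
  then have "reach (While ?B ?c) ?s0 (N * (T + 8) + 4) (I N)"
    by (rule reach_mono) (auto simp: le_less)
  then have "reach (For x y c) s (2 + (N * (T + 8) + 4)) (I N)"
    using reach_Seq_exec[of "IAssign x (ICon 0)" _ s "N * (T + 8) + 4" "I N"]
    by (simp add: set_ivar_def For_def)
  then show ?thesis by (rule reach_mono) (auto simp: for_time_def)
qed

lemma for_time_mono: "N \<le> N' \<Longrightarrow> T \<le> T' \<Longrightarrow> for_time N T \<le> for_time N' T'"
  by (auto simp: for_time_def intro!: mult_le_mono)

section \<open>The program\<close>

text \<open>Matrices are stored row by row. As the machine cannot multiply, the array
  \<open>row\<close> supplies the offsets \<open>u * n\<close>, built up by repeated
  addition.\<close>

definition entry :: "iexp \<Rightarrow> iexp \<Rightarrow> iexp" where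
  "entry u w = IPlus (IArr ''row'' u) w"

definition Bump :: "vname \<Rightarrow> iexp \<Rightarrow> iexp \<Rightarrow> com" where
  "Bump A i p = IStore A i (IPlus (IArr A i) p)"

definition Inc :: "vname \<Rightarrow> com" where
  "Inc x = IAssign x (IPlus (IVar x) (ICon 1))"

definition check_demands :: com where
  "check_demands = Seq (IAssign ''feasible'' (ICon 1))
     (For ''e'' ''m'' (Cond (ILess (IArr ''fmin'' (IVar ''e'')) (ICon 0))
       (IAssign ''feasible'' (ICon 0)) Skip))"

definition init_rows :: com where
  "init_rows = Seq (IAssign ''r'' (ICon 0))
     (For ''u'' ''n'' (Seq (IStore ''row'' (IVar ''u'') (IVar ''r''))
       (IAssign ''r'' (IPlus (IVar ''r'') (IVar ''n'')))))"

definition init_freqs :: com where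
  "init_freqs = For ''e'' ''m''
     (Seq (IStore ''F'' (entry (IArr ''src'' (IVar ''e'')) (IArr ''dst'' (IVar ''e''))) (IArr ''fmin'' (IVar ''e'')))
       (IStore ''F'' (entry (IArr ''dst'' (IVar ''e'')) (IArr ''src'' (IVar ''e''))) (IArr ''fmin'' (IVar ''e''))))"

text \<open>The array \<open>hop\<close> holds, for every root \<open>w\<close>, the number \<open>next_hop u w + 1\<close> of each vertex
  \<open>u\<close> that has been reached from \<open>w\<close>, and \<open>0\<close> for the others.\<close>

definition relax_edge :: com where
  "relax_edge =
     Seq (IAssign ''a'' (IArr ''src'' (IVar ''e'')))
    (Seq (IAssign ''c'' (IArr ''dst'' (IVar ''e'')))
    (Cond (BAnd (ILess (ICon 0) (IArr ''hop'' (entry (IVar ''w'') (IVar ''a''))))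
             (BNot (ILess (ICon 0) (IArr ''hop'' (entry (IVar ''w'') (IVar ''c''))))))
       (IStore ''hop'' (entry (IVar ''w'') (IVar ''c'')) (IPlus (IVar ''a'') (ICon 1)))
    (Cond (BAnd (ILess (ICon 0) (IArr ''hop'' (entry (IVar ''w'') (IVar ''c''))))
             (BNot (ILess (ICon 0) (IArr ''hop'' (entry (IVar ''w'') (IVar ''a''))))))
       (IStore ''hop'' (entry (IVar ''w'') (IVar ''a'')) (IPlus (IVar ''c'') (ICon 1)))
       Skip)))"

text \<open>In the manner of Bellman and Ford: the edges come in arbitrary order, and scanning all
  of them \<open>n\<close> times per root avoids adjacency lists while staying cubic in
  total.\<close>

definition compute_hops :: com where
  "compute_hops = For ''w'' ''n''
     (Seq (IStore ''hop'' (entry (IVar ''w'') (IVar ''w'')) (IPlus (IVar ''w'') (ICon 1)))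
       (For ''r'' ''n'' (For ''e'' ''m'' relax_edge)))"

text \<open>The two negated comparisons test equality. Row \<open>u\<close> of \<open>hop\<close>
  belongs to the root \<open>u\<close>, so its entry at \<open>v\<close> is
  \<open>next_hop v u + 1\<close>.\<close>

definition push_vertex :: com where
  "push_vertex =
     Cond (BAnd (BNot (ILess (IArr ''hop'' (entry (IVar ''u'') (IVar ''v''))) (IPlus (IVar ''g'') (ICon 1))))
             (BNot (ILess (IPlus (IVar ''g'') (ICon 1)) (IArr ''hop'' (entry (IVar ''u'') (IVar ''v''))))))
       (Seq (IStore ''lst'' (IVar ''q'') (IVar ''u''))
       (Seq (IAssign ''S'' (IPlus (IVar ''S'') (IArr ''F'' (entry (IVar ''v'') (IVar ''u'')))))
       (Seq (Inc ''q'') (IStore ''cum'' (IVar ''q'') (IVar ''S'')))))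
       Skip"

definition push_group :: com where
  "push_group =
     Seq (IAssign ''B'' (IVar ''S''))
    (Seq (For ''u'' ''n'' push_vertex)
    (Cond (ILess (IVar ''M'') (IMinus (IVar ''S'') (IVar ''B'')))
       (IAssign ''M'' (IMinus (IVar ''S'') (IVar ''B''))) Skip))"

definition list_ends :: com where
  "list_ends =
     Seq (Seq (IAssign ''q'' (ICon 0)) (Seq (IAssign ''S'' (ICon 0))
       (Seq (IAssign ''M'' (ICon 0)) (IStore ''cum'' (ICon 0) (ICon 0)))))
       (For ''g'' ''n'' push_group)"

definition init_match :: com where
  "init_match =
     Seq (IAssign ''D'' (IMinus (IVar ''S'') (IHalf (IVar ''S''))))
    (Seq (Cond (ILess (IVar ''D'') (IVar ''M'')) (IAssign ''D'' (IVar ''M'')) Skip)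
    (Seq (IAssign ''i'' (ICon 0)) (Seq (IAssign ''j'' (ICon 0)) (IAssign ''x'' (ICon 0)))))"

definition merge_lines :: com where
  "merge_lines =
     Seq (IAssign ''a'' (IArr ''lst'' (IVar ''i'')))
    (Seq (IAssign ''c'' (IArr ''lst'' (IVar ''j'')))
    (Seq (IAssign ''up'' (IMinus (IVar ''t'') (IVar ''x'')))
    (Seq (IAssign ''down'' (IMinus (IVar ''x'') (IVar ''t'')))
    (Seq (Bump ''F'' (entry (IVar ''a'') (IVar ''c'')) (IVar ''up''))
    (Seq (Bump ''F'' (entry (IVar ''c'') (IVar ''a'')) (IVar ''up''))
    (Seq (Bump ''F'' (entry (IVar ''v'') (IVar ''a'')) (IVar ''down''))
    (Seq (Bump ''F'' (entry (IVar ''a'') (IVar ''v'')) (IVar ''down''))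
    (Seq (Bump ''F'' (entry (IVar ''v'') (IVar ''c'')) (IVar ''down''))
    (Seq (Bump ''F'' (entry (IVar ''c'') (IVar ''v'')) (IVar ''down''))
         (IAssign ''x'' (IVar ''t'')))))))))))"

definition match_step :: com where
  "match_step =
     Seq (Seq (IAssign ''y'' (IArr ''cum'' (IPlus (IVar ''i'') (ICon 1))))
         (Seq (IAssign ''z'' (IMinus (IArr ''cum'' (IPlus (IVar ''j'') (ICon 1))) (IVar ''D'')))
              (Cond (ILess (IVar ''y'') (IVar ''z'')) (IAssign ''t'' (IVar ''y'')) (IAssign ''t'' (IVar ''z'')))))
    (Seq (Cond (ILess (IVar ''x'') (IVar ''t'')) merge_lines Skip)
         (Cond (ILess (IVar ''y'') (IVar ''z'')) (Inc ''i'') (Inc ''j'')))"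

definition process_vertices :: com where
  "process_vertices = For ''v'' ''n''
     (Seq list_ends (Seq init_match (While (ILess (IVar ''j'') (IVar ''n'')) match_step)))"

definition push_path :: com where
  "push_path = Seq (IStore ''path'' (IVar ''pos'') (IVar ''c'')) (Inc ''pos'')"

definition write_line :: com where
  "write_line =
     Seq (Seq (IStore ''freq'' (IVar ''k'') (IArr ''F'' (entry (IVar ''u'') (IVar ''w''))))
         (Seq (IAssign ''c'' (IVar ''u'')) push_path))
    (Seq (While (BNot (BAnd (BNot (ILess (IVar ''c'') (IVar ''w''))) (BNot (ILess (IVar ''w'') (IVar ''c'')))))
            (Seq (IAssign ''c'' (IMinus (IArr ''hop'' (entry (IVar ''w'') (IVar ''c''))) (ICon 1))) push_path))
         (Seq (Inc ''k'') (IStore ''start'' (IVar ''k'') (IVar ''pos''))))"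

definition write_lines :: com where
  "write_lines =
     Seq (Seq (IAssign ''k'' (ICon 0)) (Seq (IAssign ''pos'' (ICon 0)) (IStore ''start'' (ICon 0) (ICon 0))))
       (For ''u'' ''n'' (For ''w'' ''u'' write_line))"

definition lpal_program :: com where
  "lpal_program = Seq check_demands
     (Cond (ILess (ICon 0) (IVar ''feasible''))
       (Seq init_rows (Seq init_freqs (Seq compute_hops (Seq process_vertices write_lines)))) Skip)"


text \<open>The nesting mirrors the program, so that the time rules can be applied literally; the
  numbers are rounded-up step counts of the straight-line pieces.\<close>

definition program_time :: "nat \<Rightarrow> nat" where
  "program_time k = 2 + for_time k 10 + (4 + (2 + for_time k 10 + (for_time k 40 +
     (for_time k (10 + for_time k (for_time k 70)) +
     (for_time k (10 + for_time k (20 + for_time k 50) + (50 + for_time (2 * k) 200)) +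
     (10 + for_time k (for_time k (for_time k 40 + 40))))))))"

lemma program_time_le:
  assumes "1 \<le> k"
  shows "program_time k \<le> 1000 * k ^ 3"
proof -
  have "k * 1 \<le> k * k" using assms by (intro mult_le_mono) auto
  moreover have "1 * (k * k) \<le> k * (k * k)" using assms by (intro mult_le_mono) auto
  \<comment> \<open>The coefficients add up to \<open>958\<close>, which explains the constant
    \<open>1000\<close>.\<close>
  moreover have "program_time k = 54 + 202 * k + 518 * (k * k) + 184 * (k * (k * k))"
    by (simp add: program_time_def for_time_def algebra_simps)
  moreover have "k ^ 3 = k * (k * k)" by (simp add: power3_eq_cube)
  ultimately show ?thesis using assms by linarith
qed


section \<open>Correctness of the program\<close>

text \<open>Entries outside the range count as \<open>0\<close>, so that matrices can be compared as functions.\<close>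

definition cell :: "nat \<Rightarrow> (int \<Rightarrow> int) \<Rightarrow> nat \<Rightarrow> nat \<Rightarrow> int" where
  "cell n A u w = (if u < n \<and> w < n then A (int u * int n + int w) else 0)"

text \<open>Naming the update keeps nested bumps symbolic, so that \<open>cell_add_at\<close> turns
  them into \<open>kdelta\<close> terms without asking which indices coincide.\<close>

definition add_at :: "(int \<Rightarrow> int) \<Rightarrow> int \<Rightarrow> int \<Rightarrow> int \<Rightarrow> int" where
  "add_at A i w = A(i := A i + w)"

lemma index_eq_iff:
  assumes "w < n" "q < n"
  shows "int u * int n + int w = int p * int n + int q \<longleftrightarrow> u = p \<and> w = q"
proof
  assume "int u * int n + int w = int p * int n + int q"
  then have "int (u * n + w) = int (p * n + q)" by simp
  then have eq: "u * n + w = p * n + q" by (simp only: of_nat_eq_iff)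
  have "(u * n + w) div n = u" "(p * n + q) div n = p" using assms by auto
  with eq have "u = p" by metis
  with eq show "u = p \<and> w = q" by simp
qed simp

lemma cell_update:
  "p < n \<Longrightarrow> q < n \<Longrightarrow> cell n (A(int p * int n + int q := z)) u w = (if u = p \<and> w = q then z else cell n A u w)"
  by (auto simp: cell_def index_eq_iff)

lemma cell_add_at:
  "a < n \<Longrightarrow> c < n \<Longrightarrow> cell n (add_at A (int a * int n + int c) w) = (\<lambda>p q. cell n A p q + w * kdelta a c p q)"
  by (intro ext) (auto simp: add_at_def cell_def index_eq_iff)

lemma exec_Bump [simp]:
  "exec (Bump A i p) s = s\<lparr>iarr := (iarr s)(A := add_at (iarr s A) (ival i s) (ival p s))\<rparr>"
  "loop_free (Bump A i p)" "wvars (Bump A i p) = {}" "warrs (Bump A i p) = {A}"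
  by (simp_all add: Bump_def add_at_def)

lemma exec_Inc [simp]:
  "exec (Inc x) s = s\<lparr>ivar := (ivar s)(x := ivar s x + 1)\<rparr>"
  "loop_free (Inc x)" "wvars (Inc x) = {x}" "warrs (Inc x) = {}"
  by (simp_all add: Inc_def)

section \<open>Reading the input and building the initial matrix\<close>

locale lp_run = fixed_demand +
  fixes es :: "(nat \<times> nat) list"
  assumes listing: "edge_listing (network I) es"
begin

abbreviation "m \<equiv> length es"

definition env :: "state \<Rightarrow> bool" where
  "env s \<longleftrightarrow> ivar s ''n'' = int n \<and> ivar s ''m'' = int m \<and>
     (\<forall>k<m. iarr s ''src'' (int k) = int (fst (es ! k)) \<and> iarr s ''dst'' (int k) = int (snd (es ! k)) \<and>
        iarr s ''fmin'' (int k) = b {fst (es ! k), snd (es ! k)})"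

definition rows :: "state \<Rightarrow> bool" where
  "rows s \<longleftrightarrow> (\<forall>u<n. iarr s ''row'' (int u) = int u * int n)"

lemma edges_eq: "E = (\<lambda>(u, v). {u, v}) ` set es"
  using listing by (auto simp: edge_listing_def)

lemma nth_edge:
  assumes "k < m"
  shows "{fst (es ! k), snd (es ! k)} \<in> E" and "fst (es ! k) < n" and "snd (es ! k) < n"
    and "fst (es ! k) \<noteq> snd (es ! k)"
proof -
  have "es ! k \<in> set es" using assms by simp
  then show e: "{fst (es ! k), snd (es ! k)} \<in> E" unfolding edges_eq by (force simp: case_prod_beta)
  then show "fst (es ! k) < n" "snd (es ! k) < n" "fst (es ! k) \<noteq> snd (es ! k)"
    by (auto elim!: edgeE simp: doubleton_eq_iff)
qed

lemma edge_nth: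
  assumes "e \<in> E"
  obtains k where "k < m" "e = {fst (es ! k), snd (es ! k)}"
proof -
  from assms obtain z where "z \<in> set es" "e = {fst z, snd z}"
    unfolding edges_eq by (force simp: case_prod_beta)
  then show thesis using that by (metis in_set_conv_nth)
qed

lemma m_le_n: "m \<le> n"
proof -
  have "m = length (map (\<lambda>(u, v). {u, v}) es)" by simp
  also have "\<dots> = card E"
    using listing distinct_card unfolding edge_listing_def by metis
  also have "\<dots> \<le> n" by (rule card_E_le)
  finally show ?thesis .
qed

lemma env_input: "env (input_state I es)"
  using vertices by (auto simp: env_def input_state_def array_of_def case_prod_beta)

lemma env_frame:
  "frame c s s' \<Longrightarrow> env s \<Longrightarrow> {''n'', ''m''} \<inter> wvars c = {} \<Longrightarrow> {''src'', ''dst'', ''fmin''} \<inter> warrs c = {} \<Longrightarrow> env s'"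
  by (simp add: env_def frame_def)

lemma rows_frame: "frame c s s' \<Longrightarrow> rows s \<Longrightarrow> ''row'' \<notin> warrs c \<Longrightarrow> rows s'"
  by (simp add: rows_def frame_def)

lemma check_demands:
  assumes "env s"
  shows "reach check_demands s (2 + for_time n 10)
    (\<lambda>s'. ivar s' ''feasible'' = (if \<forall>e\<in>E. 0 \<le> b e then 1 else 0))"
proof -
  let ?c = "Cond (ILess (IArr ''fmin'' (IVar ''e'')) (ICon 0)) (IAssign ''feasible'' (ICon 0)) Skip"
  let ?s = "exec (IAssign ''feasible'' (ICon 1)) s"
  let ?I = "\<lambda>k s'. ivar s' ''feasible'' = (if \<forall>l<k. 0 \<le> b {fst (es ! l), snd (es ! l)} then 1 else 0)"
  have "reach (For ''e'' ''m'' ?c) ?s (for_time m (ctime ?c)) (?I m)"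
  proof (rule reach_For[where I = ?I])
    fix k s' assume k: "k < m" and I: "?I k s'" "ivar s' ''e'' = int k" and fr: "frame (For ''e'' ''m'' ?c) ?s s'"
    have "env ?s" using assms by (simp add: env_def)
    from env_frame[OF fr this] have "env s'" by simp
    then show "reach ?c s' (ctime ?c) (\<lambda>s''. ?I (Suc k) (set_ivar ''e'' (int (Suc k)) s''))"
      using I k by (intro reach_exec) (auto simp: env_def less_Suc_eq)
  qed (use assms in \<open>simp_all add: env_def\<close>)
  then have "reach check_demands s (2 + for_time m (ctime ?c)) (?I m)"
    using reach_Seq_exec[of "IAssign ''feasible'' (ICon 1)" _ s "for_time m (ctime ?c)" "?I m"]
    by (simp add: check_demands_def)
  moreover have "(\<forall>l<m. 0 \<le> b {fst (es ! l), snd (es ! l)}) \<longleftrightarrow> (\<forall>e\<in>E. 0 \<le> b e)"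
    using nth_edge(1) edge_nth by metis
  ultimately show ?thesis
    by (auto intro!: for_time_mono m_le_n elim!: reach_mono)
qed

lemma init_rows:
  assumes "env s"
  shows "reach init_rows s (2 + for_time n 10) rows"
proof -
  let ?c = "Seq (IStore ''row'' (IVar ''u'') (IVar ''r'')) (IAssign ''r'' (IPlus (IVar ''r'') (IVar ''n'')))"
  let ?s = "exec (IAssign ''r'' (ICon 0)) s"
  let ?I = "\<lambda>k s'. ivar s' ''r'' = int k * int n \<and> (\<forall>u<k. iarr s' ''row'' (int u) = int u * int n)"
  have "reach (For ''u'' ''n'' ?c) ?s (for_time n (ctime ?c)) (?I n)"
  proof (rule reach_For[where I = ?I])
    fix k s' assume k: "k < n" and I: "?I k s'" "ivar s' ''u'' = int k" and fr: "frame (For ''u'' ''n'' ?c) ?s s'"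
    have "env ?s" using assms by (simp add: env_def)
    from env_frame[OF fr this] have "env s'" by simp
    then show "reach ?c s' (ctime ?c) (\<lambda>s''. ?I (Suc k) (set_ivar ''u'' (int (Suc k)) s''))"
      using I by (intro reach_exec) (auto simp: env_def less_Suc_eq algebra_simps)
  qed (use assms in \<open>simp_all add: env_def\<close>)
  then have "reach init_rows s (2 + for_time n (ctime ?c)) (?I n)"
    using reach_Seq_exec[of "IAssign ''r'' (ICon 0)" _ s "for_time n (ctime ?c)" "?I n"]
    by (simp add: init_rows_def)
  then show ?thesis by (rule reach_mono) (auto simp: rows_def intro!: for_time_mono)
qed

lemma init_freqs:
  assumes "env s" "rows s" "\<And>i. iarr s ''F'' i = 0"
  shows "reach init_freqs s (for_time n 40) (\<lambda>s'. cell n (iarr s' ''F'') = edge_matrix)"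
proof -
  let ?c = "Seq (IStore ''F'' (entry (IArr ''src'' (IVar ''e'')) (IArr ''dst'' (IVar ''e''))) (IArr ''fmin'' (IVar ''e'')))
       (IStore ''F'' (entry (IArr ''dst'' (IVar ''e'')) (IArr ''src'' (IVar ''e''))) (IArr ''fmin'' (IVar ''e'')))"
  let ?e = "\<lambda>l. {fst (es ! l), snd (es ! l)}"
  let ?I = "\<lambda>k s'. \<forall>u w. cell n (iarr s' ''F'') u w = (if \<exists>l<k. {u, w} = ?e l then b {u, w} else 0)"
  have "reach init_freqs s (for_time m (ctime ?c)) (?I m)"
    unfolding init_freqs_def
  proof (rule reach_For[where I = ?I])
    fix k s' assume k: "k < m" and I: "?I k s'" "ivar s' ''e'' = int k" and fr: "frame (For ''e'' ''m'' ?c) s s'"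
    have en: "env s'" using env_frame[OF fr assms(1)] by simp
    have ro: "rows s'" using rows_frame[OF fr assms(2)] by simp
    note lt = nth_edge[OF k]
    have "cell n (iarr (exec ?c s') ''F'') u w = (if {u, w} = ?e k then b (?e k) else cell n (iarr s' ''F'') u w)" for u w
      using en ro lt k I(2) by (auto simp: env_def rows_def entry_def cell_update doubleton_eq_iff)
    then have "?I (Suc k) (set_ivar ''e'' (int (Suc k)) (exec ?c s'))"
      using I(1) by (auto simp: less_Suc_eq)
    then show "reach ?c s' (ctime ?c) (\<lambda>s''. ?I (Suc k) (set_ivar ''e'' (int (Suc k)) s''))"
      by (intro reach_exec) (auto simp: entry_def)
  qed (use assms in \<open>simp_all add: env_def cell_def\<close>)
  moreover have "(\<exists>l<m. {u, w} = ?e l) \<longleftrightarrow> {u, w} \<in> E" for u w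
    using nth_edge(1) edge_nth by metis
  ultimately have "reach init_freqs s (for_time m (ctime ?c)) (\<lambda>s'. cell n (iarr s' ''F'') = edge_matrix)"
    by (auto simp: edge_matrix_def fun_eq_iff elim!: reach_mono)
  then show ?thesis by (rule reach_mono) (auto simp: entry_def intro!: for_time_mono m_le_n)
qed

section \<open>Computing all next hops\<close>

definition hops :: "state \<Rightarrow> bool" where
  "hops s \<longleftrightarrow> (\<forall>w<n. \<forall>u<n. iarr s ''hop'' (int w * int n + int u) = int (next_hop u w) + 1)"

text \<open>Beyond correctness of the positive entries, the reached vertices are closed under
  stepping towards the root; so the whole path from a reached vertex is reached.\<close>

definition sound_hops :: "nat \<Rightarrow> (nat \<Rightarrow> int) \<Rightarrow> bool" where
  "sound_hops w h \<longleftrightarrow> h w = int w + 1 \<and>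
     (\<forall>u<n. 0 < h u \<longrightarrow> h u = int (next_hop u w) + 1 \<and> 0 < h (next_hop u w))"

lemma sound_hops_path:
  assumes h: "sound_hops w h" and w: "w < n"
  shows "a < n \<Longrightarrow> 0 < h a \<Longrightarrow> x \<in> set (tpath a w) \<Longrightarrow> 0 < h x"
proof (induction "length (tpath a w)" arbitrary: a rule: less_induct)
  case less
  show ?case
  proof (cases "a = w")
    case False
    note t = tpath_Cons[OF less.prems(1) w False]
    have "0 < h (next_hop a w)" using h less.prems by (simp add: sound_hops_def)
    with less.hyps[of "next_hop a w"] t less.prems show ?thesis by auto
  qed (use less.prems w in simp)
qed

text \<open>The unreached \<open>c\<close> cannot lie on the path from the reached \<open>a\<close>
  to the root, so prepending \<open>c\<close> gives the path of \<open>c\<close>.\<close>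

lemma sound_hops_extend:
  assumes h: "sound_hops w h" and w: "w < n" and e: "{a, c} \<in> E" and a: "0 < h a" and c: "\<not> 0 < h c"
  shows "sound_hops w (h(c := int a + 1))"
proof -
  have lt: "a < n" using e by (auto elim!: edgeE simp: doubleton_eq_iff)
  have "c \<notin> set (tpath a w)" using sound_hops_path[OF h w lt a] c by blast
  then have "next_hop c w = a" using e w by (intro tpath_extend) (simp_all add: insert_commute)
  moreover have "w \<noteq> c" using h c by (auto simp: sound_hops_def)
  ultimately show ?thesis using h a c by (auto simp: sound_hops_def)
qed

lemma relax_edge:
  assumes "env s" "rows s" and w: "w < n" "ivar s ''w'' = int w" and k: "k < m" "ivar s ''e'' = int k"
    and "H = cell n (iarr s ''hop'')" "H' = cell n (iarr (exec relax_edge s) ''hop'')"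
    and h: "sound_hops w (H w)" and "a = fst (es ! k)" "c = snd (es ! k)"
  shows "sound_hops w (H' w)" and "\<And>u. 0 < H w u \<Longrightarrow> 0 < H' w u"
    and "0 < H w a \<or> 0 < H w c \<Longrightarrow> 0 < H' w a \<and> 0 < H' w c"
    and "\<And>w'. w' \<noteq> w \<Longrightarrow> H' w' = H w'"
proof -
  note e = nth_edge[OF k(1), folded \<open>a = _\<close> \<open>c = _\<close>]
  have ac: "iarr s ''hop'' (int w * int n + int a) = H w a" "iarr s ''hop'' (int w * int n + int c) = H w c"
    using e w by (simp_all add: \<open>H = _\<close> cell_def)
  have H': "H' w' u = (if 0 < H w a \<and> \<not> 0 < H w c then (if w' = w \<and> u = c then int a + 1 else H w' u)
     else if 0 < H w c \<and> \<not> 0 < H w a then (if w' = w \<and> u = a then int c + 1 else H w' u) else H w' u)" for w' u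
  proof -
    have v: "iarr s ''src'' (int k) = int a" "iarr s ''dst'' (int k) = int c" "iarr s ''row'' (int w) = int w * int n"
      using assms by (simp_all add: env_def rows_def)
    show ?thesis
      using v w k e ac unfolding \<open>H' = _\<close> \<open>H = _\<close>
      by (simp add: relax_edge_def entry_def cell_update)
  qed
  have Hw: "H' w = (if 0 < H w a \<and> \<not> 0 < H w c then (H w)(c := int a + 1)
      else if 0 < H w c \<and> \<not> 0 < H w a then (H w)(a := int c + 1) else H w)"
    by (rule ext) (simp add: H')
  show "sound_hops w (H' w)"
    unfolding Hw using sound_hops_extend[OF h w(1), of a c] sound_hops_extend[OF h w(1), of c a] e h
    by (simp add: insert_commute)
  show "0 < H' w u" if "0 < H w u" for u using that by (simp add: H')
  show "0 < H' w a \<and> 0 < H' w c" if "0 < H w a \<or> 0 < H w c" using that by (auto simp: H')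
  show "H' w' = H w'" if "w' \<noteq> w" for w' using that by (intro ext) (simp add: H')
qed

definition reached :: "nat \<Rightarrow> (nat \<Rightarrow> int) \<Rightarrow> nat \<Rightarrow> bool" where
  "reached w h r \<longleftrightarrow> (\<forall>u<n. length (tpath u w) \<le> Suc r \<longrightarrow> 0 < h u)"

lemma relax_round:
  assumes en: "env s" and ro: "rows s" and w: "w < n" "ivar s ''w'' = int w"
    and "H = cell n (iarr s ''hop'')" and h: "sound_hops w (H w)" and r: "reached w (H w) r"
  shows "reach (For ''e'' ''m'' relax_edge) s (for_time m (ctime relax_edge))
    (\<lambda>s'. sound_hops w (cell n (iarr s' ''hop'') w) \<and> reached w (cell n (iarr s' ''hop'') w) (Suc r) \<and>
       (\<forall>w'. w' \<noteq> w \<longrightarrow> cell n (iarr s' ''hop'') w' = H w'))"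
proof -
  let ?a = "\<lambda>l. fst (es ! l)" and ?c = "\<lambda>l. snd (es ! l)"
  let ?I = "\<lambda>k s'. sound_hops w (cell n (iarr s' ''hop'') w) \<and>
    (\<forall>w'. w' \<noteq> w \<longrightarrow> cell n (iarr s' ''hop'') w' = H w') \<and>
    (\<forall>u. 0 < H w u \<longrightarrow> 0 < cell n (iarr s' ''hop'') w u) \<and>
    (\<forall>l<k. 0 < H w (?a l) \<or> 0 < H w (?c l) \<longrightarrow>
       0 < cell n (iarr s' ''hop'') w (?a l) \<and> 0 < cell n (iarr s' ''hop'') w (?c l))"
  have "reach (For ''e'' ''m'' relax_edge) s (for_time m (ctime relax_edge)) (?I m)"
  proof (rule reach_For[where I = ?I])
    fix k s' assume k: "k < m" and I: "?I k s'" and e: "ivar s' ''e'' = int k"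
      and fr: "frame (For ''e'' ''m'' relax_edge) s s'"
    have en': "env s'" using env_frame[OF fr en] by (simp add: relax_edge_def)
    have ro': "rows s'" using rows_frame[OF fr ro] by (simp add: relax_edge_def)
    have w': "ivar s' ''w'' = int w" using frame_ivar[OF fr] w by (simp add: relax_edge_def)
    from I have so: "sound_hops w (cell n (iarr s' ''hop'') w)" by blast
    note rel = relax_edge[OF en' ro' w(1) w' k e refl refl so refl refl]
    have "?I (Suc k) (exec relax_edge s')"
      using I rel by (auto simp: less_Suc_eq)
    then show "reach relax_edge s' (ctime relax_edge) (\<lambda>s''. ?I (Suc k) (set_ivar ''e'' (int (Suc k)) s''))"
      by (intro reach_exec) (simp_all add: relax_edge_def)
  qed (use en h in \<open>simp_all add: env_def relax_edge_def \<open>H = _\<close>\<close>)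
  then show ?thesis
  proof (rule reach_mono)
    fix s' :: state assume I: "?I m s'"
    let ?H' = "cell n (iarr s' ''hop'')"
    have "0 < ?H' w u" if u: "u < n" "length (tpath u w) \<le> Suc (Suc r)" for u
    proof (cases "u = w")
      case True
      with I show ?thesis by (simp add: sound_hops_def)
    next
      case False
      note t = tpath_Cons[OF u(1) w(1) False]
      \<comment> \<open>The next hop was reached before this round, and the edge to it is scanned
        during the round.\<close>
      have "0 < H w (next_hop u w)" using r t u by (simp add: reached_def)
      moreover obtain l where "l < m" "{u, next_hop u w} = {?a l, ?c l}" using edge_nth[OF t(3)] .
      ultimately show ?thesis using I by (metis doubleton_eq_iff)
    qed
    with I show "sound_hops w (?H' w) \<and> reached w (?H' w) (Suc r) \<and> (\<forall>w'. w' \<noteq> w \<longrightarrow> ?H' w' = H w')"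
      by (simp add: reached_def)
  qed simp
qed

lemma compute_hops:
  assumes en: "env s" and ro: "rows s" and zero: "\<And>i. iarr s ''hop'' i = 0"
  shows "reach compute_hops s (for_time n (10 + for_time n (for_time n 70))) hops"
proof -
  let ?A = "IStore ''hop'' (entry (IVar ''w'') (IVar ''w'')) (IPlus (IVar ''w'') (ICon 1))"
  let ?R = "For ''e'' ''m'' relax_edge"
  let ?c = "Seq ?A (For ''r'' ''n'' ?R)"
  let ?T = "ctime ?A + for_time n (for_time m (ctime relax_edge))"
  let ?H = "\<lambda>s. cell n (iarr s ''hop'')"
  let ?I = "\<lambda>k s'. \<forall>w<n. if w < k then \<forall>u<n. ?H s' w u = int (next_hop u w) + 1 else \<forall>u. ?H s' w u = 0"
  have "reach compute_hops s (for_time n ?T) (?I n)"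
    unfolding compute_hops_def
  proof (rule reach_For[where I = ?I])
    fix w s1 assume w: "w < n" "ivar s1 ''w'' = int w" and I: "?I w s1" and fr: "frame (For ''w'' ''n'' ?c) s s1"
    have en1: "env s1" using env_frame[OF fr en] by (simp add: relax_edge_def)
    have ro1: "rows s1" using rows_frame[OF fr ro] by (simp add: relax_edge_def)
    let ?s2 = "exec ?A s1"
    have H2: "?H ?s2 w' u = (if w' = w \<and> u = w then int w + 1 else ?H s1 w' u)" for w' u
      using ro1 w by (simp add: entry_def rows_def cell_update)
    have sound2: "sound_hops w (?H ?s2 w)"
      using I w unfolding sound_hops_def H2 by (auto split: if_splits)
    have reached2: "reached w (?H ?s2 w) 0"
      unfolding reached_def
    proof (intro allI impI)
      fix u assume u: "u < n" "length (tpath u w) \<le> Suc 0"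
      have "u = w"
      proof (rule ccontr)
        assume "u \<noteq> w"
        from tpath_Cons[OF u(1) w(1) this] tpath(1)[of "next_hop u w" w] w u show False by auto
      qed
      then show "0 < ?H ?s2 w u" by (simp only: H2) simp
    qed
    let ?J = "\<lambda>r s'. sound_hops w (?H s' w) \<and> reached w (?H s' w) r \<and> (\<forall>w'. w' \<noteq> w \<longrightarrow> ?H s' w' = ?H s1 w')"
    have "reach (For ''r'' ''n'' ?R) ?s2 (for_time n (for_time m (ctime relax_edge))) (?J n)"
    proof (rule reach_For[where I = ?J])
      show "?J 0 (set_ivar ''r'' 0 ?s2)"
        using sound2 reached2 H2 by (simp add: fun_eq_iff)
    next
      fix r s' assume J: "?J r s'" and fr: "frame (For ''r'' ''n'' ?R) ?s2 s'"
      have "env ?s2" using en1 by (simp add: env_def)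
      from env_frame[OF fr this] have en': "env s'" by (simp add: relax_edge_def)
      have "rows ?s2" using ro1 by (simp add: rows_def)
      from rows_frame[OF fr this] have ro': "rows s'" by (simp add: relax_edge_def)
      have w': "ivar s' ''w'' = int w" using frame_ivar[OF fr] w by (simp add: relax_edge_def)
      from J have so: "sound_hops w (?H s' w)" and re: "reached w (?H s' w) r" by auto
      show "reach ?R s' (for_time m (ctime relax_edge)) (\<lambda>s''. ?J (Suc r) (set_ivar ''r'' (int (Suc r)) s''))"
        by (rule reach_mono[OF relax_round[OF en' ro' w(1) w' refl so re]]) (use J in auto)
    qed (use en1 in \<open>simp_all add: env_def relax_edge_def\<close>)
    then have "reach ?c s1 ?T (?J n)" by (intro reach_Seq_exec) simp_all
    then show "reach ?c s1 ?T (\<lambda>s''. ?I (Suc w) (set_ivar ''w'' (int (Suc w)) s''))"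
    proof (rule reach_mono)
      fix s' :: state assume J: "?J n s'"
      \<comment> \<open>No path has more than \<open>n\<close> vertices, so \<open>n\<close> rounds
        reach every vertex.\<close>
      have row: "?H s' w u = int (next_hop u w) + 1" if "u < n" for u
        using J that length_tpath_le[OF that w(1)] by (auto simp: sound_hops_def reached_def)
      have other: "?H s' w' = ?H s1 w'" if "w' \<noteq> w" for w' using J that by blast
      show "?I (Suc w) (set_ivar ''w'' (int (Suc w)) s')"
      proof (intro allI impI)
        fix w' assume "w' < n"
        with I row other[of w'] show "if w' < Suc w then \<forall>u<n. ?H (set_ivar ''w'' (int (Suc w)) s') w' u = int (next_hop u w') + 1
           else \<forall>u. ?H (set_ivar ''w'' (int (Suc w)) s') w' u = 0"
          by (cases "w' = w") auto
      qed
    qed simp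
  qed (use en zero in \<open>simp_all add: env_def relax_edge_def cell_def\<close>)
  then show ?thesis
  proof (rule reach_mono)
    have "ctime ?A \<le> 10" by (simp add: entry_def)
    moreover have "ctime relax_edge \<le> 70" by (simp add: relax_edge_def entry_def)
    ultimately show "for_time n ?T \<le> for_time n (10 + for_time n (for_time n 70))"
      by (intro for_time_mono add_mono m_le_n order.refl)
  qed (auto simp: hops_def cell_def)
qed

section \<open>Listing and matching the line ends\<close>

definition base :: "state \<Rightarrow> bool" where
  "base s \<longleftrightarrow> env s \<and> rows s \<and> hops s"

lemma base_frame:
  "frame c s s' \<Longrightarrow> base s \<Longrightarrow> {''n'', ''m''} \<inter> wvars c = {} \<Longrightarrow>
   {''src'', ''dst'', ''fmin'', ''row'', ''hop''} \<inter> warrs c = {} \<Longrightarrow> base s'"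
  by (simp add: base_def env_def rows_def hops_def frame_def)

lemma base_cong:
  "base s \<Longrightarrow> ivar s' ''n'' = ivar s ''n'' \<Longrightarrow> ivar s' ''m'' = ivar s ''m'' \<Longrightarrow>
   iarr s' ''src'' = iarr s ''src'' \<Longrightarrow> iarr s' ''dst'' = iarr s ''dst'' \<Longrightarrow> iarr s' ''fmin'' = iarr s ''fmin'' \<Longrightarrow>
   iarr s' ''row'' = iarr s ''row'' \<Longrightarrow> iarr s' ''hop'' = iarr s ''hop'' \<Longrightarrow> base s'"
  by (simp add: base_def env_def rows_def hops_def)

abbreviation "freqs s \<equiv> cell n (iarr s ''F'')"

definition listed :: "(nat \<Rightarrow> int) \<Rightarrow> nat list \<Rightarrow> state \<Rightarrow> bool" where
  "listed r xs s \<longleftrightarrow> ivar s ''q'' = int (length xs) \<and> ivar s ''S'' = sum_list (map r xs) \<and>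
     (\<forall>k<length xs. iarr s ''lst'' (int k) = int (xs ! k)) \<and>
     (\<forall>k\<le>length xs. iarr s ''cum'' (int k) = csum r xs k)"

lemma push_vertex:
  assumes b: "base s" and l: "listed (freqs s v) xs s"
    and u: "u < n" "ivar s ''u'' = int u" and v: "v < n" "ivar s ''v'' = int v" and g: "ivar s ''g'' = int g"
  shows "listed (freqs s v) (if next_hop v u = g then xs @ [u] else xs) (exec push_vertex s)"
proof -
  have h: "iarr s ''hop'' (int u * int n + int v) = int (next_hop v u) + 1"
    and r: "iarr s ''row'' (int u) = int u * int n" "iarr s ''row'' (int v) = int v * int n"
    using b u v by (auto simp: base_def hops_def rows_def)
  have F: "iarr s ''F'' (int v * int n + int u) = freqs s v u" using u v by (simp add: cell_def)
  show ?thesis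
  proof (cases "next_hop v u = g")
    case True
    have c: "csum (freqs s v) (xs @ [u]) (Suc (length xs)) = sum_list (map (freqs s v) xs) + freqs s v u"
      using csum_length[of "freqs s v" "xs @ [u]"] by simp
    show ?thesis
      using l True u v g h r F c
      by (auto simp: push_vertex_def entry_def listed_def nth_append less_Suc_eq le_Suc_eq add.commute)
  next
    case False
    then show ?thesis using l u v g h r by (auto simp: push_vertex_def entry_def listed_def)
  qed
qed

lemma push_group:
  assumes b: "base s" and l: "listed (freqs s v) (grouped v g) s" and M: "ivar s ''M'' = max_group v (freqs s v) g"
    and v: "v < n" "ivar s ''v'' = int v" and g: "ivar s ''g'' = int g"
  shows "reach push_group s (20 + for_time n 50) (\<lambda>s'. listed (freqs s v) (grouped v (Suc g)) s' \<and>
    ivar s' ''M'' = max_group v (freqs s v) (Suc g))"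
proof -
  let ?s1 = "exec (IAssign ''B'' (IVar ''S'')) s" and ?r = "freqs s v"
  let ?C = "Cond (ILess (IVar ''M'') (IMinus (IVar ''S'') (IVar ''B'')))
       (IAssign ''M'' (IMinus (IVar ''S'') (IVar ''B''))) Skip"
  let ?I = "\<lambda>k s'. listed ?r (grouped v g @ filter (\<lambda>q. next_hop v q = g) [0..<k]) s'"
  let ?Q = "\<lambda>s'. listed ?r (grouped v (Suc g)) s' \<and> ivar s' ''M'' = max_group v ?r (Suc g)"
  have "reach (For ''u'' ''n'' push_vertex) ?s1 (for_time n (ctime push_vertex)) (?I n)"
  proof (rule reach_For[where I = ?I])
    fix k s' assume k: "k < n" and I: "?I k s'" and u: "ivar s' ''u'' = int k"
      and fr: "frame (For ''u'' ''n'' push_vertex) ?s1 s'"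
    have b1: "base ?s1" by (rule base_cong[OF b]) simp_all
    have b': "base s'" using base_frame[OF fr b1] by (simp add: push_vertex_def)
    have F: "freqs s' = freqs s" using frame_iarr[OF fr, of "''F''"] by (simp add: push_vertex_def)
    have vg: "ivar s' ''v'' = int v" "ivar s' ''g'' = int g"
      using frame_ivar[OF fr] v g by (simp_all add: push_vertex_def)
    have "?I (Suc k) (exec push_vertex s')"
      using push_vertex[OF b' I[folded F] k u v(1) vg] by (cases "next_hop v k = g") (simp_all add: F)
    then show "reach push_vertex s' (ctime push_vertex) (\<lambda>s''. ?I (Suc k) (set_ivar ''u'' (int (Suc k)) s''))"
      by (intro reach_exec) (simp_all add: push_vertex_def listed_def)
  qed (use b l in \<open>simp_all add: base_def env_def push_vertex_def listed_def\<close>)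
  then have "reach (Seq (For ''u'' ''n'' push_vertex) ?C) ?s1 (for_time n (ctime push_vertex) + ctime ?C) ?Q"
  proof (rule reach_Seq)
    fix s' assume fr: "frame (For ''u'' ''n'' push_vertex) ?s1 s'" and I: "?I n s'"
    have B: "ivar s' ''B'' = sum_list (map ?r (grouped v g))"
      using frame_ivar[OF fr, of "''B''"] l by (simp add: push_vertex_def listed_def)
    have M': "ivar s' ''M'' = max_group v ?r g"
      using frame_ivar[OF fr, of "''M''"] M by (simp add: push_vertex_def)
    have l': "listed ?r (grouped v (Suc g)) s'" using I by (simp add: grouped_Suc group_list_def)
    then have "ivar s' ''S'' - ivar s' ''B'' = group_sum v ?r g"
      using B by (simp add: listed_def grouped_Suc group_sum_def)
    with l' M' show "reach ?C s' (ctime ?C) ?Q"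
      by (intro reach_exec) (auto simp: listed_def max_group_Suc)
  qed
  then have "reach push_group s (ctime (IAssign ''B'' (IVar ''S'')) + (for_time n (ctime push_vertex) + ctime ?C)) ?Q"
    unfolding push_group_def by (intro reach_Seq_exec) simp_all
  then show ?thesis
  proof (rule reach_mono)
    have "for_time n (ctime push_vertex) \<le> for_time n 50"
      by (intro for_time_mono) (simp_all add: push_vertex_def entry_def Bump_def Inc_def)
    then show "ctime (IAssign ''B'' (IVar ''S'')) + (for_time n (ctime push_vertex) + ctime ?C) \<le> 20 + for_time n 50"
      by simp
  qed
qed

lemma list_ends:
  assumes b: "base s" and v: "v < n" "ivar s ''v'' = int v"
  shows "reach list_ends s (10 + for_time n (20 + for_time n 50)) (\<lambda>s'. listed (freqs s v) (grouped v n) s' \<and>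
    ivar s' ''M'' = max_group v (freqs s v) n)"
proof -
  let ?A = "Seq (IAssign ''q'' (ICon 0)) (Seq (IAssign ''S'' (ICon 0))
       (Seq (IAssign ''M'' (ICon 0)) (IStore ''cum'' (ICon 0) (ICon 0))))"
  let ?s1 = "exec ?A s" and ?r = "freqs s v"
  let ?I = "\<lambda>g s'. listed ?r (grouped v g) s' \<and> ivar s' ''M'' = max_group v ?r g"
  have "reach (For ''g'' ''n'' push_group) ?s1 (for_time n (20 + for_time n 50)) (?I n)"
  proof (rule reach_For[where I = ?I])
    fix g s' assume I: "?I g s'" and g: "ivar s' ''g'' = int g" and fr: "frame (For ''g'' ''n'' push_group) ?s1 s'"
    have b1: "base ?s1" by (rule base_cong[OF b]) simp_all
    have b': "base s'" using base_frame[OF fr b1] by (simp add: push_group_def push_vertex_def)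
    have F: "freqs s' = freqs s"
      using frame_iarr[OF fr, of "''F''"] by (simp add: push_group_def push_vertex_def)
    have v': "ivar s' ''v'' = int v"
      using frame_ivar[OF fr] v by (simp add: push_group_def push_vertex_def)
    have I': "listed (freqs s' v) (grouped v g) s'" "ivar s' ''M'' = max_group v (freqs s' v) g"
      using I F by simp_all
    show "reach push_group s' (20 + for_time n 50) (\<lambda>s''. ?I (Suc g) (set_ivar ''g'' (int (Suc g)) s''))"
      by (rule reach_mono[OF push_group[OF b' I' v(1) v' g]]) (simp_all add: F listed_def)
  qed (use b in \<open>simp_all add: base_def env_def push_group_def push_vertex_def listed_def\<close>)
  then have "reach list_ends s (ctime ?A + for_time n (20 + for_time n 50)) (?I n)"
    unfolding list_ends_def by (intro reach_Seq_exec) simp_all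
  then show ?thesis by (rule reach_mono) simp_all
qed

lemma merge_lines:
  assumes b: "base s" and v: "v < n" "ivar s ''v'' = int v"
    and a: "a < n" "iarr s ''lst'' (ivar s ''i'') = int a" and c: "c < n" "iarr s ''lst'' (ivar s ''j'') = int c"
  defines "s' \<equiv> exec merge_lines s"
  shows "freqs s' = merge v a c (ivar s ''t'' - ivar s ''x'') (freqs s)" and "ivar s' ''x'' = ivar s ''t''"
    and "ivar s' ''i'' = ivar s ''i''" and "ivar s' ''j'' = ivar s ''j''"
proof -
  have r: "iarr s ''row'' (int v) = int v * int n" "iarr s ''row'' (int a) = int a * int n"
    "iarr s ''row'' (int c) = int c * int n"
    using b v a c by (auto simp: base_def rows_def)
  let ?w = "ivar s ''t'' - ivar s ''x''" and ?w' = "ivar s ''x'' - ivar s ''t''"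
  have "iarr s' ''F'' = add_at (add_at (add_at (add_at (add_at (add_at (iarr s ''F'')
      (int a * int n + int c) ?w) (int c * int n + int a) ?w) (int v * int n + int a) ?w')
      (int a * int n + int v) ?w') (int v * int n + int c) ?w') (int c * int n + int v) ?w'"
    using r v a c by (simp add: s'_def merge_lines_def entry_def)
  moreover have alg: "f + (t - x) * k1 + (t - x) * k2 + (x - t) * k3 + (x - t) * k4 + (x - t) * k5 + (x - t) * k6
      = f + (t - x) * (k1 + k2 - k3 - k4 - k5 - k6)" for f t x k1 k2 k3 k4 k5 k6 :: int
    by (simp add: algebra_simps)
  ultimately show "freqs s' = merge v a c ?w (freqs s)"
    using v(1) a(1) c(1) by (intro ext) (simp only: cell_add_at merge_def alg)
  show "ivar s' ''x'' = ivar s ''t''" "ivar s' ''i'' = ivar s ''i''" "ivar s' ''j'' = ivar s ''j''"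
    by (simp_all add: s'_def merge_lines_def)
qed

lemma match_step:
  assumes p: "pairing I n v U F0" and b: "base s" and v: "ivar s ''v'' = int v"
    and l: "listed (F0 v) (grouped v n) s" and D: "ivar s ''D'' = pairing.shift I v"
    and i: "ivar s ''i'' = int i" and j: "ivar s ''j'' = int j" "j < n"
    and mt: "pairing.matching I n v U F0 (freqs s) i j (ivar s ''x'')"
  shows "\<exists>i' j'. ivar (exec match_step s) ''i'' = int i' \<and> ivar (exec match_step s) ''j'' = int j' \<and>
    (i' = Suc i \<and> j' = j \<or> i' = i \<and> j' = Suc j) \<and>
    pairing.matching I n v U F0 (freqs (exec match_step s)) i' j' (ivar (exec match_step s) ''x'')"
proof -
  interpret pr: pairing I n v U F0 by (rule p)
  let ?y = "pr.pos (Suc i)" and ?z = "pr.pos (Suc j) - pr.shift" and ?xs = "grouped v n"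
  have i': "i < n" using mt by (simp add: pr.matching_def)
  let ?A = "Seq (IAssign ''y'' (IArr ''cum'' (IPlus (IVar ''i'') (ICon 1))))
         (Seq (IAssign ''z'' (IMinus (IArr ''cum'' (IPlus (IVar ''j'') (ICon 1))) (IVar ''D'')))
              (Cond (ILess (IVar ''y'') (IVar ''z'')) (IAssign ''t'' (IVar ''y'')) (IAssign ''t'' (IVar ''z''))))"
  let ?B = "Cond (ILess (IVar ''x'') (IVar ''t'')) merge_lines Skip"
  define s1 where "s1 = exec ?A s"
  define s2 where "s2 = exec ?B s1"
  have cum: "iarr s ''cum'' (int i + 1) = ?y" "iarr s ''cum'' (int j + 1) = pr.pos (Suc j)"
    using l i' j unfolding listed_def pr.len
    by (metis Suc_leI add.commute of_nat_Suc)+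
  have s1: "ivar s1 ''y'' = ?y" "ivar s1 ''z'' = ?z" "ivar s1 ''t'' = min ?y ?z" "ivar s1 ''x'' = ivar s ''x''"
    "ivar s1 ''i'' = int i" "ivar s1 ''j'' = int j" "ivar s1 ''v'' = int v" "iarr s1 = iarr s"
    using cum i j D v by (auto simp: s1_def)
  have b1: "base s1" by (rule base_cong[OF b]) (simp_all add: s1_def)
  have lst: "iarr s1 ''lst'' (ivar s1 ''i'') = int (?xs ! i)" "iarr s1 ''lst'' (ivar s1 ''j'') = int (?xs ! j)"
    using l i' j s1 by (simp_all add: listed_def pr.len)
  note ml = merge_lines[OF b1 pr.v(1) s1(7) pr.xs_less[OF i'] lst(1) pr.xs_less[OF j(2)] lst(2)]
  let ?F' = "if ivar s ''x'' < min ?y ?z then merge v (?xs ! i) (?xs ! j) (min ?y ?z - ivar s ''x'') (freqs s) else freqs s"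
  \<comment> \<open>\<open>x\<close> is overwritten only by a larger \<open>t\<close>, which gives
    the \<open>max\<close> of \<open>matching_step\<close>.\<close>
  have mx: "(if a < c then c else a) = max a c" for a c :: int by simp
  have "ivar s2 ''x'' = (if ivar s ''x'' < min ?y ?z then min ?y ?z else ivar s ''x'')"
    using ml s1 by (simp add: s2_def)
  also have "\<dots> = max (ivar s ''x'') (min ?y ?z)"
    using mx .
  finally have x2: "ivar s2 ''x'' = max (ivar s ''x'') (min ?y ?z)" .
  have s2: "freqs s2 = ?F'" "ivar s2 ''i'' = int i" "ivar s2 ''j'' = int j"
    using ml s1 by (simp_all add: s2_def)
  have yz: "ivar s2 ''y'' = ?y" "ivar s2 ''z'' = ?z"
  proof -
    have "ivar (exec merge_lines s1) ''y'' = ivar s1 ''y''" "ivar (exec merge_lines s1) ''z'' = ivar s1 ''z''"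
      by (simp_all add: merge_lines_def)
    then show "ivar s2 ''y'' = ?y" "ivar s2 ''z'' = ?z" using s1 by (simp_all add: s2_def)
  qed
  have ex: "exec match_step s = exec (Cond (ILess (IVar ''y'') (IVar ''z'')) (Inc ''i'') (Inc ''j'')) s2"
    by (simp only: match_step_def exec.simps(6) s2_def s1_def)
  note st = pr.matching_step[OF mt j(2)]
  show ?thesis
  proof (cases "?y < ?z")
    case True
    then show ?thesis using st(1) s2 x2 yz unfolding ex
      by (intro exI[of _ "Suc i"] exI[of _ j]) simp
  next
    case False
    then show ?thesis using st(2) s2 x2 yz unfolding ex
      by (intro exI[of _ i] exI[of _ "Suc j"]) simp
  qed
qed

lemma process_vertex:
  assumes b: "base s" and v: "v < n" "ivar s ''v'' = int v" and F: "valid {v..<n} (freqs s)"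
  shows "reach (Seq list_ends (Seq init_match (While (ILess (IVar ''j'') (IVar ''n'')) match_step))) s
    (10 + for_time n (20 + for_time n 50) + (50 + for_time (2 * n) 200))
    (\<lambda>s'. valid {Suc v..<n} (freqs s') \<and> total (freqs s') = total (freqs s) - 2 * pairs_at v)"
proof (rule reach_Seq[OF list_ends[OF b v]])
  fix s1 assume fr: "frame list_ends s s1"
    and L: "listed (freqs s v) (grouped v n) s1 \<and> ivar s1 ''M'' = max_group v (freqs s v) n"
  define F0 where "F0 = freqs s"
  have p: "pairing I n v {v..<n} F0" using v F by unfold_locales (auto simp: F0_def)
  interpret pr: pairing I n v "{v..<n}" F0 by (rule p)
  note fd = list_ends_def push_group_def push_vertex_def
  have b1: "base s1" using base_frame[OF fr b] by (simp add: fd)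
  have v1: "ivar s1 ''v'' = int v" using frame_ivar[OF fr] v by (simp add: fd)
  have F1: "freqs s1 = F0" using frame_iarr[OF fr, of "''F''"] by (simp add: fd F0_def)
  have M1: "ivar s1 ''M'' = max_load v" using L max_load_eq[OF pr.F0 pr.v(2,1)] by (simp add: F0_def)
  have S1: "ivar s1 ''S'' = load v"
    using L load_eq[OF pr.F0 pr.v(2,1)] by (simp add: F0_def listed_def)
  have l1: "listed (F0 v) (grouped v n) s1" using L by (simp add: F0_def)
  let ?s2 = "exec init_match s1"
  have s2: "ivar ?s2 ''D'' = pr.shift" "ivar ?s2 ''i'' = 0" "ivar ?s2 ''j'' = 0" "ivar ?s2 ''x'' = 0"
    "iarr ?s2 = iarr s1"
    using M1 S1 by (auto simp: init_match_def pr.shift_def)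
  let ?J = "\<lambda>s'. \<exists>i j. ivar s' ''i'' = int i \<and> ivar s' ''j'' = int j \<and> pr.matching (freqs s') i j (ivar s' ''x'')"
  let ?B = "ILess (IVar ''j'') (IVar ''n'')"
  \<comment> \<open>Every step advances one pointer and neither exceeds \<open>n\<close>, so a
    vertex takes at most \<open>2 * n\<close> steps.\<close>
  let ?\<mu> = "\<lambda>s. nat (2 * int n - ivar s ''i'' - ivar s ''j'')"
  note fm = match_step_def merge_lines_def
  have "reach (While ?B match_step) ?s2 (2 * n * (ctime match_step + btime ?B + 1) + btime ?B + 1)
      (\<lambda>s'. ?J s' \<and> \<not> bval ?B s')"
  proof (rule reach_While[where \<mu> = ?\<mu>])
    show "?J ?s2" using pr.matching_init s2 F1 by (intro exI[of _ 0]) simp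
    show "?\<mu> ?s2 \<le> 2 * n" using s2 by simp
  next
    fix s' assume fr: "frame match_step ?s2 s'" and J: "?J s'" and B: "bval ?B s'"
    have b2: "base ?s2" by (rule base_cong[OF b1]) (simp_all add: init_match_def)
    have b': "base s'" using base_frame[OF fr b2] by (simp add: fm)
    have v': "ivar s' ''v'' = int v" using frame_ivar[OF fr, of "''v''"] v1 by (simp add: fm init_match_def)
    have D': "ivar s' ''D'' = pr.shift" using frame_ivar[OF fr, of "''D''"] s2 by (simp add: fm)
    have l': "listed (F0 v) (grouped v n) s'"
      using frame_ivar[OF fr, of "''q''"] frame_ivar[OF fr, of "''S''"] frame_iarr[OF fr, of "''lst''"]
        frame_iarr[OF fr, of "''cum''"] l1 s2
      by (simp add: fm init_match_def listed_def)
    from J obtain i j where ij: "ivar s' ''i'' = int i" "ivar s' ''j'' = int j"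
      and mt: "pr.matching (freqs s') i j (ivar s' ''x'')" by auto
    have j: "j < n" using B ij b' by (simp add: base_def env_def)
    have i: "i < n" using mt by (simp add: pr.matching_def)
    from match_step[OF p b' v' l' D' ij(1,2) j mt] obtain i' j' where
      st: "ivar (exec match_step s') ''i'' = int i'" "ivar (exec match_step s') ''j'' = int j'"
        "i' = Suc i \<and> j' = j \<or> i' = i \<and> j' = Suc j"
        "pr.matching (freqs (exec match_step s')) i' j' (ivar (exec match_step s') ''x'')" by blast
    have "?\<mu> (exec match_step s') < ?\<mu> s'" using st(3) i j unfolding st(1,2) ij by auto
    then show "reach match_step s' (ctime match_step) (\<lambda>s''. ?J s'' \<and> ?\<mu> s'' < ?\<mu> s')"
      using st by (intro reach_exec) (auto simp: fm)
  qed
  then have "reach (Seq init_match (While ?B match_step)) s1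
      (ctime init_match + (2 * n * (ctime match_step + btime ?B + 1) + btime ?B + 1)) (\<lambda>s'. ?J s' \<and> \<not> bval ?B s')"
    by (intro reach_Seq_exec) (simp_all add: init_match_def)
  then show "reach (Seq init_match (While ?B match_step)) s1 (50 + for_time (2 * n) 200)
      (\<lambda>s'. valid {Suc v..<n} (freqs s') \<and> total (freqs s') = total (freqs s) - 2 * pairs_at v)"
  proof (rule reach_mono)
    have B3: "btime ?B = 3" by simp
    have "ctime match_step + btime ?B + 1 \<le> 200 + 8"
      by (simp add: fm entry_def Bump_def Inc_def)
    from mult_le_mono[OF order.refl[of "2 * n"] this]
    have "2 * n * (ctime match_step + btime ?B + 1) \<le> 2 * n * (200 + 8)" .
    moreover have "ctime init_match \<le> 40" by (simp add: init_match_def)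
    ultimately show "ctime init_match + (2 * n * (ctime match_step + btime ?B + 1) + btime ?B + 1) \<le> 50 + for_time (2 * n) 200"
      unfolding for_time_def B3 by linarith
  next
    fix s' assume fr: "frame (Seq init_match (While ?B match_step)) s1 s'" and J: "?J s' \<and> \<not> bval ?B s'"
    then obtain i j where ij: "ivar s' ''j'' = int j" and mt: "pr.matching (freqs s') i j (ivar s' ''x'')" by auto
    have "ivar s' ''n'' = int n"
      using frame_ivar[OF fr, of "''n''"] b1 by (simp add: fm init_match_def base_def env_def)
    with J ij mt have "j = n" by (simp add: pr.matching_def)
    moreover have "{v..<n} - {v} = {Suc v..<n}" by auto
    ultimately show "valid {Suc v..<n} (freqs s') \<and> total (freqs s') = total (freqs s) - 2 * pairs_at v"
      using pr.matching_final mt by (simp add: F0_def)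
  qed
qed

lemma process_vertices:
  assumes b: "base s" and F: "freqs s = edge_matrix" and nonneg: "\<And>e. e \<in> E \<Longrightarrow> 0 \<le> b e"
  shows "reach process_vertices s
    (for_time n (10 + for_time n (20 + for_time n 50) + (50 + for_time (2 * n) 200)))
    (\<lambda>s'. valid {} (freqs s') \<and> total (freqs s') = 2 * ((\<Sum>e\<in>E. b e) - (\<Sum>v<n. pairs_at v)))"
proof -
  note fd = list_ends_def push_group_def push_vertex_def match_step_def merge_lines_def init_match_def
  let ?c = "Seq list_ends (Seq init_match (While (ILess (IVar ''j'') (IVar ''n'')) match_step))"
  let ?T = "10 + for_time n (20 + for_time n 50) + (50 + for_time (2 * n) 200)"
  let ?I = "\<lambda>k s'. valid {k..<n} (freqs s') \<and> total (freqs s') = 2 * ((\<Sum>e\<in>E. b e) - (\<Sum>v<k. pairs_at v))"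
  have "reach process_vertices s (for_time n ?T) (?I n)"
    unfolding process_vertices_def
  proof (rule reach_For[where I = ?I])
    show "?I 0 (set_ivar ''v'' 0 s)"
      using valid_edge_matrix[OF nonneg] total_edge_matrix[OF nonneg] by (simp add: F)
  next
    fix v s' assume v: "v < n" "ivar s' ''v'' = int v" and I: "?I v s'" and fr: "frame (For ''v'' ''n'' ?c) s s'"
    have b': "base s'" using base_frame[OF fr b] by (simp add: fd)
    from I have F': "valid {v..<n} (freqs s')" by simp
    show "reach ?c s' ?T (\<lambda>s''. ?I (Suc v) (set_ivar ''v'' (int (Suc v)) s''))"
      by (rule reach_mono[OF process_vertex[OF b' v F']]) (use I in simp_all)
  qed (use b in \<open>simp_all add: base_def env_def fd\<close>)
  then show ?thesis by (rule reach_mono) simp_all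
qed

section \<open>Writing the lines out\<close>

definition path_prefix :: "nat list \<Rightarrow> state \<Rightarrow> bool" where
  "path_prefix zs s \<longleftrightarrow> ivar s ''pos'' = int (length zs) \<and> (\<forall>i<length zs. iarr s ''path'' (int i) = int (zs ! i))"

definition written :: "(nat \<Rightarrow> nat \<Rightarrow> int) \<Rightarrow> nat list list \<Rightarrow> state \<Rightarrow> bool" where
  "written F ps s \<longleftrightarrow> path_prefix (concat ps) s \<and> ivar s ''k'' = int (length ps) \<and>
     (\<forall>i\<le>length ps. iarr s ''start'' (int i) = int (length (concat (take i ps)))) \<and>
     (\<forall>i<length ps. iarr s ''freq'' (int i) = F (hd (ps ! i)) (last (ps ! i)))"

lemma push_path:
  "path_prefix zs s \<Longrightarrow> ivar s ''c'' = int c \<Longrightarrow> path_prefix (zs @ [c]) (exec push_path s)"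
  by (auto simp: path_prefix_def push_path_def nth_append less_Suc_eq)

lemma write_line:
  assumes b: "base s" and wr: "written (freqs s) ps s"
    and u: "u < n" "ivar s ''u'' = int u" and w: "w < n" "ivar s ''w'' = int w"
  shows "reach write_line s (for_time n 40 + 40) (written (freqs s) (ps @ [tpath u w]))"
proof -
  let ?A = "Seq (IStore ''freq'' (IVar ''k'') (IArr ''F'' (entry (IVar ''u'') (IVar ''w''))))
         (Seq (IAssign ''c'' (IVar ''u'')) push_path)"
  let ?B = "BNot (BAnd (BNot (ILess (IVar ''c'') (IVar ''w''))) (BNot (ILess (IVar ''w'') (IVar ''c''))))"
  let ?C = "Seq (IAssign ''c'' (IMinus (IArr ''hop'' (entry (IVar ''w'') (IVar ''c''))) (ICon 1))) push_path"
  let ?D = "Seq (Inc ''k'') (IStore ''start'' (IVar ''k'') (IVar ''pos''))"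
  let ?zs = "concat ps" and ?F = "freqs s"
  define s1 where "s1 = exec ?A s"
  have row: "iarr s ''row'' (int u) = int u * int n" using b u by (simp add: base_def rows_def)
  have s1: "ivar s1 ''c'' = int u" "ivar s1 ''w'' = int w" "ivar s1 ''k'' = int (length ps)"
    "iarr s1 ''freq'' = (iarr s ''freq'')(int (length ps) := ?F u w)" "iarr s1 ''start'' = iarr s ''start''"
    using u w wr row by (auto simp: s1_def push_path_def entry_def written_def cell_def)
  have b1: "base s1" by (rule base_cong[OF b]) (simp_all add: s1_def push_path_def)
  have p1: "path_prefix (?zs @ [u]) s1"
  proof -
    let ?s = "exec (Seq (IStore ''freq'' (IVar ''k'') (IArr ''F'' (entry (IVar ''u'') (IVar ''w''))))
         (IAssign ''c'' (IVar ''u''))) s"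
    have "path_prefix ?zs ?s" "ivar ?s ''c'' = int u" using wr u by (simp_all add: written_def path_prefix_def)
    from push_path[OF this] show ?thesis by (simp add: s1_def)
  qed
  \<comment> \<open>Everything up to and including \<open>x\<close> is written; what follows
    \<open>x\<close> on the path to \<open>w\<close> is missing, and the measure is the length of
    the path that remains from \<open>x\<close>.\<close>
  let ?J = "\<lambda>s'. \<exists>vs x. x < n \<and> tpath u w = vs @ tpath x w \<and> ivar s' ''c'' = int x \<and>
    path_prefix (?zs @ vs @ [x]) s'"
  let ?\<mu> = "\<lambda>s'. length (tpath (nat (ivar s' ''c'')) w)"
  have loop: "reach (While ?B ?C) s1 (n * (ctime ?C + btime ?B + 1) + btime ?B + 1) (\<lambda>s'. ?J s' \<and> \<not> bval ?B s')"
  proof (rule reach_While[where \<mu> = ?\<mu>])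
    show "?J s1" using u s1 p1 by (intro exI[of _ "[]"] exI[of _ u]) simp
    show "?\<mu> s1 \<le> n" using s1 u w length_tpath_le by simp
  next
    fix s' assume fr: "frame ?C s1 s'" and "?J s'" and B: "bval ?B s'"
    then obtain vs x where x: "x < n" "tpath u w = vs @ tpath x w" "ivar s' ''c'' = int x"
      "path_prefix (?zs @ vs @ [x]) s'" by blast
    have b': "base s'" using base_frame[OF fr b1] by (simp add: push_path_def)
    have w': "ivar s' ''w'' = int w" using frame_ivar[OF fr, of "''w''"] s1 by (simp add: push_path_def)
    have "x \<noteq> w" using B x w' by auto
    note t = tpath_Cons[OF x(1) w(1) this]
    let ?s = "exec (IAssign ''c'' (IMinus (IArr ''hop'' (entry (IVar ''w'') (IVar ''c''))) (ICon 1))) s'"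
    have "ivar ?s ''c'' = int (next_hop x w)"
      using b' w w' x by (simp add: entry_def base_def rows_def hops_def)
    moreover have "path_prefix (?zs @ vs @ [x]) ?s" using x by (simp add: path_prefix_def)
    ultimately have pp: "path_prefix ((?zs @ vs @ [x]) @ [next_hop x w]) (exec push_path ?s)"
      and c: "ivar (exec push_path ?s) ''c'' = int (next_hop x w)"
      using push_path by (blast, simp add: push_path_def)
    have ex: "exec ?C s' = exec push_path ?s" by simp
    have "?J (exec ?C s')"
      unfolding ex using pp c t x by (intro exI[of _ "vs @ [x]"] exI[of _ "next_hop x w"]) simp
    moreover have "?\<mu> (exec ?C s') < ?\<mu> s'"
      unfolding ex c x(3) using t by simp
    ultimately show "reach ?C s' (ctime ?C) (\<lambda>s''. ?J s'' \<and> ?\<mu> s'' < ?\<mu> s')"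
      by (intro reach_exec) (simp_all add: push_path_def)
  qed
  have "reach (Seq (While ?B ?C) ?D) s1 (n * (ctime ?C + btime ?B + 1) + btime ?B + 1 + ctime ?D)
    (written ?F (ps @ [tpath u w]))"
  proof (rule reach_Seq[OF loop])
    fix s' assume fr: "frame (While ?B ?C) s1 s'" and J: "?J s' \<and> \<not> bval ?B s'"
    then obtain vs x where x: "x < n" "tpath u w = vs @ tpath x w" "ivar s' ''c'' = int x"
      "path_prefix (?zs @ vs @ [x]) s'" by blast
    have w': "ivar s' ''w'' = int w" using frame_ivar[OF fr, of "''w''"] s1 by (simp add: push_path_def)
    have "x = w" using J x w' by auto
    with x w have pp: "path_prefix (?zs @ tpath u w) s'" by simp
    have k: "ivar s' ''k'' = int (length ps)" using frame_ivar[OF fr, of "''k''"] s1 by (simp add: push_path_def)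
    have fq: "iarr s' ''freq'' = (iarr s ''freq'')(int (length ps) := ?F u w)"
      using frame_iarr[OF fr, of "''freq''"] s1 by (simp add: push_path_def)
    have st: "iarr s' ''start'' = iarr s ''start''"
      using frame_iarr[OF fr, of "''start''"] s1 by (simp add: push_path_def)
    have "written ?F (ps @ [tpath u w]) (exec ?D s')"
      using pp k fq st wr tpath[OF u(1) w(1)]
      by (auto simp: written_def path_prefix_def nth_append less_Suc_eq le_Suc_eq add.commute)
    then show "reach ?D s' (ctime ?D) (written ?F (ps @ [tpath u w]))"
      by (intro reach_exec) simp_all
  qed
  then have "reach write_line s (ctime ?A + (n * (ctime ?C + btime ?B + 1) + btime ?B + 1 + ctime ?D))
      (written ?F (ps @ [tpath u w]))"
    unfolding write_line_def s1_def by (intro reach_Seq_exec) (simp_all add: push_path_def)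
  then show ?thesis
  proof (rule reach_mono)
    have "ctime ?C + btime ?B + 1 \<le> 40 + 8" by (simp add: push_path_def entry_def Inc_def)
    from mult_le_mono[OF order.refl[of n] this]
    have "n * (ctime ?C + btime ?B + 1) \<le> n * (40 + 8)" .
    moreover have "ctime ?A + btime ?B + 1 + ctime ?D \<le> 46" by (simp add: push_path_def entry_def Inc_def)
    ultimately show "ctime ?A + (n * (ctime ?C + btime ?B + 1) + btime ?B + 1 + ctime ?D) \<le> for_time n 40 + 40"
      unfolding for_time_def by linarith
  qed
qed

text \<open>The order in which the two output loops visit the pairs, one orientation per
  line.\<close>

definition pairs_below :: "nat \<Rightarrow> (nat \<times> nat) list" where
  "pairs_below k = concat (map (\<lambda>u. map (Pair u) [0..<u]) [0..<k])"

abbreviation "tpaths \<equiv> map (\<lambda>(u, w). tpath u w)"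

lemma pairs_below_Suc: "pairs_below (Suc k) = pairs_below k @ map (Pair k) [0..<k]"
  by (simp add: pairs_below_def)

lemma set_pairs_below: "set (pairs_below k) = {(u, w). w < u \<and> u < k}"
  by (auto simp: pairs_below_def)

lemma distinct_pairs_below: "distinct (pairs_below k)"
  by (induction k)
     (auto simp: pairs_below_Suc set_pairs_below distinct_map inj_on_def, simp add: pairs_below_def)

lemma write_lines:
  assumes b: "base s"
  shows "reach write_lines s (10 + for_time n (for_time n (for_time n 40 + 40)))
    (written (freqs s) (tpaths (pairs_below n)))"
proof -
  let ?A = "Seq (IAssign ''k'' (ICon 0)) (Seq (IAssign ''pos'' (ICon 0)) (IStore ''start'' (ICon 0) (ICon 0)))"
  let ?s1 = "exec ?A s" and ?F = "freqs s"
  let ?L = "For ''w'' ''u'' write_line"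
  let ?T = "for_time n 40 + 40"
  let ?I = "\<lambda>u. written ?F (tpaths (pairs_below u))"
  note fd = write_line_def push_path_def
  have b1: "base ?s1" by (rule base_cong[OF b]) simp_all
  have "reach (For ''u'' ''n'' ?L) ?s1 (for_time n (for_time n ?T)) (?I n)"
  proof (rule reach_For[where I = ?I])
    fix u s' assume u: "u < n" "ivar s' ''u'' = int u" and I: "?I u s'" and fr: "frame (For ''u'' ''n'' ?L) ?s1 s'"
    have b': "base s'" using base_frame[OF fr b1] by (simp add: fd)
    have F': "freqs s' = ?F" using frame_iarr[OF fr, of "''F''"] by (simp add: fd)
    let ?J = "\<lambda>w. written ?F (tpaths (pairs_below u @ map (Pair u) [0..<w]))"
    have "reach ?L s' (for_time u ?T) (?J u)"
    proof (rule reach_For[where I = ?J])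
      fix w s'' assume w: "w < u" "ivar s'' ''w'' = int w" and J: "?J w s''" and fr2: "frame ?L s' s''"
      have b'': "base s''" using base_frame[OF fr2 b'] by (simp add: fd)
      have F'': "freqs s'' = ?F" using frame_iarr[OF fr2, of "''F''"] F' by (simp add: fd)
      have u'': "ivar s'' ''u'' = int u" using frame_ivar[OF fr2, of "''u''"] u by (simp add: fd)
      have wn: "w < n" using w u by simp
      from J have J': "written (freqs s'') (tpaths (pairs_below u @ map (Pair u) [0..<w])) s''" by (simp only: F'')
      show "reach write_line s'' ?T (\<lambda>s3. ?J (Suc w) (set_ivar ''w'' (int (Suc w)) s3))"
        by (rule reach_mono[OF write_line[OF b'' J' u(1) u'' wn w(2)]])
           (simp_all add: F'' written_def path_prefix_def)
    qed (use u I in \<open>simp_all add: fd written_def path_prefix_def\<close>)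
    then show "reach ?L s' (for_time n ?T) (\<lambda>s''. ?I (Suc u) (set_ivar ''u'' (int (Suc u)) s''))"
      by (rule reach_mono) (use u in \<open>auto simp: pairs_below_Suc written_def path_prefix_def intro!: for_time_mono\<close>)
  qed (use b in \<open>simp_all add: base_def env_def fd written_def path_prefix_def pairs_below_def\<close>)
  then have "reach write_lines s (ctime ?A + for_time n (for_time n ?T)) (?I n)"
    unfolding write_lines_def by (intro reach_Seq_exec) simp_all
  then show ?thesis by (rule reach_mono) simp_all
qed

section \<open>From the final state to the theorem\<close>

text \<open>Frequencies belong to subgraphs, while the matrix is indexed by ends;
  \<open>inj_on_lines\<close> lets \<open>inv_into\<close> recover the ends, and \<open>nat\<close>
  loses nothing as valid matrices are nonnegative.\<close>

lemma written_solves: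
  assumes wr: "written F (tpaths (pairs_below n)) s" and F: "valid U F"
    and tot: "total F = 2 * ((\<Sum>e\<in>E. b e) - (\<Sum>v<n. pairs_at v))"
    and feas: "ivar s ''feasible'' = 1"
  shows "solves_LPAL s I"
proof -
  let ?ps = "tpaths (pairs_below n)" and ?l = "\<lambda>(u, w). line_of (tpath u w)"
  let ?P = "{(u, w). w < u \<and> u < n}"
  define L where "L = ?l ` ?P"
  define f where "f l = nat (case inv_into ?P ?l l of (u, w) \<Rightarrow> F u w)" for l
  have inv: "inv_into ?P ?l (?l z) = z" if "z \<in> ?P" for z
    by (rule inv_into_f_f[OF inj_on_lines that])
  have f: "int (f (line_of (tpath u w))) = F u w" if "w < u" "u < n" for u w
    using inv[of "(u, w)"] that F by (simp add: f_def valid_def)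
  have opt: "optimal I L f" by (rule optimal_matrix[OF F tot L_def f])
  have "outputs s (network I) L f"
    unfolding outputs_def
  proof (intro exI[of _ ?ps] conjI ballI allI impI)
    fix p assume "p \<in> set ?ps"
    then show "simple_path (network I) p" using simple_tpath by (auto simp: set_pairs_below)
  next
    have eq: "map line_of ?ps = map ?l (pairs_below n)" by auto
    show "distinct (map line_of ?ps)" "L = set (map line_of ?ps)"
      unfolding eq using inj_on_lines distinct_pairs_below[of n]
      by (simp_all add: distinct_map set_pairs_below L_def)
  next
    show "ivar s ''k'' = int (length ?ps)" using wr by (simp add: written_def)
  next
    fix i assume i: "i < length ?ps"
    obtain u w where uw: "pairs_below n ! i = (u, w)" by fastforce
    have "(u, w) \<in> set (pairs_below n)" using i uw by (metis length_map nth_mem)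
    then have lt: "w < u" "u < n" "w < n" by (auto simp: set_pairs_below)
    have p: "?ps ! i = tpath u w" using i uw by simp
    have "iarr s ''freq'' (int i) = F (hd (?ps ! i)) (last (?ps ! i))"
      using wr i unfolding written_def by blast
    then show "iarr s ''freq'' (int i) = int (f (line_of (?ps ! i)))"
      using p tpath[of u w] lt f by simp
    have start: "iarr s ''start'' (int l) = int (length (concat (take l ?ps)))" if "l \<le> length ?ps" for l
      using wr that unfolding written_def by blast
    have take: "take (Suc i) ?ps = take i ?ps @ [?ps ! i]" using i by (rule take_Suc_conv_app_nth)
    show "iarr s ''start'' (int i + 1) = iarr s ''start'' (int i) + int (length (?ps ! i))"
      using start[of "Suc i"] start[of i] i unfolding take by (simp add: add.commute)
    fix j assume j: "j < length (?ps ! i)"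
    have eq: "concat ?ps = concat (take i ?ps) @ ?ps ! i @ concat (drop (Suc i) ?ps)"
      using id_take_nth_drop[OF i] by (metis concat.simps(2) concat_append)
    let ?k = "length (concat (take i ?ps)) + j"
    have "concat ?ps ! ?k = ?ps ! i ! j" using j by (subst eq) (simp add: nth_append)
    moreover have "?k < length (concat ?ps)" using j by (subst eq) simp
    then have "iarr s ''path'' (int ?k) = int (concat ?ps ! ?k)"
      using wr unfolding written_def path_prefix_def by blast
    ultimately show "iarr s ''path'' (iarr s ''start'' (int i) + int j) = int (?ps ! i ! j)"
      using start[of i] i by simp
  qed
  with opt feas show ?thesis unfolding solves_LPAL_def optimal_def by auto
qed

lemma program_correct:
  "reach lpal_program (input_state I es) (program_time n) (\<lambda>s. solves_LPAL s I)"
proof -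
  let ?s0 = "input_state I es"
  let ?main = "Seq init_rows (Seq init_freqs (Seq compute_hops (Seq process_vertices write_lines)))"
  note fd = check_demands_def init_rows_def init_freqs_def compute_hops_def relax_edge_def
    process_vertices_def list_ends_def push_group_def push_vertex_def init_match_def match_step_def
    merge_lines_def write_lines_def write_line_def push_path_def
  show ?thesis
    unfolding lpal_program_def program_time_def
  proof (rule reach_Seq[OF check_demands[OF env_input]])
    fix s1 assume fr1: "frame check_demands ?s0 s1"
      and f1: "ivar s1 ''feasible'' = (if \<forall>e\<in>E. 0 \<le> b e then 1 else 0)"
    have env1: "env s1" using env_frame[OF fr1 env_input] by (simp add: fd)
    have zero: "iarr s1 ''F'' i = 0" "iarr s1 ''hop'' i = 0" for i
      using frame_iarr[OF fr1, of "''F''"] frame_iarr[OF fr1, of "''hop''"] by (simp_all add: fd input_state_def)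
    let ?T = "2 + for_time n 10 + (for_time n 40 + (for_time n (10 + for_time n (for_time n 70)) +
      (for_time n (10 + for_time n (20 + for_time n 50) + (50 + for_time (2 * n) 200)) +
      (10 + for_time n (for_time n (for_time n 40 + 40))))))"
    let ?B = "ILess (ICon 0) (IVar ''feasible'')"
    have "reach (Cond ?B ?main Skip) s1 (btime ?B + 1 + ?T) (\<lambda>s. solves_LPAL s I)"
    proof (rule reach_Cond)
      assume "bval ?B s1"
      then have nonneg: "\<And>e. e \<in> E \<Longrightarrow> 0 \<le> b e" and feas1: "ivar s1 ''feasible'' = 1"
        using f1 by (auto split: if_splits)
      show "reach ?main s1 ?T (\<lambda>s. solves_LPAL s I)"
      proof (rule reach_Seq[OF init_rows[OF env1]])
        fix s2 assume fr2: "frame init_rows s1 s2" and rows2: "rows s2"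
        have env2: "env s2" using env_frame[OF fr2 env1] by (simp add: fd)
        have zero2: "iarr s2 ''F'' i = 0" "iarr s2 ''hop'' i = 0" for i
          using frame_iarr[OF fr2, of "''F''"] frame_iarr[OF fr2, of "''hop''"] zero by (simp_all add: fd)
        show "reach (Seq init_freqs (Seq compute_hops (Seq process_vertices write_lines))) s2
          (for_time n 40 + (for_time n (10 + for_time n (for_time n 70)) +
          (for_time n (10 + for_time n (20 + for_time n 50) + (50 + for_time (2 * n) 200)) +
          (10 + for_time n (for_time n (for_time n 40 + 40)))))) (\<lambda>s. solves_LPAL s I)"
        proof (rule reach_Seq[OF init_freqs[OF env2 rows2 zero2(1)]])
          fix s3 assume fr3: "frame init_freqs s2 s3" and F3: "freqs s3 = edge_matrix"
          have env3: "env s3" using env_frame[OF fr3 env2] by (simp add: fd)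
          have rows3: "rows s3" using rows_frame[OF fr3 rows2] by (simp add: fd)
          have zero3: "iarr s3 ''hop'' i = 0" for i
            using frame_iarr[OF fr3, of "''hop''"] zero2 by (simp add: fd)
          show "reach (Seq compute_hops (Seq process_vertices write_lines)) s3
            (for_time n (10 + for_time n (for_time n 70)) +
            (for_time n (10 + for_time n (20 + for_time n 50) + (50 + for_time (2 * n) 200)) +
            (10 + for_time n (for_time n (for_time n 40 + 40))))) (\<lambda>s. solves_LPAL s I)"
          proof (rule reach_Seq[OF compute_hops[OF env3 rows3 zero3]])
            fix s4 assume fr4: "frame compute_hops s3 s4" and hops4: "hops s4"
            have base4: "base s4"
              using env_frame[OF fr4 env3] rows_frame[OF fr4 rows3] hops4 by (simp add: fd base_def)
            have F4: "freqs s4 = edge_matrix" using frame_iarr[OF fr4, of "''F''"] F3 by (simp add: fd)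
            show "reach (Seq process_vertices write_lines) s4
              (for_time n (10 + for_time n (20 + for_time n 50) + (50 + for_time (2 * n) 200)) +
              (10 + for_time n (for_time n (for_time n 40 + 40)))) (\<lambda>s. solves_LPAL s I)"
            proof (rule reach_Seq[OF process_vertices[OF base4 F4 nonneg]])
              fix s5 assume fr5: "frame process_vertices s4 s5"
                and F5: "valid {} (freqs s5) \<and> total (freqs s5) = 2 * ((\<Sum>e\<in>E. b e) - (\<Sum>v<n. pairs_at v))"
              have base5: "base s5" using base_frame[OF fr5 base4] by (simp add: fd)
              have feas5: "ivar s5 ''feasible'' = 1"
                using frame_ivar[OF fr5, of "''feasible''"] frame_ivar[OF fr4, of "''feasible''"]
                  frame_ivar[OF fr3, of "''feasible''"] frame_ivar[OF fr2, of "''feasible''"] feas1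
                by (simp add: fd)
              show "reach write_lines s5 (10 + for_time n (for_time n (for_time n 40 + 40))) (\<lambda>s. solves_LPAL s I)"
              proof (rule reach_mono[OF write_lines[OF base5] order.refl])
                fix s6 assume fr6: "frame write_lines s5 s6" and wr: "written (freqs s5) (tpaths (pairs_below n)) s6"
                have "ivar s6 ''feasible'' = 1"
                  using frame_ivar[OF fr6, of "''feasible''"] feas5 by (simp add: fd)
                with wr F5 show "solves_LPAL s6 I" by (intro written_solves) auto
              qed
            qed
          qed
        qed
      qed
    next
      assume "\<not> bval ?B s1"
      then have neg: "\<not> (\<forall>e\<in>E. 0 \<le> b e)" and "ivar s1 ''feasible'' = 0"
        using f1 by (auto split: if_splits)
      moreover have "\<not> (\<exists>L f. feasible I L f)" using neg feasible_imp_nonneg by blast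
      ultimately have "solves_LPAL s1 I" by (simp add: solves_LPAL_def)
      then show "reach Skip s1 ?T (\<lambda>s. solves_LPAL s I)"
        by (intro reach_mono[OF reach_exec]) simp_all
    qed
    then show "reach (Cond ?B ?main Skip) s1 (4 + ?T) (\<lambda>s. solves_LPAL s I)" by simp
  qed
qed

end

theorem theorem13:
  "\<exists>(alg :: com) (T :: nat \<Rightarrow> nat).
     (\<lambda>n. real (T n)) \<in> O(\<lambda>n. real n ^ 3) \<and>
     (\<forall>(I :: nat lp_instance) (es :: (nat \<times> nat) list) (n :: nat).
        lp_instance I \<and> tree (network I) \<and> fst (network I) = {..<n} \<and> edge_listing (network I) es \<and>
        d_fix I = 0 \<and> (\<forall>e \<in> snd (network I). f_min I e = f_max I e) \<longrightarrow>
        (\<exists>t s. runs alg (input_state I es) t s \<and> t \<le> T n \<and> solves_LPAL s I))"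
proof (intro exI[of _ lpal_program] exI[of _ program_time] conjI allI impI)
  show "(\<lambda>n. real (program_time n)) \<in> O(\<lambda>n. real n ^ 3)"
  proof (intro bigoI eventually_sequentiallyI)
    \<comment> \<open>The bound starts at \<open>1\<close>, since \<open>program_time 0\<close> is
      positive.\<close>
    fix k :: nat assume "1 \<le> k"
    then have "real (program_time k) \<le> real (1000 * k ^ 3)"
      by (intro of_nat_mono program_time_le)
    then show "norm (real (program_time k)) \<le> 1000 * norm (real k ^ 3)" by simp
  qed
next
  fix I :: "nat lp_instance" and es :: "(nat \<times> nat) list" and n :: nat
  assume "lp_instance I \<and> tree (network I) \<and> fst (network I) = {..<n} \<and> edge_listing (network I) es \<and>
    d_fix I = 0 \<and> (\<forall>e \<in> snd (network I). f_min I e = f_max I e)"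
  then interpret lp_run I n es by unfold_locales auto
  from program_correct show "\<exists>t s. runs lpal_program (input_state I es) t s \<and> t \<le> program_time n \<and> solves_LPAL s I"
    by (auto simp: reach_def)
qed

end
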